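(* Let $\Gamma=(\mathsf{V},\mathsf{E})$ be a finite simple graph with non-empty vertex set, and let $G_{\Gamma}=\langle v\in \mathsf{V}\mid vw=wv \text{ if } \{v,w\}\in \mathsf{E}\rangle$ be the associated right-angled Artin group. Then the Alexander polynomial $\Delta_{G_\Gamma}$ is non-constant (that is, not equal, up to a unit of the Laurent polynomial ring, to an integer constant, where $0$ counts as a constant) if and only if $\Gamma$ has connectivity $\kappa(\Gamma)=1$, meaning that $\Gamma$ is connected and there is a vertex $v\in\mathsf{V}$ such that the induced subgraph of $\Gamma$ on $\mathsf{V}\setminus\{v\}$ is disconnected.
   Context: A graph is disconnected if it has at least two connected components (so the empty graph and the one-vertex graph are not disconnected). Alexander polynomial: for a finitely generated group $G$, let $H=H_1(G,\mathbb{Z})/\text{torsion}\cong\mathbb{Z}^n$, $n=b_1(G)$, so $\mathbb{Z}H\cong \mathbb{Z}[t_1^{\pm1},\dots,t_n^{\pm1}]$. Let $X$ be a connected CW-complex with one $0$-cell $x_0$, finitely many $1$-cells, and $\pi_1(X,x_0)=G$; let $\pi\colon X'\to X$ be the regular cover corresponding to the projection $G\to H$. The Alexander module is the $\mathbb{Z}H$-module $A_G=H_1(X',\pi^{-1}(x_0),\mathbb{Z})$, which depends only on $G$. For a finitely generated module $M$ over a Noetherian UFD $R$ with presentation $R^m\xrightarrow{\Phi}R^q\to M\to 0$, the elementary ideal $E_i(M)$ is generated by the minors of size $q-i$ of $\Phi$ (with $E_i(M)=R$ if $i\ge q$ and $E_i(M)=0$ if $q-i>m$). The Alexander polynomial is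 $\Delta_G=\gcd(E_1(A_G))\in\mathbb{Z}H$, well-defined up to units of $\mathbb{Z}H$. *)

theory Defs
  imports
    "HOL-Homology.Homology"
    "Jordan_Normal_Form.Determinant"
    "Jordan_Normal_Form.DL_Submatrix"
begin

section \<open>Graphs\<close>

definition simple_graph :: "'v set \<Rightarrow> 'v set set \<Rightarrow> bool" where
  "simple_graph V E \<longleftrightarrow> (\<forall>e\<in>E. \<exists>v\<in>V. \<exists>w\<in>V. v \<noteq> w \<and> e = {v, w})"

definition reachable :: "'v set \<Rightarrow> 'v set set \<Rightarrow> ('v \<times> 'v) set" where
  "reachable V E = {(u, w). u \<in> V \<and> w \<in> V \<and> (u, w) \<in> {(a, b). {a, b} \<in> E}\<^sup>*}"

definition graph_components :: "'v set \<Rightarrow> 'v set set \<Rightarrow> 'v set set" where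
  "graph_components V E = V // reachable V E"

definition connected_graph :: "'v set \<Rightarrow> 'v set set \<Rightarrow> bool" where
  "connected_graph V E \<longleftrightarrow> card (graph_components V E) = 1"

definition disconnected_graph :: "'v set \<Rightarrow> 'v set set \<Rightarrow> bool" where
  "disconnected_graph V E \<longleftrightarrow> card (graph_components V E) \<ge> 2"

definition induced_edges :: "'v set set \<Rightarrow> 'v set \<Rightarrow> 'v set set" where
  "induced_edges E W = {e \<in> E. e \<subseteq> W}"

definition connectivity_one :: "'v set \<Rightarrow> 'v set set \<Rightarrow> bool" where
  "connectivity_one V E \<longleftrightarrow> connected_graph V E \<and>
     (\<exists>v\<in>V. disconnected_graph (V - {v}) (induced_edges E (V - {v})))"


section \<open>Group presentations and right-angled Artin groups\<close>

text \<open>A letter \<open>(s, True)\<close> is the generator \<open>s\<close>, and \<open>(s, False)\<close> is its formal inverse.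
  The relators are pairs of words, \<open>(u, w)\<close> standing for the relation \<open>u = w\<close>.\<close>

type_synonym 's word = "('s \<times> bool) list"

inductive word_eq :: "'s set \<Rightarrow> ('s word \<times> 's word) set \<Rightarrow> 's word \<Rightarrow> 's word \<Rightarrow> bool"
  for S R where
  refl: "u \<in> lists (S \<times> UNIV) \<Longrightarrow> word_eq S R u u"
| sym: "word_eq S R u w \<Longrightarrow> word_eq S R w u"
| trans: "word_eq S R u v \<Longrightarrow> word_eq S R v w \<Longrightarrow> word_eq S R u w"
| append: "word_eq S R u u' \<Longrightarrow> word_eq S R w w' \<Longrightarrow> word_eq S R (u @ w) (u' @ w')"
| cancel: "s \<in> S \<Longrightarrow> word_eq S R [(s, b), (s, \<not> b)] []"
| relation: "(u, w) \<in> R \<Longrightarrow> word_eq S R u w"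

definition presented_group :: "'s set \<Rightarrow> ('s word \<times> 's word) set \<Rightarrow> 's word set monoid" where
  "presented_group S R =
     \<lparr>carrier = lists (S \<times> UNIV) // {(u, w). word_eq S R u w},
      monoid.mult = (\<lambda>A B. {x. \<exists>u\<in>A. \<exists>w\<in>B. word_eq S R (u @ w) x}),
      one = {x. word_eq S R [] x}\<rparr>"

definition raag :: "'v set \<Rightarrow> 'v set set \<Rightarrow> 'v word set monoid" where
  "raag V E = presented_group V
     {([(v, True), (w, True)], [(w, True), (v, True)]) | v w. {v, w} \<in> E}"


section \<open>First homology modulo torsion\<close>

definition first_homology :: "'g monoid \<Rightarrow> 'g set monoid" where
  "first_homology G = G Mod derived G (carrier G)"

definition torsion_elements :: "'g monoid \<Rightarrow> 'g set" where
  "torsion_elements A = {a \<in> carrier A. \<exists>k::nat. k > 0 \<and> a [^]\<^bsub>A\<^esub> k = \<one>\<^bsub>A\<^esub>}"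

definition free_homology :: "'g monoid \<Rightarrow> 'g set set monoid" where
  "free_homology G = first_homology G Mod torsion_elements (first_homology G)"

definition free_homology_proj :: "'g monoid \<Rightarrow> 'g \<Rightarrow> 'g set set" where
  "free_homology_proj G g =
     torsion_elements (first_homology G) #>\<^bsub>first_homology G\<^esub> (derived G (carrier G) #>\<^bsub>G\<^esub> g)"

definition additive_group :: "'h::ab_group_add monoid" where
  "additive_group = \<lparr>carrier = UNIV, monoid.mult = (+), one = 0\<rparr>"


section \<open>Fundamental group\<close>

definition loops_at :: "'a::topological_space set \<Rightarrow> 'a \<Rightarrow> (real \<Rightarrow> 'a) set" where
  "loops_at X x = {\<gamma>. path \<gamma> \<and> path_image \<gamma> \<subseteq> X \<and> pathstart \<gamma> = x \<and> pathfinish \<gamma> = x}"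

definition path_class :: "'a::topological_space set \<Rightarrow> (real \<Rightarrow> 'a) \<Rightarrow> (real \<Rightarrow> 'a) set" where
  "path_class X \<gamma> = {\<delta>. homotopic_paths X \<gamma> \<delta>}"

definition fundamental_group ::
    "'a::topological_space set \<Rightarrow> 'a \<Rightarrow> (real \<Rightarrow> 'a) set monoid" where
  "fundamental_group X x =
     \<lparr>carrier = path_class X ` loops_at X x,
      monoid.mult = (\<lambda>A B. {\<delta>. \<exists>\<alpha>\<in>A. \<exists>\<beta>\<in>B. homotopic_paths X (\<alpha> +++ \<beta>) \<delta>}),
      one = path_class X (\<lambda>_. x)\<rparr>"


section \<open>CW-complexes\<close>

definition unit_disc :: "nat \<Rightarrow> (nat \<Rightarrow> real) set" where
  "unit_disc n = {x. (\<forall>i\<ge>n. x i = 0) \<and> (\<Sum>i<n. (x i)\<^sup>2) \<le> 1}"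

definition open_unit_disc :: "nat \<Rightarrow> (nat \<Rightarrow> real) set" where
  "open_unit_disc n = {x. (\<forall>i\<ge>n. x i = 0) \<and> (\<Sum>i<n. (x i)\<^sup>2) < 1}"

text \<open>\<open>C n\<close> is the set of characteristic maps of the \<open>n\<close>-cells; they are only relevant on
  \<open>unit_disc n\<close>, and \<open>disjoint\<close> forces each cell to have exactly one of them in \<open>C n\<close>.
  The closure of the cell of \<open>f\<close> is \<open>f ` unit_disc n\<close>. The converse of \<open>weak_topology\<close> holds
  because these closures are compact and \<open>X\<close> is Hausdorff.\<close>

locale cw_complex =
  fixes X :: "'a::t2_space set" and C :: "nat \<Rightarrow> ((nat \<Rightarrow> real) \<Rightarrow> 'a) set"
  assumes continuous: "f \<in> C n \<Longrightarrow>
      continuous_map (subtopology (Euclidean_space n) (unit_disc n)) (top_of_set X) f"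
    and embedding: "f \<in> C n \<Longrightarrow>
      embedding_map (subtopology (Euclidean_space n) (open_unit_disc n)) (top_of_set X) f"
    and disjoint: "f \<in> C n \<Longrightarrow> g \<in> C m \<Longrightarrow> (n, f) \<noteq> (m, g) \<Longrightarrow>
      f ` open_unit_disc n \<inter> g ` open_unit_disc m = {}"
    and cover: "(\<Union>n. \<Union>f\<in>C n. f ` open_unit_disc n) = X"
    and closure_finite: "f \<in> C n \<Longrightarrow>
      \<exists>F. finite F \<and> (\<forall>(m, g)\<in>F. m < n \<and> g \<in> C m) \<and>
        f ` (unit_disc n - open_unit_disc n) \<subseteq> (\<Union>(m, g)\<in>F. g ` open_unit_disc m)"
    and weak_topology: "A \<subseteq> X \<Longrightarrow>
      (\<And>n f. f \<in> C n \<Longrightarrow> closedin (top_of_set X) (A \<inter> f ` unit_disc n)) \<Longrightarrow>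
      closedin (top_of_set X) A"


section \<open>The Alexander module\<close>

text \<open>The type \<open>'h\<close> is a copy, written additively, of \<open>H = H_1(G) / torsion\<close>, identified with it
  through \<open>\<psi>\<close>; thus the group ring of \<open>H\<close> is the ring \<open>'h \<Rightarrow>\<^sub>0 int\<close> with the convolution product
  of \<open>HOL-Library.Poly_Mapping\<close>. The isomorphism \<open>\<phi>\<close> expresses that \<open>G\<close> is the fundamental group
  of \<open>X\<close>, and \<open>projection_to_H\<close> is the projection \<open>G \<rightarrow> H\<close> seen on the fundamental group. The cover \<open>p : X' \<rightarrow> X\<close>
  is the one whose fundamental group is the kernel of this projection, and \<open>\<tau>\<close> is the usual identification of
  \<open>H\<close> with its deck group: \<open>\<tau> h\<close> takes \<open>x0'\<close> to the endpoint of the lift at \<open>x0'\<close> of any loop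
  representing \<open>h\<close>.\<close>

definition projection_to_H ::
    "'g monoid \<Rightarrow> ('g set set \<Rightarrow> 'h) \<Rightarrow> ('c \<Rightarrow> 'g) \<Rightarrow> 'c \<Rightarrow> 'h" where
  "projection_to_H G \<psi> \<phi> c = \<psi> (free_homology_proj G (\<phi> c))"

locale alexander_cover =
  cw_complex X C
  for X :: "'a::t2_space set" and C :: "nat \<Rightarrow> ((nat \<Rightarrow> real) \<Rightarrow> 'a) set" +
  fixes G :: "'g monoid"
    and \<psi> :: "'g set set \<Rightarrow> 'h::ab_group_add"
    and x0 :: 'a
    and \<phi> :: "(real \<Rightarrow> 'a) set \<Rightarrow> 'g"
    and X' :: "'b::topological_space set"
    and x0' :: 'b
    and p :: "'b \<Rightarrow> 'a"
    and \<tau> :: "'h \<Rightarrow> 'b \<Rightarrow> 'b"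
  assumes group: "group G"
    and psi: "\<psi> \<in> iso (free_homology G) additive_group"
    and connected: "connected X"
    and one_0_cell: "\<exists>f. C 0 = {f} \<and> f ` unit_disc 0 = {x0}"
    and finitely_many_1_cells: "finite (C 1)"
    and phi: "\<phi> \<in> iso (fundamental_group X x0) G"
    and covering: "covering_space X' p X"
    and path_connected: "path_connected X'"
    and base_point: "x0' \<in> X'" "p x0' = x0"
    and cover_kernel: "{path_class X (p \<circ> \<gamma>) | \<gamma>. \<gamma> \<in> loops_at X' x0'} =
      {c \<in> carrier (fundamental_group X x0). projection_to_H G \<psi> \<phi> c = 0}"
    and deck_homeomorphism: "\<exists>g. homeomorphism X' X' (\<tau> h) g"
    and deck_over_base: "y \<in> X' \<Longrightarrow> p (\<tau> h y) = p y"
    and deck_lift: "path \<gamma> \<Longrightarrow> path_image \<gamma> \<subseteq> X' \<Longrightarrow> pathstart \<gamma> = x0' \<Longrightarrow> p (pathfinish \<gamma>) = x0 \<Longrightarrow>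
      \<tau> (projection_to_H G \<psi> \<phi> (path_class X (p \<circ> \<gamma>))) x0' = pathfinish \<gamma>"

definition fibre :: "'b set \<Rightarrow> ('b \<Rightarrow> 'a) \<Rightarrow> 'a \<Rightarrow> 'b set" where
  "fibre X' p x0 = {y \<in> X'. p y = x0}"

definition alexander_module ::
    "'b::topological_space set \<Rightarrow> ('b \<Rightarrow> 'a) \<Rightarrow> 'a \<Rightarrow> 'b chain set monoid" where
  "alexander_module X' p x0 = relative_homology_group 1 (top_of_set X') (fibre X' p x0)"

text \<open>The action of the group ring, where the homology groups are written multiplicatively:
  the linear combination \<open>\<Sum>h. r h * h\<close> sends \<open>a\<close> to the product of the powers
  \<open>(\<tau> h)\<^sub>* (a) [^] r h\<close>.\<close>

definition alexander_smult ::
    "'b::topological_space set \<Rightarrow> ('b \<Rightarrow> 'a) \<Rightarrow> 'a \<Rightarrow> ('h::ab_group_add \<Rightarrow> 'b \<Rightarrow> 'b) \<Rightarrow>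
      ('h \<Rightarrow>\<^sub>0 int) \<Rightarrow> 'b chain set \<Rightarrow> 'b chain set" where
  "alexander_smult X' p x0 \<tau> r a =
     (\<Otimes>\<^bsub>alexander_module X' p x0\<^esub>h\<in>Poly_Mapping.keys r.
        hom_induced 1 (top_of_set X') (fibre X' p x0) (top_of_set X') (fibre X' p x0) (\<tau> h) a
          [^]\<^bsub>alexander_module X' p x0\<^esub> Poly_Mapping.lookup r h)"


section \<open>Elementary ideals and the Alexander polynomial\<close>

text \<open>\<open>M\<close> is (the multiplicatively written additive group of) a module with scalar multiplication
  \<open>smul\<close>, and \<open>presents M smul \<Phi>\<close> says that there is an exact sequence
  \<open>R^m \<rightarrow> R^q \<rightarrow> M \<rightarrow> 0\<close> whose first map is the \<open>q \<times> m\<close> matrix \<open>\<Phi>\<close> and whose second one takes the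
  standard basis to \<open>b\<close>.\<close>

definition presents ::
    "'m monoid \<Rightarrow> ('r::comm_ring_1 \<Rightarrow> 'm \<Rightarrow> 'm) \<Rightarrow> 'r mat \<Rightarrow> bool" where
  "presents M smul \<Phi> \<longleftrightarrow>
     (\<exists>b :: nat \<Rightarrow> 'm. (\<forall>i<dim_row \<Phi>. b i \<in> carrier M) \<and>
       (let \<pi> = (\<lambda>v. \<Otimes>\<^bsub>M\<^esub>i\<in>{..<dim_row \<Phi>}. smul (vec_index v i) (b i)) in
         \<pi> ` carrier_vec (dim_row \<Phi>) = carrier M \<and>
         {v \<in> carrier_vec (dim_row \<Phi>). \<pi> v = \<one>\<^bsub>M\<^esub>} = (\<lambda>w. \<Phi> *\<^sub>v w) ` carrier_vec (dim_col \<Phi>)))"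

definition minors :: "'r::comm_ring_1 mat \<Rightarrow> nat \<Rightarrow> 'r set" where
  "minors \<Phi> k = {Determinant.det (submatrix \<Phi> I J) | I J.
     I \<subseteq> {..<dim_row \<Phi>} \<and> J \<subseteq> {..<dim_col \<Phi>} \<and> card I = k \<and> card J = k}"

definition ideal_generated :: "'r::comm_ring_1 set \<Rightarrow> 'r set" where
  "ideal_generated S = module.span (*) S"

definition elementary_ideal :: "nat \<Rightarrow> 'r::comm_ring_1 mat \<Rightarrow> 'r set" where
  "elementary_ideal i \<Phi> =
     (if i \<ge> dim_row \<Phi> then UNIV
      else if dim_row \<Phi> - i > dim_col \<Phi> then {0}
      else ideal_generated (minors \<Phi> (dim_row \<Phi> - i)))"

definition is_gcd_of :: "'r::comm_ring_1 \<Rightarrow> 'r set \<Rightarrow> bool" where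
  "is_gcd_of d I \<longleftrightarrow> (\<forall>x\<in>I. d dvd x) \<and> (\<forall>c. (\<forall>x\<in>I. c dvd x) \<longrightarrow> c dvd d)"

text \<open>The elementary ideals do not depend on the presentation, and the gcd is only determined up
  to units, so this is a predicate.\<close>

definition is_alexander_polynomial ::
    "'m monoid \<Rightarrow> ('r::comm_ring_1 \<Rightarrow> 'm \<Rightarrow> 'm) \<Rightarrow> 'r \<Rightarrow> bool" where
  "is_alexander_polynomial M smul \<Delta> \<longleftrightarrow>
     (\<exists>\<Phi>. presents M smul \<Phi> \<and> is_gcd_of \<Delta> (elementary_ideal 1 \<Phi>))"

definition constant_up_to_unit :: "'r::comm_ring_1 \<Rightarrow> bool" where
  "constant_up_to_unit \<Delta> \<longleftrightarrow> (\<exists>u (c::int). u dvd 1 \<and> \<Delta> = u * of_int c)"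

end

theory Submission
  imports Defs
begin

text \<open>Singular 1-chains of the cover relative to the fibre are generated by lifts of loops, so the
  Alexander module is the universal target of crossed homomorphisms on the group. For the group of \<open>\<Gamma>\<close> it is
  generated by elements \<open>d v\<close>, \<open>v \<in> V\<close>, subject to \<open>(t w - 1) d v = (t v - 1) d w\<close> for every edge \<open>{v, w}\<close>.

  The first elementary ideal of an arbitrary presentation \<open>\<Phi>\<close> is controlled by two rank arguments. If \<open>\<Gamma>\<close> with some vertices
  \<open>A\<close> deleted is disconnected, then after putting \<open>t v = 1\<close> for \<open>v \<in> A\<close> the module has two independent functionals, so all the
  minors vanish. Hence \<open>\<Delta> = 0\<close> if \<open>\<Gamma>\<close> is disconnected, and \<open>t v - 1\<close> divides \<open>\<Delta>\<close> for a cut vertex \<open>v\<close>.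
  If \<open>\<Gamma>\<close> without \<open>v\<close> is connected, then the relations along paths show that some product \<open>P\<close> of factors \<open>t w - 1\<close>, \<open>w \<noteq> v\<close>,
  maps the module into a cyclic submodule, and then \<open>\<Delta>\<close> divides a power of \<open>P\<close>. As the \<open>t w - 1\<close> are pairwise
  non-associated primes, \<open>\<Delta>\<close> is a unit if this happens for all \<open>v\<close>.\<close>

section \<open>Minors and elementary ideals\<close>

text \<open>The definition of the polynomial allows any presentation, and the group ring is taken
  over an abstract type without order, coordinates or factorisation theory. So no particular matrix
  is written down and no gcd is computed: both rank arguments work with functionals on the module
  itself and therefore apply to every \<open>\<Phi>\<close>. The arithmetic used is only that the
  ring is a domain and that \<open>t v - 1\<close> generates the kernel of the specialisation
  \<open>t v = 1\<close>. All functionals have one origin. The relations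
  \<open>(t w - 1) d v = (t v - 1) d w\<close> always admit \<open>d v \<mapsto> t v - 1\<close>,
  the boundary map of the pair. Once \<open>t v = 1\<close> for \<open>v \<in> A\<close>, an edge
  meeting \<open>A\<close> imposes nothing on values that vanish on \<open>A\<close>, so this
  functional can be cut off to any union of components of \<open>\<Gamma>\<close> minus
  \<open>A\<close>. Two complementary pieces are the independent functionals. The uncut one does not
  vanish on any \<open>d u\<close>, and this is what makes the argument with a cyclic submodule
  work.\<close>

lemma dvd_det_mult_of_column_selections:
  fixes A :: "'r::comm_ring_1 mat"
  assumes A: "A \<in> carrier_mat k m" and B: "B \<in> carrier_mat m k"
    and d: "\<And>g. (\<forall>j<k. g j < m) \<Longrightarrow> d dvd det (mat k k (\<lambda>(i, j). A $$ (i, g j)))"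
  shows "d dvd det (A * B)"
proof -
  have AB: "A * B \<in> carrier_mat k k"
    using A B by auto
  \<comment> \<open>The expansion is by multilinearity in the rows, hence the transposition. The
    result is a Cauchy-Binet formula in which repeated columns are not yet discarded.\<close>
  have "det (A * B) = det ((A * B)\<^sup>T)"
    by (rule det_transpose[OF AB, symmetric])
  also have "(A * B)\<^sup>T = B\<^sup>T * A\<^sup>T"
    by (rule transpose_mult[OF A B])
  also have "\<dots> = mat\<^sub>r k k (\<lambda>i. finsum_vec TYPE('r) k (\<lambda>s. B\<^sup>T $$ (i, s) \<cdot>\<^sub>v row A\<^sup>T s) {0..<m})"
    by (rule mat_mul_finsum_alt) (use A B in auto)
  also have "det \<dots> =
      (\<Sum>f\<in>{f. (\<forall>i\<in>{0..<k}. f i \<in> {0..<m}) \<and> (\<forall>i. i \<notin> {0..<k} \<longrightarrow> f i = i)}.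
        det (mat\<^sub>r k k (\<lambda>i. B\<^sup>T $$ (i, f i) \<cdot>\<^sub>v row A\<^sup>T (f i))))"
    by (rule det_linear_rows_sum) (use A B in auto)
  also have "d dvd \<dots>"
  proof (rule dvd_sum)
    fix f assume "f \<in> {f. (\<forall>i\<in>{0..<k}. f i \<in> {0..<m}) \<and> (\<forall>i. i \<notin> {0..<k} \<longrightarrow> f i = i)}"
    then have f: "\<And>i. i < k \<Longrightarrow> f i < m" by auto
    have "det (mat\<^sub>r k k (\<lambda>i. B\<^sup>T $$ (i, f i) \<cdot>\<^sub>v row A\<^sup>T (f i))) =
        prod (\<lambda>i. B\<^sup>T $$ (i, f i)) {0..<k} * det (mat\<^sub>r k k (\<lambda>i. row A\<^sup>T (f i)))"
      by (rule det_rows_mul) (use A f in \<open>auto intro!: carrier_vecI\<close>)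
    also have "mat\<^sub>r k k (\<lambda>i. row A\<^sup>T (f i)) = (mat k k (\<lambda>(i, j). A $$ (i, f j)))\<^sup>T"
      by (rule eq_matI) (use A f in auto)
    also have "det \<dots> = det (mat k k (\<lambda>(i, j). A $$ (i, f j)))"
      by (rule det_transpose[of _ k]) auto
    finally show "d dvd det (mat\<^sub>r k k (\<lambda>i. B\<^sup>T $$ (i, f i) \<cdot>\<^sub>v row A\<^sup>T (f i)))"
      using d[of f] f by simp
  qed
  finally show ?thesis .
qed

lemma bij_betw_pick:
  assumes "finite I"
  shows "bij_betw (pick I) {..<card I} I"
proof -
  have "inj_on (pick I) {..<card I}"
  proof (rule inj_onI)
    fix a b assume ab: "a \<in> {..<card I}" "b \<in> {..<card I}" "pick I a = pick I b"
    then have "a < card I" "b < card I" by auto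
    then have "card {x \<in> I. x < pick I a} = a" "card {x \<in> I. x < pick I b} = b"
      by (blast intro: card_pick)+
    then show "a = b" unfolding ab(3) by (rule HOL.trans[OF HOL.sym])
  qed
  moreover have "pick I ` {..<card I} \<subseteq> I"
    using pick_in_set_le by auto
  ultimately show ?thesis
    using assms by (metis bij_betw_def card_image card_lessThan card_subset_eq)
qed

text \<open>Passes from selections given by functions to \<open>minors\<close>, which enumerates
  index sets increasingly: a repeated column gives determinant 0, and an injective selection differs
  from the increasing one by a permutation, that is, by a sign.\<close>

lemma dvd_det_column_selection:
  fixes \<Phi> :: "'r::comm_ring_1 mat"
  assumes I: "I \<subseteq> {..<dim_row \<Phi>}" "card I = k"
    and g: "\<And>j. j < k \<Longrightarrow> g j < dim_col \<Phi>"
    and d: "\<And>x. x \<in> minors \<Phi> k \<Longrightarrow> d dvd x"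
  shows "d dvd det (mat k k (\<lambda>(r, c). \<Phi> $$ (pick I r, g c)))"
    (is "d dvd det ?N")
proof (cases "inj_on g {0..<k}")
  case False
  then obtain a b where ab: "a < k" "b < k" "a \<noteq> b" "g a = g b"
    by (auto simp: inj_on_def)
  then have "det ?N = 0"
    by (intro det_identical_columns[of _ k a b]) (auto intro!: eq_vecI)
  then show ?thesis by simp
next
  case True
  define J where "J = g ` {0..<k}"
  have J: "J \<subseteq> {..<dim_col \<Phi>}" "card J = k" "finite J"
    unfolding J_def using g True by (auto simp: card_image)
  \<comment> \<open>\<open>\<sigma> c\<close> is the rank of the column \<open>g c\<close> in
    \<open>J\<close>, so that \<open>pick J\<close> after \<open>\<sigma>\<close> is
    \<open>g\<close>.\<close>
  define \<sigma> where "\<sigma> c = (if c < k then card {a \<in> J. a < g c} else c)" for c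
  have pick: "pick J (\<sigma> c) = g c" if "c < k" for c
    unfolding \<sigma>_def using that by (auto simp: J_def intro: pick_card_in_set)
  have \<sigma>: "\<sigma> permutes {0..<k}"
  proof (rule inj_on_nat_permutes)
    show "inj_on \<sigma> {0..<k}"
    proof (rule inj_onI)
      fix a b assume ab: "a \<in> {0..<k}" "b \<in> {0..<k}" "\<sigma> a = \<sigma> b"
      then have "g a = g b" using pick[of a] pick[of b] by simp
      then show "a = b" using True ab by (auto dest: inj_onD)
    qed
    have "card {a \<in> J. a < g c} < card J" if "c < k" for c
      using J(3) that by (intro psubset_card_mono) (auto simp: J_def)
    then show "\<sigma> \<in> {0..<k} \<rightarrow> {0..<k}"
      using J by (auto simp: \<sigma>_def)
  qed (auto simp: \<sigma>_def)
  have eqs: "{i. i < dim_row \<Phi> \<and> i \<in> I} = I" "{j. j < dim_col \<Phi> \<and> j \<in> J} = J"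
    using I J by auto
  let ?S = "submatrix \<Phi> I J"
  have S: "?S \<in> carrier_mat k k"
    unfolding submatrix_def eqs I(2) J(2) by simp
  have N: "?N = (mat k k (\<lambda>(i, j). ?S\<^sup>T $$ (\<sigma> i, j)))\<^sup>T"
  proof (rule eq_matI)
    fix r c assume "r < dim_row ((mat k k (\<lambda>(i, j). ?S\<^sup>T $$ (\<sigma> i, j)))\<^sup>T)"
      "c < dim_col ((mat k k (\<lambda>(i, j). ?S\<^sup>T $$ (\<sigma> i, j)))\<^sup>T)"
    then have rc: "r < k" "c < k" by auto
    moreover have "\<sigma> c < k"
      using rc permutes_in_image[OF \<sigma>, of c] by simp
    ultimately show "?N $$ (r, c) = (mat k k (\<lambda>(i, j). ?S\<^sup>T $$ (\<sigma> i, j)))\<^sup>T $$ (r, c)"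
      using S I J pick by (simp add: submatrix_index eqs)
  qed auto
  have "det ?N = det (mat k k (\<lambda>(i, j). ?S\<^sup>T $$ (\<sigma> i, j)))"
    unfolding N by (rule det_transpose[of _ k]) auto
  also have "\<dots> = signof \<sigma> * det (?S\<^sup>T)"
    by (rule det_permute_rows[OF _ \<sigma>]) (use S in auto)
  also have "\<dots> = signof \<sigma> * det ?S"
    using det_transpose[OF S] by simp
  finally have "det ?N = signof \<sigma> * det ?S" .
  moreover have "det ?S \<in> minors \<Phi> k"
    unfolding minors_def using I J(1,2) by blast
  ultimately show ?thesis
    using d by simp
qed

text \<open>The enumeration of the complement of one index is the index shift built into
  \<open>mat_delete\<close>.\<close>

lemma pick_remove:
  assumes "i < q" "r < q - 1"
  shows "pick ({..<q} - {i}) r = (if r < i then r else Suc r)"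
proof -
  let ?x = "if r < i then r else Suc r"
  have "{a \<in> {..<q} - {i}. a < ?x} = (if r < i then {..<r} else {..r} - {i})"
    using assms by (auto split: if_splits)
  then have card: "card {a \<in> {..<q} - {i}. a < ?x} = r"
    by (cases "r < i") simp_all
  have "?x \<in> {..<q} - {i}" using assms by auto
  from pick_card_in_set[OF this] show ?thesis
    unfolding card .
qed

text \<open>In the Laplace expansion along column \<open>i\<close> the foreign column
  \<open>\<alpha>\<close> only supplies coefficients; the cofactors are minors of
  \<open>\<Phi> * W\<close> and hence, by the two lemmas on column selections, multiples of
  \<open>d\<close>.\<close>

lemma dvd_det_replace_column:
  fixes \<Phi> :: "'r::comm_ring_1 mat"
  assumes \<Phi>: "\<Phi> \<in> carrier_mat q m" and W: "W \<in> carrier_mat m q" and i: "i < q"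
    and d: "\<And>x. x \<in> minors \<Phi> (q - 1) \<Longrightarrow> d dvd x"
  shows "d dvd det (mat q q (\<lambda>(r, c). if c = i then \<alpha> r else (\<Phi> * W) $$ (r, c)))"
    (is "d dvd det ?Y")
proof -
  have "d dvd det (mat_delete ?Y s i)" if s: "s < q" for s
  proof -
    let ?A = "mat (q - 1) m (\<lambda>(r, c). \<Phi> $$ (pick ({..<q} - {s}) r, c))"
    let ?B = "mat m (q - 1) (\<lambda>(r, c). W $$ (r, pick ({..<q} - {i}) c))"
    have "mat_delete ?Y s i = ?A * ?B"
    proof (rule eq_matI)
      fix r c assume "r < dim_row (?A * ?B)" "c < dim_col (?A * ?B)"
      then have rc: "r < q - 1" "c < q - 1" by auto
      then show "mat_delete ?Y s i $$ (r, c) = (?A * ?B) $$ (r, c)"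
        using \<Phi> W s i by (auto simp: mat_delete_def pick_remove scalar_prod_def)
    qed (use i in \<open>auto simp: mat_delete_def\<close>)
    moreover have "d dvd det (?A * ?B)"
    proof (rule dvd_det_mult_of_column_selections)
      fix g assume g: "\<forall>j<q - 1. g j < m"
      have "mat (q - 1) (q - 1) (\<lambda>(i, j). ?A $$ (i, g j)) =
          mat (q - 1) (q - 1) (\<lambda>(r, c). \<Phi> $$ (pick ({..<q} - {s}) r, g c))"
        using g by (intro eq_matI) auto
      moreover have "d dvd det (mat (q - 1) (q - 1) (\<lambda>(r, c). \<Phi> $$ (pick ({..<q} - {s}) r, g c)))"
      proof (rule dvd_det_column_selection)
        show "{..<q} - {s} \<subseteq> {..<dim_row \<Phi>}" using \<Phi> by auto
        show "card ({..<q} - {s}) = q - 1" using s by simp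
        show "g j < dim_col \<Phi>" if "j < q - 1" for j using g \<Phi> that by auto
      qed (rule d)
      ultimately show "d dvd det (mat (q - 1) (q - 1) (\<lambda>(i, j). ?A $$ (i, g j)))"
        by metis
    qed auto
    ultimately show ?thesis by simp
  qed
  then have "d dvd (\<Sum>s<q. ?Y $$ (s, i) * cofactor ?Y s i)"
    unfolding cofactor_def by (intro dvd_sum dvd_mult) simp
  also have "\<dots> = det ?Y"
    by (rule laplace_expansion_column[symmetric]) (use i in auto)
  finally show ?thesis .
qed

text \<open>Adding \<open>\<gamma> c\<close> times column \<open>i\<close> to every other column
  \<open>c\<close> removes the rank one term and leaves \<open>P\<close> times the identity with
  column \<open>i\<close> replaced by \<open>\<alpha>\<close>. The matrix \<open>?S\<close> undoes
  these column operations.\<close>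

lemma det_replace_column_rank_one_update:
  fixes P :: "'r::comm_ring_1"
  assumes i: "i < q"
  shows "det (mat q q (\<lambda>(r, c). if c = i then \<alpha> r else (if r = c then P else 0) - \<gamma> c * \<alpha> r)) =
    P ^ (q - 1) * \<alpha> i"
    (is "det ?Y = _")
proof -
  let ?T = "mat q q (\<lambda>(r, c). if c = i then \<alpha> r else if r = c then P else 0)"
  let ?S = "mat q q (\<lambda>(r, c). if r = c then 1 else if r = i then - \<gamma> c else 0)"
  have "?Y = ?T * ?S"
  proof (rule eq_matI)
    fix r c assume "r < dim_row (?T * ?S)" "c < dim_col (?T * ?S)"
    then have rc: "r < q" "c < q" by auto
    have "(?T * ?S) $$ (r, c) = (\<Sum>s<q. ?T $$ (r, s) * ?S $$ (s, c))"
      using rc by (auto simp: scalar_prod_def lessThan_atLeast0 intro: sum.cong)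
    also have "\<dots> = (\<Sum>s<q. (if s = c then ?T $$ (r, s) else 0) +
        (if s = i then (if c = i then 0 else - \<gamma> c * \<alpha> r) else 0))"
      using rc by (intro sum.cong) auto
    also have "\<dots> = ?Y $$ (r, c)"
      using rc i by (auto simp: sum.distrib)
    finally show "?Y $$ (r, c) = (?T * ?S) $$ (r, c)" by simp
  qed auto
  then have "det ?Y = det ?T * det ?S"
    by (simp add: det_mult[of _ q])
  also have "det ?S = (\<Sum>s<q. ?S $$ (s, i) * cofactor ?S s i)"
    by (rule laplace_expansion_column) (use i in auto)
  also have "\<dots> = (\<Sum>s<q. if s = i then cofactor ?S s i else 0)"
    using i by (intro sum.cong) auto
  also have "\<dots> = det (mat_delete ?S i i)"
    using i by (simp add: cofactor_def flip: mult_2)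
  also have "mat_delete ?S i i = 1\<^sub>m (q - 1)"
    using i by (intro eq_matI) (auto simp: mat_delete_def)
  also have "det ?T = (\<Sum>s<q. ?T $$ (i, s) * cofactor ?T i s)"
    by (rule laplace_expansion_row) (use i in auto)
  also have "\<dots> = (\<Sum>s<q. if s = i then \<alpha> i * cofactor ?T i s else 0)"
    using i by (intro sum.cong) auto
  also have "\<dots> = \<alpha> i * det (mat_delete ?T i i)"
    using i by (simp add: cofactor_def flip: mult_2)
  also have "mat_delete ?T i i = P \<cdot>\<^sub>m 1\<^sub>m (q - 1)"
    using i by (intro eq_matI) (auto simp: mat_delete_def)
  finally show ?thesis by (simp add: mult.commute)
qed

text \<open>Multiplying the kernel relation by the adjugate turns it into \<open>det N\<close> times
  \<open>y\<close>, without any division.\<close>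

lemma det_mult_left_kernel:
  fixes N :: "'r::comm_ring_1 mat"
  assumes N: "N \<in> carrier_mat k k" and y: "\<And>c. c < k \<Longrightarrow> (\<Sum>r<k. y r * N $$ (r, c)) = 0" and j: "j < k"
  shows "det N * y j = 0"
proof -
  have "det N * y j = (\<Sum>r<k. y r * (det N \<cdot>\<^sub>m 1\<^sub>m k) $$ (r, j))"
    using j by (simp add: if_distrib mult.commute cong: if_cong)
  also have "\<dots> = (\<Sum>r<k. y r * (N * adj_mat N) $$ (r, j))"
    using adj_mat(2)[OF N] by simp
  also have "\<dots> = (\<Sum>r<k. \<Sum>c<k. y r * N $$ (r, c) * adj_mat N $$ (c, j))"
  proof (rule sum.cong[OF HOL.refl])
    fix r assume "r \<in> {..<k}"
    then have "(N * adj_mat N) $$ (r, j) = (\<Sum>c<k. N $$ (r, c) * adj_mat N $$ (c, j))"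
      using N adj_mat(1)[OF N] j by (simp add: scalar_prod_def lessThan_atLeast0)
    then show "y r * (N * adj_mat N) $$ (r, j) = (\<Sum>c<k. y r * N $$ (r, c) * adj_mat N $$ (c, j))"
      by (simp only: sum_distrib_left mult.assoc)
  qed
  also have "\<dots> = (\<Sum>c<k. (\<Sum>r<k. y r * N $$ (r, c)) * adj_mat N $$ (c, j))"
    by (subst sum.swap) (simp only: sum_distrib_right)
  also have "\<dots> = 0"
    using y by simp
  finally show ?thesis .
qed

lemma one_in_minors_0: "1 \<in> minors \<Phi> 0"
proof -
  have "det (submatrix \<Phi> {} {}) = 1"
    by (rule det_dim_zero) (simp add: submatrix_def)
  then have "1 = det (submatrix \<Phi> {} {}) \<and> {} \<subseteq> {..<dim_row \<Phi>} \<and> {} \<subseteq> {..<dim_col \<Phi>} \<and>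
      card ({} :: nat set) = 0 \<and> card ({} :: nat set) = 0"
    by simp
  then show ?thesis
    unfolding minors_def by blast
qed

lemma module_ring_mult: "Modules.module ((*) :: 'r::comm_ring_1 \<Rightarrow> 'r \<Rightarrow> 'r)"
  by unfold_locales (simp_all add: algebra_simps)

lemma minors_subset_elementary_ideal:
  "minors \<Phi> (dim_row \<Phi> - i) \<subseteq> elementary_ideal i \<Phi>"
proof (cases "i \<ge> dim_row \<Phi>")
  case True
  then show ?thesis by (simp add: elementary_ideal_def)
next
  case i: False
  show ?thesis
  proof (cases "dim_row \<Phi> - i > dim_col \<Phi>")
    case True
    show ?thesis
    proof
      fix x assume "x \<in> minors \<Phi> (dim_row \<Phi> - i)"
      then obtain J where "J \<subseteq> {..<dim_col \<Phi>}" "card J = dim_row \<Phi> - i"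
        unfolding minors_def by blast
      then have "dim_row \<Phi> - i \<le> dim_col \<Phi>"
        using card_mono[of "{..<dim_col \<Phi>}" J] by simp
      then show "x \<in> elementary_ideal i \<Phi>" using True by simp
    qed
  next
    case False
    then show ?thesis
      using i Modules.module.span_base[OF module_ring_mult, of _ "minors \<Phi> (dim_row \<Phi> - i)"]
      by (auto simp: elementary_ideal_def ideal_generated_def)
  qed
qed

lemma elementary_ideal_in_kernel:
  assumes \<rho>: "comm_ring_hom \<rho>"
    and zero: "\<And>x. x \<in> minors \<Phi> (dim_row \<Phi> - i) \<Longrightarrow> \<rho> x = 0"
    and x: "x \<in> elementary_ideal i \<Phi>"
  shows "\<rho> x = 0"
proof -
  interpret comm_ring_hom \<rho> by (rule \<rho>)
  consider "i \<ge> dim_row \<Phi>" | "x = 0" | "x \<in> module.span (*) (minors \<Phi> (dim_row \<Phi> - i))"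
    using x by (auto simp: elementary_ideal_def ideal_generated_def split: if_splits)
  then show ?thesis
  proof cases
    case 1
    \<comment> \<open>The difference \<open>dim_row \<Phi> - i\<close> is truncated to 0 here, so
      the hypothesis speaks of the minors of size 0, among them 1.\<close>
    then have "\<rho> 1 = 0"
      using zero[of 1] one_in_minors_0[of \<Phi>] by auto
    then have "\<rho> (x * 1) = 0"
      unfolding hom_mult by simp
    then show ?thesis by simp
  next
    case 3
    show ?thesis
    proof (rule Modules.module.span_induct_alt[OF module_ring_mult 3, where h = "\<lambda>x. \<rho> x = 0"])
      show "\<rho> (c * a + b) = 0" if "a \<in> minors \<Phi> (dim_row \<Phi> - i)" "\<rho> b = 0" for c a b
        using zero[OF that(1)] that(2) by (simp add: hom_distribs)
    qed simp
  qed simp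
qed

section \<open>Functionals on a presented module\<close>

text \<open>A module whose addition is written multiplicatively, as homology groups are, over a ring
  that is a type, as matrix determinants require.\<close>

locale group_with_scalars =
  fixes M :: "('m, 'z) monoid_scheme" (structure)
    and smul :: "'r::comm_ring_1 \<Rightarrow> 'm \<Rightarrow> 'm"
  assumes comm: "comm_group M"
    and smul_closed [simp, intro]: "a \<in> carrier M \<Longrightarrow> smul r a \<in> carrier M"
    and smul_mult: "a \<in> carrier M \<Longrightarrow> b \<in> carrier M \<Longrightarrow> smul r (a \<otimes> b) = smul r a \<otimes> smul r b"
    and smul_add: "a \<in> carrier M \<Longrightarrow> smul (r + s) a = smul r a \<otimes> smul s a"
    and smul_smul: "a \<in> carrier M \<Longrightarrow> smul (r * s) a = smul r (smul s a)"
    and smul_1: "a \<in> carrier M \<Longrightarrow> smul 1 a = a"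
begin

sublocale comm_group M by (rule comm)

lemma smul_0 [simp]: "a \<in> carrier M \<Longrightarrow> smul 0 a = \<one>"
  using smul_add[of a 0 0] by (metis add.right_neutral l_cancel_one smul_closed)

lemma smul_one [simp]: "smul r \<one> = \<one>"
  using smul_mult[of \<one> \<one> r] by (metis l_cancel_one one_closed r_one smul_closed)

lemma smul_uminus: "a \<in> carrier M \<Longrightarrow> smul (- r) a = inv (smul r a)"
  using smul_add[of a "- r" r] by (metis inv_equality smul_0 smul_closed add.left_inverse)

lemma smul_finprod:
  assumes "finite I" "g \<in> I \<rightarrow> carrier M"
  shows "smul r (finprod M g I) = finprod M (\<lambda>i. smul r (g i)) I"
  using assms by (induction rule: finite_induct) (simp_all add: smul_mult finprod_insert Pi_iff)

end

text \<open>Such an \<open>f\<close> amounts to a linear functional on the base change of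
  \<open>M\<close> along \<open>\<rho>\<close>; semilinearity avoids constructing that base
  change.\<close>

locale semilinear_functional = group_with_scalars M smul
  for M :: "('m, 'z) monoid_scheme" (structure) and smul :: "'r::comm_ring_1 \<Rightarrow> 'm \<Rightarrow> 'm" +
  fixes \<rho> :: "'r \<Rightarrow> 's::comm_ring_1" and f :: "'m \<Rightarrow> 's"
  assumes \<rho>: "comm_ring_hom \<rho>"
    and f_mult: "a \<in> carrier M \<Longrightarrow> b \<in> carrier M \<Longrightarrow> f (a \<otimes> b) = f a + f b"
    and f_smul: "a \<in> carrier M \<Longrightarrow> f (smul r a) = \<rho> r * f a"
begin

lemma f_one [simp]: "f \<one> = 0"
  using f_mult[of \<one> \<one>] by simp

lemma f_finprod:
  assumes "finite I" "g \<in> I \<rightarrow> carrier M"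
  shows "f (finprod M g I) = (\<Sum>i\<in>I. f (g i))"
  using assms by (induction rule: finite_induct) (simp_all add: f_mult finprod_insert Pi_iff)

lemma f_combination:
  assumes "\<And>i. i < (q::nat) \<Longrightarrow> b i \<in> carrier M"
  shows "f (\<Otimes>i\<in>{..<q}. smul (v i) (b i)) = (\<Sum>i<q. \<rho> (v i) * f (b i))"
  using assms by (subst f_finprod) (auto simp: f_smul)

end

text \<open>Two independent functionals on the cokernel of \<open>\<Phi>\<close> force the corank of \<open>\<Phi>\<close> to be at least two: for each
  deleted row, some nonzero combination of the two vanishes on the corresponding basis vector,
  hence is a left kernel vector of the minor.\<close>

lemma elementary_ideal_1_in_kernel:
  fixes M (structure) and \<rho> :: "'r::comm_ring_1 \<Rightarrow> 's::comm_ring_1"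
  assumes f1: "semilinear_functional M smul \<rho> f1" and f2: "semilinear_functional M smul \<rho> f2"
    and dom: "\<And>x y :: 's. x * y = 0 \<Longrightarrow> x = 0 \<or> y = 0"
    and m: "m1 \<in> carrier M" "f1 m1 \<noteq> 0" "f2 m1 = 0" "m2 \<in> carrier M" "f2 m2 \<noteq> 0"
    and \<Phi>: "presents M smul \<Phi>" and x: "x \<in> elementary_ideal 1 \<Phi>"
  shows "\<rho> x = 0"
proof -
  interpret f1: semilinear_functional M smul \<rho> f1 by (rule f1)
  interpret f2: semilinear_functional M smul \<rho> f2 by (rule f2)
  interpret comm_ring_hom \<rho> by (rule f1.\<rho>)
  define q where "q = dim_row \<Phi>"
  define \<pi> where "\<pi> b v = (\<Otimes>i\<in>{..<q}. smul (vec_index v i) (b i))" for b and v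
  obtain b where b: "\<And>i. i < q \<Longrightarrow> b i \<in> carrier M"
    and surj: "\<pi> b ` carrier_vec q = carrier M"
    and ker: "{v \<in> carrier_vec q. \<pi> b v = \<one>} = (\<lambda>w. \<Phi> *\<^sub>v w) ` carrier_vec (dim_col \<Phi>)"
    using \<Phi> unfolding presents_def q_def \<pi>_def Let_def by blast
  have f1\<pi>: "f1 (\<pi> b v) = (\<Sum>i<q. \<rho> (vec_index v i) * f1 (b i))" for v
    unfolding \<pi>_def by (rule f1.f_combination[OF b])
  have f2\<pi>: "f2 (\<pi> b v) = (\<Sum>i<q. \<rho> (vec_index v i) * f2 (b i))" for v
    unfolding \<pi>_def by (rule f2.f_combination[OF b])
  have column: "\<pi> b (col \<Phi> j) = \<one>" if "j < dim_col \<Phi>" for j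
  proof -
    have "\<Phi> *\<^sub>v unit_vec (dim_col \<Phi>) j = col \<Phi> j"
      using that by (intro eq_vecI) auto
    moreover have "\<Phi> *\<^sub>v unit_vec (dim_col \<Phi>) j \<in> {v \<in> carrier_vec q. \<pi> b v = \<one>}"
      unfolding ker by auto
    ultimately show ?thesis by auto
  qed
  have "\<rho> z = 0" if z: "z \<in> minors \<Phi> (q - 1)" for z
  proof -
    obtain I J where IJ: "z = det (submatrix \<Phi> I J)" "I \<subseteq> {..<q}" "J \<subseteq> {..<dim_col \<Phi>}"
      "card I = q - 1" "card J = q - 1"
      using z unfolding minors_def q_def by blast
    have fin: "finite I" "finite J"
      using IJ(2,3) finite_subset by blast+
    have "q \<noteq> 0"
    proof
      assume "q = 0"
      then have "f1 (\<pi> b v) = 0" for v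
        using f1\<pi> by simp
      moreover obtain v where "m1 = \<pi> b v"
        using surj m(1) by (metis imageE)
      ultimately show False using m(2) by simp
    qed
    then have "I \<noteq> {..<q}" using IJ(4) by auto
    then obtain i0 where i0: "i0 < q" "i0 \<notin> I" using IJ(2) by auto
    have "card (insert i0 I) = q"
      using i0 fin IJ(4) by simp
    then have I: "{..<q} = insert i0 I"
      using i0 IJ(2) card_subset_eq[of "{..<q}" "insert i0 I"] by simp
    \<comment> \<open>A nontrivial zero of a linear form in two variables: cross the coefficients,
      unless both vanish, when any nonzero scalar serves and \<open>f1 m1\<close> is one at
      hand.\<close>
    obtain c1 c2 where c: "c1 \<noteq> 0 \<or> c2 \<noteq> 0" "c1 * f1 (b i0) + c2 * f2 (b i0) = 0"
    proof (cases "f1 (b i0) = 0 \<and> f2 (b i0) = 0")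
      case True
      then show ?thesis using that[of "f1 m1" 0] m by simp
    next
      case False
      then show ?thesis using that[of "f2 (b i0)" "- f1 (b i0)"] by (auto simp: mult.commute)
    qed
    define y where "y i = c1 * f1 (b i) + c2 * f2 (b i)" for i
    have y\<pi>: "c1 * f1 (\<pi> b v) + c2 * f2 (\<pi> b v) = (\<Sum>i<q. y i * \<rho> (vec_index v i))" for v
      unfolding f1\<pi> f2\<pi> y_def by (simp add: sum_distrib_left sum.distrib[symmetric] algebra_simps)
    \<comment> \<open>Otherwise the combination of \<open>f1\<close> and \<open>f2\<close> vanishes
      on all of \<open>M\<close>. Its value at \<open>m1\<close>, where \<open>f2\<close> is 0,
      yields \<open>c1 = 0\<close>, and then its value at \<open>m2\<close> yields
      \<open>c2 = 0\<close>.\<close>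
    have "\<exists>i<q. y i \<noteq> 0"
    proof (rule ccontr)
      assume "\<not> (\<exists>i<q. y i \<noteq> 0)"
      then have "c1 * f1 (\<pi> b v) + c2 * f2 (\<pi> b v) = 0" for v
        unfolding y\<pi> by (intro sum.neutral) auto
      then have g: "c1 * f1 z + c2 * f2 z = 0" if "z \<in> carrier M" for z
        using surj that by (metis imageE)
      have "c1 = 0" using g[OF m(1)] dom m by auto
      moreover have "c2 = 0" using g[OF m(4)] dom m calculation by auto
      ultimately show False using c by simp
    qed
    then obtain i where i: "i \<in> I" "y i \<noteq> 0"
      using I c(2) by (auto simp: y_def set_eq_iff)
    have eqs: "{i. i < dim_row \<Phi> \<and> i \<in> I} = I" "{j. j < dim_col \<Phi> \<and> j \<in> J} = J"
      using IJ(2,3) unfolding q_def by auto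
    let ?S = "submatrix \<Phi> I J"
    have S: "?S = mat (q - 1) (q - 1) (\<lambda>(r, c). \<Phi> $$ (pick I r, pick J c))"
      unfolding submatrix_def eqs IJ(4,5) by simp
    have "bij_betw (pick I) {..<q - 1} I" "bij_betw (pick J) {..<q - 1} J"
      using bij_betw_pick[OF fin(1)] bij_betw_pick[OF fin(2)] unfolding IJ(4,5) by auto
    then have pick: "bij_betw (pick I) {..<q - 1} I" "\<And>c. c < q - 1 \<Longrightarrow> pick J c \<in> J"
      by (auto simp: bij_betw_def)
    obtain r where r: "r < q - 1" "pick I r = i"
      using pick(1) i(1) unfolding bij_betw_def by (metis imageE lessThan_iff)
    have "det (map_mat \<rho> ?S) * y (pick I r) = 0"
    proof (rule det_mult_left_kernel[where k = "q - 1" and y = "\<lambda>r. y (pick I r)"])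
      fix c assume c': "c < q - 1"
      define j where "j = pick J c"
      have j: "j < dim_col \<Phi>" using pick(2)[OF c'] IJ(3) unfolding j_def by auto
      have "(\<Sum>r<q - 1. y (pick I r) * map_mat \<rho> ?S $$ (r, c)) =
          (\<Sum>r<q - 1. y (pick I r) * \<rho> (\<Phi> $$ (pick I r, j)))"
        unfolding S j_def using c' by (intro sum.cong) auto
      also have "\<dots> = (\<Sum>i\<in>I. y i * \<rho> (\<Phi> $$ (i, j)))"
        by (rule sum.reindex_bij_betw[OF pick(1)])
      also have "\<dots> = (\<Sum>i<q. y i * \<rho> (\<Phi> $$ (i, j)))"
        unfolding I using fin i0 c(2) by (simp add: y_def)
      also have "\<dots> = (\<Sum>i<q. y i * \<rho> (vec_index (col \<Phi> j) i))"
        using j by (intro sum.cong) (auto simp: q_def)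
      also have "\<dots> = 0"
        unfolding y\<pi>[symmetric] column[OF j] by simp
      finally show "(\<Sum>r<q - 1. y (pick I r) * map_mat \<rho> ?S $$ (r, c)) = 0" .
    qed (use r in \<open>auto simp: S\<close>)
    then have "det (map_mat \<rho> ?S) = 0"
      using dom i(2) unfolding r(2) by blast
    then show ?thesis unfolding IJ(1) by (simp add: hom_det)
  qed
  then show ?thesis
    using elementary_ideal_in_kernel[OF f1.\<rho> _ x] unfolding q_def by blast
qed

text \<open>If \<open>P\<close> maps \<open>M\<close> into the cyclic module generated by \<open>a\<close>, then the columns of \<open>P I - \<alpha> \<gamma>\<^sup>T\<close> are relations,
  where \<open>a\<close> has coordinates \<open>\<alpha>\<close> and \<open>P\<close> times the \<open>i\<close>-th generator is \<open>\<gamma> i\<close> times \<open>a\<close>. Replacing its \<open>i\<close>-th column by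
  \<open>\<alpha>\<close> yields the determinant \<open>P ^ (q - 1) * \<alpha> i\<close>, and the functional gives \<open>P = \<Sum>i. \<alpha> i * \<gamma> i\<close>.\<close>

lemma dvd_power_of_annihilator:
  fixes M (structure) and P :: "'r::comm_ring_1"
  assumes f: "semilinear_functional M smul (\<lambda>x. x) f"
    and a: "a \<in> carrier M" and P: "\<And>m. m \<in> carrier M \<Longrightarrow> \<exists>c. smul P m = smul c a"
    and fa: "\<And>x. x * f a = 0 \<Longrightarrow> x = 0"
    and \<Phi>: "presents M smul \<Phi>" and d: "\<And>x. x \<in> elementary_ideal 1 \<Phi> \<Longrightarrow> d dvd x"
  shows "d dvd P ^ dim_row \<Phi>"
proof -
  interpret semilinear_functional M smul "\<lambda>x. x" f by (rule f)
  define q where "q = dim_row \<Phi>"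
  define \<pi> where "\<pi> b v = (\<Otimes>i\<in>{..<q}. smul (vec_index v i) (b i))" for b and v
  obtain b where b: "\<And>i. i < q \<Longrightarrow> b i \<in> carrier M"
    and surj: "\<pi> b ` carrier_vec q = carrier M"
    and ker: "{v \<in> carrier_vec q. \<pi> b v = \<one>} = (\<lambda>w. \<Phi> *\<^sub>v w) ` carrier_vec (dim_col \<Phi>)"
    using \<Phi> unfolding presents_def q_def \<pi>_def Let_def by blast
  obtain v where v: "v \<in> carrier_vec q" "\<pi> b v = a"
    using surj a by (metis imageE)
  define \<alpha> where "\<alpha> = vec_index v"
  have fa_eq: "f a = (\<Sum>i<q. \<alpha> i * f (b i))"
    unfolding v(2)[symmetric] \<pi>_def \<alpha>_def by (rule f_combination[OF b])
  have "\<forall>i. \<exists>c. i < q \<longrightarrow> smul P (b i) = smul c a"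
    using P b by blast
  then obtain \<gamma> where \<gamma>: "\<And>i. i < q \<Longrightarrow> smul P (b i) = smul (\<gamma> i) a"
    by metis
  have "(P - (\<Sum>i<q. \<alpha> i * \<gamma> i)) * f a = 0"
  proof -
    have "P * f a = (\<Sum>i<q. \<alpha> i * (P * f (b i)))"
      unfolding fa_eq by (simp add: sum_distrib_left mult.left_commute)
    also have "\<dots> = (\<Sum>i<q. \<alpha> i * (\<gamma> i * f a))"
    proof (rule sum.cong[OF HOL.refl])
      fix i assume "i \<in> {..<q}"
      then have "f (smul P (b i)) = f (smul (\<gamma> i) a)" "b i \<in> carrier M"
        using \<gamma> b by auto
      then show "\<alpha> i * (P * f (b i)) = \<alpha> i * (\<gamma> i * f a)"
        using f_smul a by simp
    qed
    also have "\<dots> = (\<Sum>i<q. \<alpha> i * \<gamma> i) * f a"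
      by (simp add: sum_distrib_right mult.assoc)
    finally show ?thesis by (simp add: left_diff_distrib)
  qed
  then have P_eq: "P = (\<Sum>i<q. \<alpha> i * \<gamma> i)"
    using fa eq_iff_diff_eq_0 by blast
  define u where "u i = vec q (\<lambda>r. (if r = i then P else 0) - \<gamma> i * \<alpha> r)" for i
  have "\<pi> b (u i) = \<one>" if i: "i < q" for i
  proof -
    have "\<pi> b (u i) = (\<Otimes>r\<in>{..<q}. smul (if r = i then P else 0) (b r) \<otimes> smul (- \<gamma> i) (smul (\<alpha> r) (b r)))"
      unfolding \<pi>_def
    proof (rule finprod_cong')
      fix r assume "r \<in> {..<q}"
      then have r: "r < q" by simp
      have "smul (vec_index (u i) r) (b r) = smul ((if r = i then P else 0) + (- \<gamma> i) * \<alpha> r) (b r)"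
        using r by (simp add: u_def)
      also have "\<dots> = smul (if r = i then P else 0) (b r) \<otimes> smul ((- \<gamma> i) * \<alpha> r) (b r)"
        using b[OF r] by (rule smul_add)
      also have "smul ((- \<gamma> i) * \<alpha> r) (b r) = smul (- \<gamma> i) (smul (\<alpha> r) (b r))"
        using b[OF r] by (rule smul_smul)
      finally show "smul (vec_index (u i) r) (b r) =
        smul (if r = i then P else 0) (b r) \<otimes> smul (- \<gamma> i) (smul (\<alpha> r) (b r))" .
    qed (use b in auto)
    also have "\<dots> = (\<Otimes>r\<in>{..<q}. smul (if r = i then P else 0) (b r)) \<otimes>
        (\<Otimes>r\<in>{..<q}. smul (- \<gamma> i) (smul (\<alpha> r) (b r)))"
      using b by (intro finprod_multf) auto
    also have "(\<Otimes>r\<in>{..<q}. smul (- \<gamma> i) (smul (\<alpha> r) (b r))) = smul (- \<gamma> i) a"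
      unfolding v(2)[symmetric] \<pi>_def \<alpha>_def using b by (subst smul_finprod) auto
    also have "(\<Otimes>r\<in>{..<q}. smul (if r = i then P else 0) (b r)) =
        (\<Otimes>r\<in>{..<q}. if i = r then smul P (b r) else \<one>)"
      using b by (intro finprod_cong') auto
    also have "\<dots> = smul P (b i)"
      by (rule finprod_singleton) (use b i in auto)
    also have "\<dots> \<otimes> smul (- \<gamma> i) a = smul (\<gamma> i + - \<gamma> i) a"
      unfolding \<gamma>[OF i] using a by (rule smul_add[symmetric])
    also have "\<dots> = \<one>" using a by simp
    finally show ?thesis .
  qed
  then have "\<forall>i. \<exists>w. i < q \<longrightarrow> w \<in> carrier_vec (dim_col \<Phi>) \<and> u i = \<Phi> *\<^sub>v w"
    using ker by (fastforce simp: u_def)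
  then obtain w where w: "\<And>i. i < q \<Longrightarrow> w i \<in> carrier_vec (dim_col \<Phi>)" "\<And>i. i < q \<Longrightarrow> u i = \<Phi> *\<^sub>v w i"
    by metis
  define W where "W = mat (dim_col \<Phi>) q (\<lambda>(r, c). vec_index (w c) r)"
  have \<Phi>W: "(\<Phi> * W) $$ (r, c) = (if r = c then P else 0) - \<gamma> c * \<alpha> r" if rc: "r < q" "c < q" for r c
  proof -
    have "(\<Phi> * W) $$ (r, c) = vec_index (\<Phi> *\<^sub>v w c) r"
      using rc w(1)[OF rc(2)] by (simp add: W_def scalar_prod_def q_def)
    also have "\<dots> = vec_index (u c) r" using w(2)[OF rc(2)] by simp
    finally show ?thesis using rc by (simp add: u_def)
  qed
  have \<alpha>: "d dvd P ^ (q - 1) * \<alpha> i" if i: "i < q" for i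
  proof -
    have "d dvd det (mat q q (\<lambda>(r, c). if c = i then \<alpha> r else (\<Phi> * W) $$ (r, c)))"
    proof (rule dvd_det_replace_column[OF _ _ i])
      show "\<Phi> \<in> carrier_mat q (dim_col \<Phi>)" "W \<in> carrier_mat (dim_col \<Phi>) q"
        by (auto simp: q_def W_def)
      show "d dvd x" if "x \<in> minors \<Phi> (q - 1)" for x
        using d that minors_subset_elementary_ideal[of \<Phi> 1] unfolding q_def by blast
    qed
    also have "mat q q (\<lambda>(r, c). if c = i then \<alpha> r else (\<Phi> * W) $$ (r, c)) =
        mat q q (\<lambda>(r, c). if c = i then \<alpha> r else (if r = c then P else 0) - \<gamma> c * \<alpha> r)"
      by (rule eq_matI) (auto simp: \<Phi>W simp del: index_mult_mat)
    finally show ?thesis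
      unfolding det_replace_column_rank_one_update[OF i] .
  qed
  show ?thesis
  proof (cases "q = 0")
    case True
    \<comment> \<open>Without generators \<open>a\<close> is trivial, and the cancellation
      hypothesis \<open>fa\<close> then forces the ring itself to be trivial.\<close>
    then have "f a = 0" using fa_eq by simp
    then have "(1::'r) = 0" using fa[of 1] by simp
    then have "x = 0" for x :: 'r by (metis mult_1 mult_zero_left)
    then show ?thesis by (metis dvd_0_right)
  next
    case False
    then have "P ^ q = P ^ (q - 1) * P" by (cases q) simp_all
    \<comment> \<open>Only the last factor \<open>P\<close> is expanded, so that every summand
      contains one of the determinants from \<open>\<alpha>\<close>.\<close>
    also have "\<dots> = (\<Sum>i<q. P ^ (q - 1) * \<alpha> i * \<gamma> i)"
      by (subst (2) P_eq) (simp add: sum_distrib_left mult.assoc)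
    also have "d dvd \<dots>" using \<alpha> by (intro dvd_sum dvd_mult2[OF \<alpha>]) simp
    finally show ?thesis unfolding q_def .
  qed
qed

section \<open>Lifting to covering spaces\<close>

text \<open>The agreement set is clopen: near a point both maps stay in one sheet each. If the
  sheets coincide, injectivity of \<open>p\<close> gives agreement; if not, they are disjoint. The
  domain is any connected set because paths, overlaps of rectangles and \<open>X'\<close> itself all
  occur.\<close>

lemma covering_lifts_agree:
  fixes k1 k2 :: "'c::topological_space \<Rightarrow> 'b::topological_space"
  assumes cov: "covering_space C p X" and S: "connected S"
    and k1: "continuous_on S k1" "k1 ` S \<subseteq> C" and k2: "continuous_on S k2" "k2 ` S \<subseteq> C"
    and eq: "\<And>x. x \<in> S \<Longrightarrow> p (k1 x) = p (k2 x)"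
    and a: "a \<in> S" "k1 a = k2 a" and x: "x \<in> S"
  shows "k1 x = k2 x"
proof -
  define G where "G = {x \<in> S. k1 x = k2 x}"
  have nbhd: "\<exists>W. openin (top_of_set S) W \<and> z \<in> W \<and> (if k1 z = k2 z then W \<subseteq> G else W \<subseteq> S - G)"
    if z: "z \<in> S" for z
  proof -
    have "p (k1 z) \<in> X"
      using covering_space_imp_surjective[OF cov] k1(2) z by auto
    then obtain T v where T: "p (k1 z) \<in> T" and v: "\<Union>v = C \<inter> p -` T"
        "\<And>u. u \<in> v \<Longrightarrow> openin (top_of_set C) u" "pairwise disjnt v"
        "\<And>u. u \<in> v \<Longrightarrow> \<exists>q. homeomorphism u T p q"
      using cov unfolding covering_space_def by meson
    have "k1 z \<in> \<Union>v" "k2 z \<in> \<Union>v"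
      unfolding v(1) using T z k1(2) k2(2) eq[OF z] by auto
    then obtain u1 u2 where u: "u1 \<in> v" "k1 z \<in> u1" "u2 \<in> v" "k2 z \<in> u2" by blast
    define W where "W = (S \<inter> k1 -` u1) \<inter> (S \<inter> k2 -` u2)"
    have "openin (top_of_set S) W"
      unfolding W_def using k1 k2 u v(2) by (intro openin_Int continuous_openin_preimage[where T = C]) auto
    moreover have "z \<in> W" using z u by (simp add: W_def)
    moreover have inj: "inj_on p u" if "u \<in> v" for u
      using v(4)[OF that] by (metis homeomorphism_def inj_on_inverseI)
    moreover have "W \<subseteq> G" if "k1 z = k2 z"
    proof -
      have "u1 = u2" using that u v(3) by (auto simp: pairwise_def disjnt_def)
      then show ?thesis
        using inj_onD[OF inj[OF u(1)] eq] by (auto simp: W_def G_def)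
    qed
    moreover have "W \<subseteq> S - G" if ne: "k1 z \<noteq> k2 z"
    proof -
      have "u1 \<noteq> u2"
        using inj_onD[OF inj[OF u(1)] eq[OF z] u(2)] u(4) ne by auto
      then have "u1 \<inter> u2 = {}" using u v(3) by (auto simp: pairwise_def disjnt_def)
      then show ?thesis by (auto simp: W_def G_def)
    qed
    ultimately show ?thesis by auto
  qed
  have "openin (top_of_set S) G"
    by (subst openin_subopen) (use nbhd in \<open>fastforce simp: G_def\<close>)
  moreover have "openin (top_of_set S) (S - G)"
  proof (subst openin_subopen, intro ballI)
    fix z assume "z \<in> S - G"
    then show "\<exists>T. openin (top_of_set S) T \<and> z \<in> T \<and> T \<subseteq> S - G"
      using nbhd[of z] by (auto simp: G_def)
  qed
  moreover have "G \<subseteq> S" by (auto simp: G_def)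
  ultimately have "G = {} \<or> G = S"
    using S unfolding connected_clopen closedin_def by simp
  then show ?thesis using a x by (auto simp: G_def)
qed

text \<open>The point \<open>z\<close> at which the lift is prescribed is arbitrary, so a lift on
  one piece can be continued on the next from any common point.\<close>

definition lifts_on ::
    "'b::topological_space set \<Rightarrow> ('b \<Rightarrow> 'a) \<Rightarrow> ('c::topological_space \<Rightarrow> 'a) \<Rightarrow> 'c set \<Rightarrow> bool" where
  "lifts_on C p h S \<longleftrightarrow> (\<forall>z\<in>S. \<forall>e\<in>C. p e = h z \<longrightarrow>
     (\<exists>k. continuous_on S k \<and> k ` S \<subseteq> C \<and> k z = e \<and> (\<forall>x\<in>S. p (k x) = h x)))"

text \<open>Since the overlap is connected, lifts that agree at one of its points agree on all of it
  and can be glued.\<close>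

lemma lifts_on_Un:
  fixes S T :: "'c::topological_space set"
  assumes cov: "covering_space C p X"
    and cl: "closedin (top_of_set (S \<union> T)) S" "closedin (top_of_set (S \<union> T)) T"
    and ST: "connected (S \<inter> T)" "S \<inter> T \<noteq> {}"
    and S: "lifts_on C p h S" and T: "lifts_on C p h T"
  shows "lifts_on C p h (S \<union> T)"
proof -
  have *: "\<exists>k. continuous_on (S \<union> T) k \<and> k ` (S \<union> T) \<subseteq> C \<and> k z = e \<and> (\<forall>x\<in>S \<union> T. p (k x) = h x)"
    if cl: "closedin (top_of_set (S \<union> T)) S" "closedin (top_of_set (S \<union> T)) T"
    and ST: "connected (S \<inter> T)" "S \<inter> T \<noteq> {}"
    and S: "lifts_on C p h S" and T: "lifts_on C p h T" and z: "z \<in> S" and e: "e \<in> C" "p e = h z"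
    for S T :: "'c set" and z e
  proof -
    obtain k1 where k1: "continuous_on S k1" "k1 ` S \<subseteq> C" "k1 z = e" "\<And>x. x \<in> S \<Longrightarrow> p (k1 x) = h x"
      using S z e unfolding lifts_on_def by meson
    obtain w where w: "w \<in> S" "w \<in> T" using ST by blast
    then have "k1 w \<in> C" "p (k1 w) = h w" using k1 by auto
    then obtain k2 where k2: "continuous_on T k2" "k2 ` T \<subseteq> C" "k2 w = k1 w" "\<And>x. x \<in> T \<Longrightarrow> p (k2 x) = h x"
      using T w unfolding lifts_on_def by meson
    have agree: "k1 x = k2 x" if "x \<in> S \<inter> T" for x
    proof (rule covering_lifts_agree[OF cov ST(1), where a = w and x = x])
      show "continuous_on (S \<inter> T) k1" "continuous_on (S \<inter> T) k2"
        using k1(1) k2(1) by (auto elim: continuous_on_subset)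
    qed (use k1 k2 w that in auto)
    define k where "k x = (if x \<in> S then k1 x else k2 x)" for x
    have "continuous_on (S \<union> T) k"
      unfolding k_def by (rule continuous_on_cases_local[OF cl k1(1) k2(1)]) (use agree in auto)
    moreover have "k ` (S \<union> T) \<subseteq> C" "k z = e" "\<forall>x\<in>S \<union> T. p (k x) = h x"
      using k1 k2 z by (auto simp: k_def)
    ultimately show ?thesis by blast
  qed
  show ?thesis
    unfolding lifts_on_def
  proof (intro ballI impI)
    fix z e assume ze: "z \<in> S \<union> T" "e \<in> C" "p e = h z"
    show "\<exists>k. continuous_on (S \<union> T) k \<and> k ` (S \<union> T) \<subseteq> C \<and> k z = e \<and> (\<forall>x\<in>S \<union> T. p (k x) = h x)"
    proof (cases "z \<in> S")
      case True
      then show ?thesis using *[OF cl ST S T _ ze(2,3)] by blast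
    next
      case False
      then have "z \<in> T" using ze by blast
      then show ?thesis
        using *[of T S z e] cl ST S T ze by (simp add: Un_commute Int_commute)
    qed
  qed
qed

lemma lifts_on_evenly_covered:
  assumes v: "\<Union>v = C \<inter> p -` T" "\<And>u. u \<in> v \<Longrightarrow> \<exists>q. homeomorphism u T p q"
    and h: "continuous_on S h" "h ` S \<subseteq> T"
  shows "lifts_on C p h S"
  unfolding lifts_on_def
proof (intro ballI impI)
  fix z e assume ze: "z \<in> S" "e \<in> C" "p e = h z"
  then have "e \<in> \<Union>v" unfolding v(1) using h by auto
  then obtain u where u: "u \<in> v" "e \<in> u" by blast
  obtain q where q: "homeomorphism u T p q" using v(2)[OF u(1)] by blast
  have "continuous_on S (\<lambda>x. q (h x))"
    by (rule continuous_on_compose2[of T q, OF _ h]) (use q in \<open>simp add: homeomorphism_def\<close>)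
  moreover have "u \<subseteq> C"
    using u(1) v(1) by blast
  then have "(\<lambda>x. q (h x)) ` S \<subseteq> C"
    using q h(2) by (fastforce simp: homeomorphism_def)
  moreover have "q (h z) = e"
    using q u ze(3) by (metis homeomorphism_apply1)
  moreover have "\<forall>x\<in>S. p (q (h x)) = h x"
    using q h by (auto simp: homeomorphism_def)
  ultimately show "\<exists>k. continuous_on S k \<and> k ` S \<subseteq> C \<and> k z = e \<and> (\<forall>x\<in>S. p (k x) = h x)"
    by (intro exI[of _ "\<lambda>x. q (h x)"]) auto
qed

text \<open>Bisection (\<open>Bolzano\<close>) is applied in one coordinate after the other: small
  rectangles are evenly covered, they are stacked to narrow strips, and the strips are joined to the
  square.\<close>

lemma lifts_on_square:
  fixes h :: "real \<times> real \<Rightarrow> 'a::topological_space"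
  assumes cov: "covering_space C p X"
    and h: "continuous_on ({0..1} \<times> {0..1}) h" "h ` ({0..1} \<times> {0..1}) \<subseteq> X"
  shows "lifts_on C p h ({0..1} \<times> {0..1})"
proof -
  have small: "\<exists>r>0. \<forall>a b c d. a \<le> x \<and> x \<le> b \<and> b - a < r \<and> 0 \<le> a \<and> b \<le> 1 \<and> c \<le> y \<and> y \<le> d \<and> d - c < r \<and> 0 \<le> c \<and> d \<le> 1
      \<longrightarrow> lifts_on C p h ({a..b} \<times> {c..d})"
    if xy: "0 \<le> x" "x \<le> 1" "0 \<le> y" "y \<le> 1" for x y
  proof -
    have "h (x, y) \<in> X" using h xy by auto
    then obtain T v where T: "h (x, y) \<in> T" "openin (top_of_set X) T" and v: "\<Union>v = C \<inter> p -` T"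
        "\<And>u. u \<in> v \<Longrightarrow> \<exists>q. homeomorphism u T p q"
      using cov unfolding covering_space_def by meson
    have "openin (top_of_set ({0..1} \<times> {0..1})) (({0..1} \<times> {0..1}) \<inter> h -` T)"
      using h T(2) by (intro continuous_openin_preimage[where T = X]) auto
    moreover have "(x, y) \<in> ({0..1} \<times> {0..1}) \<inter> h -` T" using xy T(1) by auto
    ultimately obtain r where r: "r > 0"
      "\<And>w. w \<in> {0..1} \<times> {0..1} \<Longrightarrow> dist w (x, y) < r \<Longrightarrow> w \<in> ({0..1} \<times> {0..1}) \<inter> h -` T"
      unfolding openin_euclidean_subtopology_iff by meson
    have "lifts_on C p h ({a..b} \<times> {c..d})"
      if abcd: "a \<le> x" "x \<le> b" "b - a < r / 2" "0 \<le> a" "b \<le> 1" "c \<le> y" "y \<le> d" "d - c < r / 2" "0 \<le> c" "d \<le> 1"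
      for a b c d
    proof (rule lifts_on_evenly_covered[OF v])
      show "continuous_on ({a..b} \<times> {c..d}) h"
        by (rule continuous_on_subset[OF h(1)]) (use abcd in auto)
      show "h ` ({a..b} \<times> {c..d}) \<subseteq> T"
      proof clarify
        fix s t assume st: "s \<in> {a..b}" "t \<in> {c..d}"
        have "dist (s, t) (x, y) \<le> \<bar>s - x\<bar> + \<bar>t - y\<bar>"
          unfolding dist_Pair_Pair dist_real_def by (rule sqrt_sum_squares_le_sum_abs[THEN order_trans]) simp
        also have "\<dots> < r" using st abcd by auto
        finally show "h (s, t) \<in> T" using r(2)[of "(s, t)"] st abcd by auto
      qed
    qed
    \<comment> \<open>Half of \<open>r\<close> suffices because the distance is estimated by the sum
      of the two coordinate differences.\<close>
    then show ?thesis using r(1) by (intro exI[of _ "r / 2"]) auto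
  qed
  have strip: "\<exists>r>0. \<forall>a b. a \<le> x \<and> x \<le> b \<and> b - a < r \<and> 0 \<le> a \<and> b \<le> 1 \<longrightarrow> lifts_on C p h ({a..b} \<times> {0..1})"
    if x: "0 \<le> x" "x \<le> 1" for x
  proof -
    \<comment> \<open>The admissible width is quantified inside the predicate, since it may shrink
      to a minimum at each stacking.\<close>
    let ?P = "\<lambda>c d. 0 \<le> c \<and> d \<le> 1 \<longrightarrow>
      (\<exists>r>0. \<forall>a b. a \<le> x \<and> x \<le> b \<and> b - a < r \<and> 0 \<le> a \<and> b \<le> 1 \<longrightarrow> lifts_on C p h ({a..b} \<times> {c..d}))"
    have "?P 0 (1::real)"
    proof (rule Bolzano[of 0 1 ?P])
      fix c d e :: real assume P: "?P c d" "?P d e" and le: "c \<le> d" "d \<le> e"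
      show "?P c e"
      proof
        assume "0 \<le> c \<and> e \<le> 1"
        then have "0 \<le> c \<and> d \<le> 1" "0 \<le> d \<and> e \<le> 1"
          using le by auto
        then obtain r1 r2 where r: "r1 > 0" "r2 > 0"
          "\<And>a b. a \<le> x \<and> x \<le> b \<and> b - a < r1 \<and> 0 \<le> a \<and> b \<le> 1 \<Longrightarrow> lifts_on C p h ({a..b} \<times> {c..d})"
          "\<And>a b. a \<le> x \<and> x \<le> b \<and> b - a < r2 \<and> 0 \<le> a \<and> b \<le> 1 \<Longrightarrow> lifts_on C p h ({a..b} \<times> {d..e})"
          using P by blast
        have "lifts_on C p h ({a..b} \<times> {c..e})"
          if "a \<le> x \<and> x \<le> b \<and> b - a < min r1 r2 \<and> 0 \<le> a \<and> b \<le> 1" for a b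
        proof -
          have eq: "{a..b} \<times> {c..e} = {a..b} \<times> {c..d} \<union> {a..b} \<times> {d..e}" using le by auto
          have int: "({a..b} \<times> {c..d}) \<inter> ({a..b} \<times> {d..e}) = {a..b} \<times> {d}" using le by auto
          show ?thesis
            unfolding eq
          proof (rule lifts_on_Un[OF cov])
            show "connected ({a..b} \<times> {c..d} \<inter> {a..b} \<times> {d..e})"
              unfolding int by (intro connected_Times) auto
            show "{a..b} \<times> {c..d} \<inter> {a..b} \<times> {d..e} \<noteq> {}"
              unfolding int using that by auto
          qed (use r that in \<open>auto intro!: closed_subset closed_Times\<close>)
        qed
        then show "\<exists>r>0. \<forall>a b. a \<le> x \<and> x \<le> b \<and> b - a < r \<and> 0 \<le> a \<and> b \<le> 1 \<longrightarrow> lifts_on C p h ({a..b} \<times> {c..e})"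
          using r(1,2) by (intro exI[of _ "min r1 r2"]) auto
      qed
    next
      fix y :: real assume y: "0 \<le> y" "y \<le> 1"
      obtain r where "r > 0" "\<And>a b c d. a \<le> x \<and> x \<le> b \<and> b - a < r \<and> 0 \<le> a \<and> b \<le> 1 \<and> c \<le> y \<and> y \<le> d \<and> d - c < r \<and> 0 \<le> c \<and> d \<le> 1
          \<Longrightarrow> lifts_on C p h ({a..b} \<times> {c..d})"
        using small[OF x y] by blast
      then show "\<exists>d>0. \<forall>a b. a \<le> y \<and> y \<le> b \<and> b - a < d \<longrightarrow> ?P a b"
        by (intro exI[of _ r]) blast
    qed simp
    then show ?thesis by simp
  qed
  let ?P = "\<lambda>a b. 0 \<le> a \<and> b \<le> 1 \<longrightarrow> lifts_on C p h ({a..b} \<times> {0..1})"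
  have "?P 0 (1::real)"
  proof (rule Bolzano[of 0 1 ?P])
    fix a b c :: real assume P: "?P a b" "?P b c" and le: "a \<le> b" "b \<le> c"
    show "?P a c"
    proof
      assume ac: "0 \<le> a \<and> c \<le> 1"
      have eq: "{a..c} \<times> {0..1::real} = {a..b} \<times> {0..1} \<union> {b..c} \<times> {0..1}" using le by auto
      have int: "({a..b} \<times> {0..1::real}) \<inter> ({b..c} \<times> {0..1}) = {b} \<times> {0..1}" using le by auto
      show "lifts_on C p h ({a..c} \<times> {0..1})"
        unfolding eq
      proof (rule lifts_on_Un[OF cov])
        show "connected ({a..b} \<times> {0..1::real} \<inter> {b..c} \<times> {0..1})"
          unfolding int by (intro connected_Times) auto
        show "{a..b} \<times> {0..1::real} \<inter> {b..c} \<times> {0..1} \<noteq> {}"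
          unfolding int by auto
      qed (use P le ac in \<open>auto intro!: closed_subset closed_Times\<close>)
    qed
  next
    fix x :: real assume "0 \<le> x" "x \<le> 1"
    from strip[OF this] show "\<exists>d>0. \<forall>a b. a \<le> x \<and> x \<le> b \<and> b - a < d \<longrightarrow> ?P a b"
      by blast
  qed simp
  then show ?thesis by simp
qed

lemma covering_square_lift:
  fixes h :: "real \<times> real \<Rightarrow> 'a::topological_space"
  assumes cov: "covering_space C p X"
    and h: "continuous_on ({0..1} \<times> {0..1}) h" "h ` ({0..1} \<times> {0..1}) \<subseteq> X"
    and e: "e \<in> C" "p e = h (0, 0)"
  obtains k where "\<And>s. s \<in> {0..1} \<Longrightarrow> path (\<lambda>t. k (s, t))" "\<And>t. t \<in> {0..1} \<Longrightarrow> path (\<lambda>s. k (s, t))"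
    "continuous_on ({0..1} \<times> {0..1}) k" "k (0, 0) = e"
    "\<And>s t. s \<in> {0..1} \<Longrightarrow> t \<in> {0..1} \<Longrightarrow> k (s, t) \<in> C"
    "\<And>s t. s \<in> {0..1} \<Longrightarrow> t \<in> {0..1} \<Longrightarrow> p (k (s, t)) = h (s, t)"
proof -
  have "(0, 0) \<in> {0..1::real} \<times> {0..1::real}" by simp
  then obtain k where k: "continuous_on ({0..1} \<times> {0..1}) k" "k ` ({0..1} \<times> {0..1}) \<subseteq> C" "k (0, 0) = e"
      "\<forall>z\<in>{0..1} \<times> {0..1}. p (k z) = h z"
    using lifts_on_square[OF cov h] e unfolding lifts_on_def by meson
  have "path (\<lambda>t. k (s, t))" if "s \<in> {0..1}" for s
    unfolding path_def
    by (rule continuous_on_compose2[OF k(1), where f = "\<lambda>t. (s, t)"])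
      (use that in \<open>auto intro!: continuous_intros\<close>)
  moreover have "path (\<lambda>s. k (s, t))" if "t \<in> {0..1}" for t
    unfolding path_def
    by (rule continuous_on_compose2[OF k(1), where f = "\<lambda>s. (s, t)"])
      (use that in \<open>auto intro!: continuous_intros\<close>)
  moreover have "k (s, t) \<in> C" "p (k (s, t)) = h (s, t)" if "s \<in> {0..1}" "t \<in> {0..1}" for s t
    using k(2,4) that by blast+
  ultimately show thesis
    using k(1,3) that by blast
qed

lemma covering_path_lift:
  fixes p :: "'b::topological_space \<Rightarrow> 'a::topological_space"
  assumes cov: "covering_space C p X" and g: "path g" "path_image g \<subseteq> X" and e: "e \<in> C" "p e = pathstart g"
  obtains k where "path k" "path_image k \<subseteq> C" "pathstart k = e" "\<And>t. t \<in> {0..1} \<Longrightarrow> p (k t) = g t"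
proof -
  have 1: "continuous_on ({0..1} \<times> {0..1}) (\<lambda>z::real \<times> real. g (snd z))"
    by (rule continuous_on_compose2[of "{0..1}" g])
      (use g(1) in \<open>auto simp: path_def intro!: continuous_intros\<close>)
  have 2: "(\<lambda>z::real \<times> real. g (snd z)) ` ({0..1} \<times> {0..1}) \<subseteq> X"
    using g(2) by (auto simp: path_image_def)
  have 3: "p e = g (snd (0::real, 0))"
    using e(2) by (simp add: pathstart_def)
  obtain k :: "real \<times> real \<Rightarrow> 'b"
    where "\<And>s. s \<in> {0..1} \<Longrightarrow> path (\<lambda>t. k (s, t))" "\<And>t. t \<in> {0..1} \<Longrightarrow> path (\<lambda>s. k (s, t))"
    "continuous_on ({0..1} \<times> {0..1}) k" "k (0, 0) = e"
    "\<And>s t. s \<in> {0..1} \<Longrightarrow> t \<in> {0..1} \<Longrightarrow> k (s, t) \<in> C"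
    "\<And>s t. s \<in> {0..1} \<Longrightarrow> t \<in> {0..1} \<Longrightarrow> p (k (s, t)) = g (snd (s, t))"
    by (rule covering_square_lift[OF cov 1 2 e(1) 3]) (rule that)
  note k = this(1,4,5,6)
  have zero: "(0::real) \<in> {0..1}" by simp
  show ?thesis
  proof
    show "path (\<lambda>t. k (0, t))" by (rule k(1)[OF zero])
    show "path_image (\<lambda>t. k (0, t)) \<subseteq> C" using k(3)[OF zero] by (auto simp: path_image_def)
    show "pathstart (\<lambda>t. k (0, t)) = e" using k(2) by (simp add: pathstart_def)
    show "p (k (0, t)) = g t" if "t \<in> {0..1}" for t using k(4)[OF zero that] by simp
  qed
qed

lemma covering_homotopic_lifts:
  fixes p :: "'b::topological_space \<Rightarrow> 'a::topological_space"
  assumes cov: "covering_space C p X" and hom: "homotopic_paths X g1 g2"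
    and k1: "path k1" "path_image k1 \<subseteq> C" "\<And>t. t \<in> {0..1} \<Longrightarrow> p (k1 t) = g1 t"
    and k2: "path k2" "path_image k2 \<subseteq> C" "\<And>t. t \<in> {0..1} \<Longrightarrow> p (k2 t) = g2 t"
    and start: "pathstart k1 = pathstart k2"
  shows "homotopic_paths C k1 k2"
proof -
  have unit: "(0::real) \<in> {0..1}" "(1::real) \<in> {0..1}" by auto
  obtain h :: "real \<times> real \<Rightarrow> 'a" where h: "continuous_on ({0..1} \<times> {0..1}) h" "h \<in> {0..1} \<times> {0..1} \<rightarrow> X"
      "\<forall>x\<in>{0..1}. h (0, x) = g1 x" "\<forall>x\<in>{0..1}. h (1, x) = g2 x"
      "\<forall>t\<in>{0..1}. h (t, 0) = g1 0 \<and> h (t, 1) = g1 1"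
    using hom unfolding homotopic_paths by (auto simp: pathstart_def pathfinish_def)
  have him: "h ` ({0..1} \<times> {0..1}) \<subseteq> X" using h(2) by blast
  have k1C: "k1 t \<in> C" and k2C: "k2 t \<in> C" if "t \<in> {0..1}" for t
    using k1(2) k2(2) that by (auto simp: path_image_def)
  have p0: "p (k1 0) = h (0, 0)"
    using k1(3)[OF unit(1)] h(3) unit by simp
  obtain k :: "real \<times> real \<Rightarrow> 'b"
    where k: "\<And>s. s \<in> {0..1} \<Longrightarrow> path (\<lambda>t. k (s, t))" "\<And>t. t \<in> {0..1} \<Longrightarrow> path (\<lambda>s. k (s, t))"
    "continuous_on ({0..1} \<times> {0..1}) k" "k (0, 0) = k1 0"
    "\<And>s t. s \<in> {0..1} \<Longrightarrow> t \<in> {0..1} \<Longrightarrow> k (s, t) \<in> C"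
    "\<And>s t. s \<in> {0..1} \<Longrightarrow> t \<in> {0..1} \<Longrightarrow> p (k (s, t)) = h (s, t)"
    by (rule covering_square_lift[OF cov h(1) him k1C[OF unit(1)] p0]) (rule that)
  have agree: "l1 t = l2 t"
    if "path l1" "path l2" "\<And>s. s \<in> {0..1} \<Longrightarrow> l1 s \<in> C" "\<And>s. s \<in> {0..1} \<Longrightarrow> l2 s \<in> C"
      "\<And>s. s \<in> {0..1} \<Longrightarrow> p (l1 s) = p (l2 s)" "l1 0 = l2 0" "t \<in> {0..1}" for l1 l2 t
    by (rule covering_lifts_agree[OF cov, where S = "{0..1::real}" and a = 0])
      (use that in \<open>auto simp: path_def\<close>)
  have const: "path (\<lambda>s::real. c)" for c :: 'b by (simp add: path_def)
  \<comment> \<open>The sides of the lifted square are identified by uniqueness. The side over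
    \<open>g1\<close> comes first; the two sides over the fixed endpoints are then constant, and
    they provide the starting point for the side over \<open>g2\<close>.\<close>
  have k0: "k (0, t) = k1 t" if "t \<in> {0..1}" for t
    by (rule agree[of "\<lambda>t. k (0, t)" k1 t])
      (simp_all only: k(1)[OF unit(1)] k1(1) k(4,5) k1C k(6) k1(3) h(3) unit that)
  have ks: "k (s, 0) = k1 0" if "s \<in> {0..1}" for s
    by (rule agree[of "\<lambda>s. k (s, 0)" "\<lambda>_. k1 0" s])
      (simp_all only: k(2)[OF unit(1)] const k(4,5) k1C k(6) k1(3) h(5) unit that)
  have kf: "k (s, 1) = k1 1" if "s \<in> {0..1}" for s
    by (rule agree[of "\<lambda>s. k (s, 1)" "\<lambda>_. k1 1" s])
      (simp_all only: k(2)[OF unit(2)] const k(5) k0 k1C k(6) k1(3) h(5) unit that)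
  have kk: "k (1, t) = k2 t" if "t \<in> {0..1}" for t
    by (rule agree[of "\<lambda>t. k (1, t)" k2 t])
      (simp_all only: k(1)[OF unit(2)] k2(1) ks k(5) k2C k(6) k2(3) h(4) unit that start[unfolded pathstart_def])
  show ?thesis
    unfolding homotopic_paths
  proof (intro exI conjI)
    show "k \<in> {0..1} \<times> {0..1} \<rightarrow> C" using k(5) by auto
  qed (use k(3) k0 ks kf kk in \<open>auto simp: pathstart_def pathfinish_def\<close>)
qed

section \<open>Paths and relative one-dimensional homology\<close>

text \<open>Constant tails and backtracking are removed by reparametrisation: any two paths in the
  convex interval with the same ends are homotopic, and \<open>p\<close> carries that homotopy
  along.\<close>

lemma homotopic_paths_precompose:
  fixes f g :: "real \<Rightarrow> real"
  assumes p: "path p" "path_image p \<subseteq> S" and fg: "homotopic_paths {0..1} f g"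
  shows "homotopic_paths S (p \<circ> f) (p \<circ> g)"
  using homotopic_paths_continuous_image[OF fg, of p S] p by (auto simp: path_def path_image_def)

lemma homotopic_paths_unit_interval:
  fixes f g :: "real \<Rightarrow> real"
  assumes "path f" "path_image f \<subseteq> {0..1}" "path g" "path_image g \<subseteq> {0..1}"
    "pathstart f = pathstart g" "pathfinish f = pathfinish g"
  shows "homotopic_paths {0..1} f g"
  using convex_imp_simply_connected[of "{0..1::real}"] assms
  unfolding simply_connected_eq_homotopic_paths by simp

lemma compose_linepath_0_1: "p \<circ> linepath 0 1 = p"
  by (simp add: fun_eq_iff linepath_def)

lemma homotopic_paths_join_const:
  assumes p: "path p" "path_image p \<subseteq> S"
  shows "homotopic_paths S (p +++ (\<lambda>_. pathfinish p)) p"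
proof -
  have "homotopic_paths S (p \<circ> (linepath 0 1 +++ linepath 1 1)) (p \<circ> linepath 0 1)"
    by (intro homotopic_paths_precompose[OF p] homotopic_paths_unit_interval)
      (auto simp: path_image_join closed_segment_eq_real_ivl)
  moreover have "p \<circ> linepath 1 1 = (\<lambda>_. pathfinish p)"
    by (simp add: fun_eq_iff linepath_def pathfinish_def)
  ultimately show ?thesis
    by (simp add: path_compose_join compose_linepath_0_1)
qed

lemma homotopic_paths_reverse_join:
  assumes p: "path p" "path_image p \<subseteq> S"
  shows "homotopic_paths S (reversepath p +++ p) (\<lambda>_. pathfinish p)"
proof -
  have "homotopic_paths S (p \<circ> (linepath 1 0 +++ linepath 0 1)) (p \<circ> linepath 1 1)"
    by (intro homotopic_paths_precompose[OF p] homotopic_paths_unit_interval)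
      (auto simp: path_image_join closed_segment_eq_real_ivl)
  moreover have "p \<circ> linepath 1 0 = reversepath p" "p \<circ> linepath 1 1 = (\<lambda>_. pathfinish p)"
    by (simp_all add: fun_eq_iff linepath_def pathfinish_def reversepath_def)
  ultimately show ?thesis
    by (simp add: path_compose_join compose_linepath_0_1)
qed

lemma path_const [simp]: "path (\<lambda>_. x)"
  by (simp add: path_def)

lemma path_image_const [simp]: "path_image (\<lambda>_. x) = {x}"
  by (auto simp: path_image_def)

lemma pathstart_const [simp]: "pathstart (\<lambda>_. x) = x"
  by (simp add: pathstart_def)

lemma pathfinish_const [simp]: "pathfinish (\<lambda>_. x) = x"
  by (simp add: pathfinish_def)

lemma homotopic_paths_join_reverse_join:
  assumes p: "path p" "path_image p \<subseteq> S" and q: "path q" "path_image q \<subseteq> S"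
    and eq: "pathfinish p = pathfinish q"
  shows "homotopic_paths S ((p +++ reversepath q) +++ q) p"
proof -
  have "homotopic_paths S ((p +++ reversepath q) +++ q) (p +++ (reversepath q +++ q))"
    by (rule homotopic_paths_sym[OF homotopic_paths_assoc]) (use p q eq in auto)
  also have "homotopic_paths S \<dots> (p +++ (\<lambda>_. pathfinish p))"
    unfolding eq by (rule homotopic_paths_join[OF _ homotopic_paths_reverse_join[OF q]]) (use p eq in auto)
  also have "homotopic_paths S \<dots> p"
    by (rule homotopic_paths_join_const[OF p])
  finally show ?thesis .
qed

section \<open>Singular simplices of dimension 1 and 2 as paths and homotopies\<close>

definition edge_simplex :: "(real \<Rightarrow> 'a) \<Rightarrow> (nat \<Rightarrow> real) \<Rightarrow> 'a" where
  "edge_simplex \<gamma> = restrict (\<lambda>x. \<gamma> (x 1)) (standard_simplex 1)"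

text \<open>The parameter is the barycentric coordinate with index 1, so face 1 is the start of the
  path and face 0 its end. \<open>edge_simplex\<close> and \<open>simplex_path\<close> are inverse
  to each other up to values outside their domains.\<close>

definition simplex_path :: "((nat \<Rightarrow> real) \<Rightarrow> 'a) \<Rightarrow> real \<Rightarrow> 'a" where
  "simplex_path \<sigma> t = \<sigma> (\<lambda>i. if i = 0 then 1 - t else if i = 1 then t else 0)"

lemma singular_simplex_top_of_set:
  fixes Y :: "'a::topological_space set"
  shows "singular_simplex n (top_of_set Y) f \<longleftrightarrow>
    continuous_on (standard_simplex n) f \<and> f ` standard_simplex n \<subseteq> Y \<and> f \<in> extensional (standard_simplex n)"
  by (auto simp: singular_simplex_def euclidean_product_topology continuous_map_in_subtopology)

lemma standard_simplex_1:
  "x \<in> standard_simplex 1 \<longleftrightarrow> 0 \<le> x 1 \<and> x 1 \<le> 1 \<and> x 0 = 1 - x 1 \<and> (\<forall>i>1. x i = 0)"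
  (is "?L \<longleftrightarrow> ?R")
proof
  assume ?R
  then have "0 \<le> x i \<and> x i \<le> 1" for i
    by (cases "i = 0"; cases "i = 1") auto
  then show ?L using \<open>?R\<close> by (auto simp: standard_simplex_def)
qed (auto simp: standard_simplex_def)

lemmas standard_simplex_Suc_0 = standard_simplex_1[unfolded One_nat_def]

lemma standard_simplex_2:
  assumes "x \<in> standard_simplex 2"
  shows "0 \<le> x 2" "0 \<le> x 1" "x 1 + x 2 \<le> 1" "x 0 = 1 - x 1 - x 2"
proof -
  have "x 0 + x 1 + x 2 = 1" "0 \<le> x 0"
    using assms by (auto simp: standard_simplex_def numeral_2_eq_2)
  then show "x 1 + x 2 \<le> 1" "x 0 = 1 - x 1 - x 2" by auto
qed (use assms in \<open>auto simp: standard_simplex_def\<close>)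

lemma singular_simplex_edge_simplex:
  assumes "path \<gamma>" "path_image \<gamma> \<subseteq> Y"
  shows "singular_simplex 1 (top_of_set Y) (edge_simplex \<gamma>)"
proof -
  have "continuous_on (standard_simplex 1) (\<lambda>x. \<gamma> (x 1))"
  proof (rule continuous_on_compose2[of "{0..1}" \<gamma>])
    show "continuous_on (standard_simplex 1) (\<lambda>x. x 1 :: real)"
      by (rule continuous_on_subset[OF continuous_on_product_coordinates]) simp
  qed (use assms in \<open>auto simp: path_def standard_simplex_Suc_0\<close>)
  then have "continuous_on (standard_simplex 1) (edge_simplex \<gamma>)"
    by (rule continuous_on_eq) (simp add: edge_simplex_def)
  moreover have "edge_simplex \<gamma> ` standard_simplex 1 \<subseteq> Y"
    using assms(2) by (auto simp: edge_simplex_def path_image_def standard_simplex_Suc_0)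
  ultimately show ?thesis
    by (simp add: singular_simplex_top_of_set edge_simplex_def)
qed

lemma path_simplex_path:
  fixes Y :: "'a::topological_space set"
  assumes "singular_simplex 1 (top_of_set Y) \<sigma>"
  shows "path (simplex_path \<sigma>)" "path_image (simplex_path \<sigma>) \<subseteq> Y"
proof -
  have "continuous_on {0..1} (\<lambda>t. \<sigma> (\<lambda>i. if i = 0 then 1 - t else if i = 1 then t else 0))"
  proof (rule continuous_on_compose2[of "standard_simplex 1" \<sigma>])
    have "continuous_on {0..1} (\<lambda>t. if i = 0 then 1 - t else if i = 1 then t else 0 :: real)" for i :: nat
      by (cases "i = 0"; cases "i = 1") (auto intro!: continuous_intros)
    then show "continuous_on {0..1} (\<lambda>t i :: nat. if i = 0 then 1 - t else if i = 1 then t else 0 :: real)"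
      by (rule continuous_on_coordinatewise_then_product)
  qed (use assms in \<open>auto simp: singular_simplex_top_of_set standard_simplex_Suc_0\<close>)
  then show "path (simplex_path \<sigma>)"
    by (simp add: path_def simplex_path_def[abs_def])
  have "simplex_path \<sigma> t \<in> Y" if "t \<in> {0..1}" for t
  proof -
    have "(\<lambda>i. if i = 0 then 1 - t else if i = 1 then t else 0) \<in> standard_simplex 1"
      using that by (simp add: standard_simplex_Suc_0)
    then show ?thesis using assms unfolding singular_simplex_top_of_set simplex_path_def by blast
  qed
  then show "path_image (simplex_path \<sigma>) \<subseteq> Y"
    by (auto simp: path_image_def)
qed

lemma simplex_path_edge_simplex:
  assumes "t \<in> {0..1}"
  shows "simplex_path (edge_simplex \<gamma>) t = \<gamma> t"
  using assms by (simp add: simplex_path_def edge_simplex_def standard_simplex_Suc_0)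

lemma edge_simplex_simplex_path:
  assumes "\<sigma> \<in> extensional (standard_simplex 1)"
  shows "edge_simplex (simplex_path \<sigma>) = \<sigma>"
proof
  fix x
  show "edge_simplex (simplex_path \<sigma>) x = \<sigma> x"
  proof (cases "x \<in> standard_simplex 1")
    case True
    then have "(\<lambda>i. if i = 0 then 1 - x 1 else if i = 1 then x 1 else 0) = x"
      by (auto simp: standard_simplex_Suc_0 fun_eq_iff)
    with True show ?thesis by (simp only: edge_simplex_def simplex_path_def restrict_def if_True)
  next
    case False
    then show ?thesis using assms by (simp add: edge_simplex_def extensional_def)
  qed
qed

lemma edge_simplex_cong:
  assumes "\<And>t. t \<in> {0..1} \<Longrightarrow> \<gamma> t = \<delta> t"
  shows "edge_simplex \<gamma> = edge_simplex \<delta>"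
  unfolding edge_simplex_def by (rule restrict_ext) (use assms in \<open>auto simp: standard_simplex_Suc_0\<close>)

text \<open>The vertices 0, 1, 2 go to \<open>(0, 0)\<close>, \<open>(0, 1)\<close>,
  \<open>(1, 1)\<close>, so the simplex is the half \<open>s \<le> t\<close> of the unit
  square.\<close>

definition triangle_simplex :: "(real \<times> real \<Rightarrow> 'a) \<Rightarrow> (nat \<Rightarrow> real) \<Rightarrow> 'a" where
  "triangle_simplex H = restrict (\<lambda>x. H (x 2, x 1 + x 2)) (standard_simplex 2)"

lemma singular_face_2:
  assumes "k \<le> 2"
  shows "singular_face 2 k (triangle_simplex H) =
    edge_simplex (\<lambda>t. H (if k = 0 then t else if k = 1 then t else 0, if k = 0 then 1 else t))"
proof
  fix x :: "nat \<Rightarrow> real"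
  show "singular_face 2 k (triangle_simplex H) x =
    edge_simplex (\<lambda>t. H (if k = 0 then t else if k = 1 then t else 0, if k = 0 then 1 else t)) x"
  proof (cases "x \<in> standard_simplex 1")
    case True
    have "simplical_face k x \<in> standard_simplex 2"
      by (rule simplical_face_in_standard_simplex) (use True assms in auto)
    moreover have "k = 0 \<or> k = 1 \<or> k = 2" using assms by auto
    ultimately show ?thesis
      using True standard_simplex_1[of x]
      by (auto simp: singular_face_def triangle_simplex_def edge_simplex_def simplical_face_def numeral_2_eq_2)
  qed (simp add: singular_face_def edge_simplex_def)
qed

lemma triangle_boundary:
  fixes Y :: "'a::topological_space set"
  assumes H: "continuous_on {(s, t). 0 \<le> s \<and> s \<le> t \<and> t \<le> 1} H"
    and Y: "\<And>s t. 0 \<le> s \<Longrightarrow> s \<le> t \<Longrightarrow> t \<le> 1 \<Longrightarrow> H (s, t) \<in> Y"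
  shows "singular_relboundary 1 (top_of_set Y) F
    (frag_of (edge_simplex (\<lambda>t. H (t, 1))) - frag_of (edge_simplex (\<lambda>t. H (t, t))) + frag_of (edge_simplex (\<lambda>t. H (0, t))))"
    (is "singular_relboundary _ _ _ ?c")
proof -
  have coord: "continuous_on (standard_simplex 2) (\<lambda>x. x i :: real)" for i
    by (rule continuous_on_subset[OF continuous_on_product_coordinates]) simp
  have "continuous_on (standard_simplex 2) (\<lambda>x. H (x 2, x 1 + x 2))"
    by (rule continuous_on_compose2[OF H])
      (auto intro!: continuous_intros coord dest: standard_simplex_2)
  then have "continuous_on (standard_simplex 2) (triangle_simplex H)"
    by (rule continuous_on_eq) (simp add: triangle_simplex_def)
  moreover have "triangle_simplex H ` standard_simplex 2 \<subseteq> Y"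
  proof clarify
    fix x :: "nat \<Rightarrow> real" assume "x \<in> standard_simplex 2"
    then show "triangle_simplex H x \<in> Y"
      using Y[of "x 2" "x 1 + x 2"] standard_simplex_2[of x] by (simp add: triangle_simplex_def)
  qed
  ultimately have "singular_simplex 2 (top_of_set Y) (triangle_simplex H)"
    by (simp add: singular_simplex_top_of_set triangle_simplex_def)
  then have "singular_chain (Suc 1) (top_of_set Y) (frag_of (triangle_simplex H))"
    by (simp add: singular_chain_of numeral_2_eq_2)
  moreover have "{..2::nat} = {0, 1, 2}" by auto
  then have "chain_boundary (Suc 1) (frag_of (triangle_simplex H)) = ?c"
    by (simp add: chain_boundary_of singular_face_2 numeral_2_eq_2[symmetric])
  ultimately show ?thesis
    unfolding singular_relboundary_def mod_subset_def by (intro exI[of _ "frag_of (triangle_simplex H)"]) simp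
qed

abbreviation edge_chain :: "(real \<Rightarrow> 'a) \<Rightarrow> 'a chain" where
  "edge_chain \<gamma> \<equiv> frag_of (edge_simplex \<gamma>)"

text \<open>A constant triangle has three equal edges with signs +, -, +, so one copy of the edge
  remains as its boundary.\<close>

lemma relboundary_const:
  assumes "x \<in> Y"
  shows "singular_relboundary 1 (top_of_set Y) F (edge_chain (\<lambda>_. x))"
  using triangle_boundary[of "\<lambda>_. x" Y F] assms by simp

lemma relboundary_join:
  assumes p: "path p" "path_image p \<subseteq> Y" and q: "path q" "path_image q \<subseteq> Y" and pq: "pathfinish p = pathstart q"
  shows "singular_relboundary 1 (top_of_set Y) F
    (edge_chain p + edge_chain q - edge_chain (p +++ q))"
proof -
  \<comment> \<open>The argument runs from 0 to 1/2 on the edge \<open>s = 0\<close>, from 1/2 to 1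
    on the edge \<open>t = 1\<close>, and over the whole interval on the diagonal: the edges are
    \<open>p\<close>, \<open>q\<close> and \<open>p +++ q\<close>.\<close>
  define H where "H z = (p +++ q) ((fst z + snd z) / 2)" for z
  have pq': "path (p +++ q)" "path_image (p +++ q) \<subseteq> Y"
    using p q pq by (auto simp: path_image_join)
  have cont: "continuous_on {(s, t). 0 \<le> s \<and> s \<le> t \<and> t \<le> 1} H"
    unfolding H_def
    by (rule continuous_on_compose2[of "{0..1}" "p +++ q"])
      (use pq' in \<open>auto simp: path_def intro!: continuous_intros\<close>)
  have Y: "H (s, t) \<in> Y" if "0 \<le> s" "s \<le> t" "t \<le> 1" for s t
    using pq'(2) that by (auto simp: H_def path_image_def)
  have "edge_simplex (\<lambda>t. H (0, t)) = edge_simplex p"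
    by (rule edge_simplex_cong) (simp add: H_def joinpaths_def)
  moreover have "edge_simplex (\<lambda>t. H (t, 1)) = edge_simplex q"
    using pq by (intro edge_simplex_cong) (auto simp: H_def joinpaths_def pathfinish_def pathstart_def field_simps)
  moreover have "edge_simplex (\<lambda>t. H (t, t)) = edge_simplex (p +++ q)"
    by (rule edge_simplex_cong) (simp add: H_def)
  ultimately show ?thesis
    using triangle_boundary[OF cont Y, of F] by (simp add: algebra_simps)
qed

text \<open>The square of the homotopy is cut along its diagonal; \<open>h'\<close> is the second
  half with coordinates swapped. In the difference of the two boundaries the diagonal cancels, and
  the sides over the endpoints are constant edges, hence boundaries.\<close>

lemma relboundary_homotopic:
  assumes "homotopic_paths Y p q"
  shows "singular_relboundary 1 (top_of_set Y) F (edge_chain p - edge_chain q)"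
proof -
  obtain h :: "real \<times> real \<Rightarrow> 'a" where h: "continuous_on ({0..1} \<times> {0..1}) h" "h \<in> {0..1} \<times> {0..1} \<rightarrow> Y"
      "\<forall>t\<in>{0..1}. h (0, t) = p t" "\<forall>t\<in>{0..1}. h (1, t) = q t"
      "\<forall>t\<in>{0..1}. h (t, 0) = p 0 \<and> h (t, 1) = p 1"
    using assms unfolding homotopic_paths by (auto simp: pathstart_def pathfinish_def)
  define h' where "h' z = h (snd z, fst z)" for z
  have cont: "continuous_on {(s, t). 0 \<le> s \<and> s \<le> t \<and> t \<le> 1} h"
    by (rule continuous_on_subset[OF h(1)]) auto
  have cont': "continuous_on {(s, t). 0 \<le> s \<and> s \<le> t \<and> t \<le> 1} h'"
    unfolding h'_def by (rule continuous_on_compose2[OF h(1)]) (auto intro!: continuous_intros)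
  have Y: "h (s, t) \<in> Y" "h' (s, t) \<in> Y" if "0 \<le> s" "s \<le> t" "t \<le> 1" for s t
    using h(2) that by (auto simp: h'_def Pi_iff)
  have pY: "p 0 \<in> Y" "p 1 \<in> Y"
    using homotopic_paths_imp_subset[OF assms] by (auto simp: path_image_def)
  have e1: "edge_simplex (\<lambda>t. h (0, t)) = edge_simplex p"
    by (rule edge_simplex_cong) (rule bspec[OF h(3)])
  have e2: "edge_simplex (\<lambda>t. h (t, 1)) = edge_simplex (\<lambda>_. p 1)"
    by (rule edge_simplex_cong) (rule conjunct2[OF bspec[OF h(5)]])
  have e3: "edge_simplex (\<lambda>t. h' (0, t)) = edge_simplex (\<lambda>_. p 0)"
    by (rule edge_simplex_cong) (simp only: h'_def fst_conv snd_conv conjunct1[OF bspec[OF h(5)]])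
  have e4: "edge_simplex (\<lambda>t. h' (t, 1)) = edge_simplex q"
    by (rule edge_simplex_cong) (simp only: h'_def fst_conv snd_conv bspec[OF h(4)])
  have e5: "h' (t, t) = h (t, t)" for t
    by (simp add: h'_def)
  let ?e = edge_chain and ?R = "singular_relboundary 1 (top_of_set Y) F"
  have "?R (?e (\<lambda>_. p 1) - ?e (\<lambda>t. h (t, t)) + ?e p)"
    using triangle_boundary[OF cont Y(1), of F] unfolding e1 e2 .
  moreover have "?R (?e q - ?e (\<lambda>t. h (t, t)) + ?e (\<lambda>_. p 0))"
    using triangle_boundary[OF cont' Y(2), of F] unfolding e3 e4 e5 .
  ultimately have "?R ((?e (\<lambda>_. p 1) - ?e (\<lambda>t. h (t, t)) + ?e p) - (?e q - ?e (\<lambda>t. h (t, t)) + ?e (\<lambda>_. p 0))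
      - (?e (\<lambda>_. p 1) - ?e (\<lambda>_. p 0)))"
    using relboundary_const pY by (intro singular_relboundary_diff) auto
  then show ?thesis by (simp add: algebra_simps)
qed


text \<open>Conversely, a 2-simplex provides a homotopy, because two paths around the convex
  triangle with the same ends are homotopic in it. This yields the cocycle condition in
  \<open>ex_functional\<close>.\<close>

lemma simplex_path_face_join:
  fixes Y :: "'a::topological_space set"
  assumes s: "singular_simplex 2 (top_of_set Y) s"
  shows "homotopic_paths Y (simplex_path (singular_face 2 2 s) +++ simplex_path (singular_face 2 0 s))
    (simplex_path (singular_face 2 1 s))" (is ?hom)
    and "pathfinish (simplex_path (singular_face 2 2 s)) = pathstart (simplex_path (singular_face 2 0 s))" (is ?ends)
proof -
  define T where "T = {(a, b). 0 \<le> a \<and> a \<le> b \<and> b \<le> (1::real)}"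
  define G where "G = (\<lambda>(a, b). s (\<lambda>i. if i = 0 then 1 - b else if i = 1 then b - a else if i = 2 then a else 0))"
  have in2: "(\<lambda>i. if i = 0 then 1 - b else if i = 1 then b - a else if i = 2 then a else 0) \<in> standard_simplex 2"
    if "(a, b) \<in> T" for a b
    using that by (auto simp: T_def standard_simplex_def numeral_2_eq_2)
  have contG: "continuous_on T G"
    unfolding G_def case_prod_unfold
  proof (rule continuous_on_compose2[of "standard_simplex 2" s])
    have "continuous_on T (\<lambda>z. if i = 0 then 1 - snd z else if i = 1 then snd z - fst z else if i = 2 then fst z else 0)"
      for i :: nat
      by (cases "i = 0"; cases "i = 1"; cases "i = 2") (auto intro!: continuous_intros)
    then show "continuous_on T (\<lambda>z i :: nat. if i = 0 then 1 - snd z else if i = 1 then snd z - fst z else if i = 2 then fst z else 0)"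
      by (rule continuous_on_coordinatewise_then_product)
    show "(\<lambda>z i :: nat. if i = 0 then 1 - snd z else if i = 1 then snd z - fst z else if i = 2 then fst z else 0) ` T
        \<subseteq> standard_simplex 2"
      using in2 by auto
  qed (use s in \<open>simp add: singular_simplex_top_of_set\<close>)
  have GY: "G \<in> T \<rightarrow> Y"
    using s in2 unfolding singular_simplex_top_of_set G_def by auto
  have "convex T"
  proof -
    have "T = {z. 0 \<le> (1, 0) \<bullet> z} \<inter> {z. 0 \<le> (- 1, 1) \<bullet> z} \<inter> {z. (0, 1) \<bullet> z \<le> 1}"
      by (auto simp: T_def)
    then show ?thesis
      by (simp add: convex_Int convex_halfspace_ge convex_halfspace_le)
  qed
  then have sc: "simply_connected T"
    by (rule convex_imp_simply_connected)
  define l2 l0 l1 where "l2 = (\<lambda>t::real. (0::real, t))" and "l0 = (\<lambda>t::real. (t, 1::real))" and "l1 = (\<lambda>t::real. (t, t))"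
  have l: "path l2" "path l0" "path l1" "path_image l2 \<subseteq> T" "path_image l0 \<subseteq> T" "path_image l1 \<subseteq> T"
    "pathstart l2 = (0, 0)" "pathfinish l2 = (0, 1)" "pathstart l0 = (0, 1)" "pathfinish l0 = (1, 1)"
    "pathstart l1 = (0, 0)" "pathfinish l1 = (1, 1)"
    by (auto simp: l2_def l0_def l1_def path_def path_image_def T_def pathstart_def pathfinish_def intro!: continuous_intros)
  have "homotopic_paths T (l2 +++ l0) l1"
    using sc l unfolding simply_connected_eq_homotopic_paths by (auto simp: path_image_join)
  from homotopic_paths_continuous_image[OF this contG GY]
  have hom: "homotopic_paths Y ((G \<circ> l2) +++ (G \<circ> l0)) (G \<circ> l1)"
    by (simp add: path_compose_join)
  have face: "simplex_path (singular_face 2 2 s) t = (G \<circ> l2) t" "simplex_path (singular_face 2 0 s) t = (G \<circ> l0) t"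
    "simplex_path (singular_face 2 1 s) t = (G \<circ> l1) t" if "t \<in> {0..1}" for t
  proof -
    have x: "(\<lambda>i. if i = 0 then 1 - t else if i = 1 then t else 0) \<in> standard_simplex 1"
      using that by (simp add: standard_simplex_Suc_0)
    show "simplex_path (singular_face 2 2 s) t = (G \<circ> l2) t" "simplex_path (singular_face 2 0 s) t = (G \<circ> l0) t"
      "simplex_path (singular_face 2 1 s) t = (G \<circ> l1) t"
      using x by (auto simp: simplex_path_def singular_face_def G_def l2_def l0_def l1_def simplical_face_def fun_eq_iff
          intro!: arg_cong[where f = s])
  qed
  have "pathfinish (G \<circ> l2) = pathstart (G \<circ> l0)"
    by (simp add: pathfinish_compose pathstart_compose l)
  moreover have "path (G \<circ> l)" "path_image (G \<circ> l) \<subseteq> Y" if "path l" "path_image l \<subseteq> T" for l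
    using that contG GY by (auto simp: path_image_compose intro: path_continuous_image continuous_on_subset)
  ultimately have G: "path ((G \<circ> l2) +++ (G \<circ> l0))" "path_image ((G \<circ> l2) +++ (G \<circ> l0)) \<subseteq> Y"
    "path (G \<circ> l1)" "path_image (G \<circ> l1) \<subseteq> Y"
    using l by (auto simp: path_image_join)
  have "homotopic_paths Y ((G \<circ> l2) +++ (G \<circ> l0)) (simplex_path (singular_face 2 2 s) +++ simplex_path (singular_face 2 0 s))"
    by (rule homotopic_paths_eq[OF G(1,2)]) (use face in \<open>auto simp: joinpaths_def\<close>)
  moreover have "homotopic_paths Y (G \<circ> l1) (simplex_path (singular_face 2 1 s))"
    by (rule homotopic_paths_eq[OF G(3,4)]) (use face in auto)
  ultimately show ?hom
    using hom by (meson homotopic_paths_sym homotopic_paths_trans)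
  show ?ends
    using face(1)[of 1] face(2)[of 0] by (simp add: pathfinish_def pathstart_def l2_def l0_def)
qed

text \<open>Every chain is homologous to loops at \<open>x0\<close> plus the paths \<open>b x\<close> from \<open>x0\<close> to the points \<open>x\<close> of its boundary.\<close>

lemma relcycle_induct_paths:
  fixes Y :: "'a::topological_space set"
  assumes c: "singular_relcycle 1 (top_of_set Y) F c"
    and Y: "path_connected Y" and x0: "x0 \<in> Y" "x0 \<in> F" and F: "F \<subseteq> Y"
    and path: "\<And>\<gamma>. path \<gamma> \<Longrightarrow> path_image \<gamma> \<subseteq> Y \<Longrightarrow> pathstart \<gamma> = x0 \<Longrightarrow> pathfinish \<gamma> \<in> F \<Longrightarrow> P (edge_chain \<gamma>)"
    and diff: "\<And>a b. P a \<Longrightarrow> P b \<Longrightarrow> P (a - b)"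
    and boundary: "\<And>a. singular_relboundary 1 (top_of_set Y) F a \<Longrightarrow> P a"
  shows "P c"
proof -
  have zero: "P 0" using boundary[of 0] by simp
  have add: "P (a + b)" if "P a" "P b" for a b
    using diff[OF that(1) diff[OF zero that(2)]] by simp
  have "\<forall>x. \<exists>\<gamma>. x \<in> Y \<longrightarrow> path \<gamma> \<and> path_image \<gamma> \<subseteq> Y \<and> pathstart \<gamma> = x0 \<and> pathfinish \<gamma> = x"
    using Y x0 unfolding path_connected_def by blast
  then obtain b where b: "\<And>x. x \<in> Y \<Longrightarrow> path (b x)" "\<And>x. x \<in> Y \<Longrightarrow> path_image (b x) \<subseteq> Y"
    "\<And>x. x \<in> Y \<Longrightarrow> pathstart (b x) = x0" "\<And>x. x \<in> Y \<Longrightarrow> pathfinish (b x) = x"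
    by metis
  let ?e = edge_chain and ?R = "singular_relboundary 1 (top_of_set Y) F"
  let ?v = "\<lambda>i::nat. if i = 0 then 1 else 0 :: real"
  define B where "B = frag_extend (\<lambda>\<sigma>. ?e (b (\<sigma> ?v)))"
  have edge: "P (frag_of \<sigma> - B (chain_boundary 1 (frag_of \<sigma>)))" if \<sigma>: "singular_simplex 1 (top_of_set Y) \<sigma>" for \<sigma>
  proof -
    define \<gamma> where "\<gamma> = simplex_path \<sigma>"
    have \<gamma>: "path \<gamma>" "path_image \<gamma> \<subseteq> Y" and e\<gamma>: "edge_simplex \<gamma> = \<sigma>"
      using path_simplex_path[OF \<sigma>] edge_simplex_simplex_path \<sigma> unfolding \<gamma>_def singular_simplex_def by auto
    have ends: "pathstart \<gamma> \<in> Y" "pathfinish \<gamma> \<in> Y" using \<gamma>(2) by auto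
    have v: "?v \<in> standard_simplex 0" by (auto simp: standard_simplex_def)
    have s0: "singular_face 1 1 \<sigma> ?v = pathstart \<gamma>"
      using v by (auto simp: singular_face_def simplical_face_def \<gamma>_def simplex_path_def pathstart_def fun_eq_iff
          intro!: arg_cong[where f = \<sigma>])
    have s1: "singular_face 1 0 \<sigma> ?v = pathfinish \<gamma>"
      using v by (auto simp: singular_face_def simplical_face_def \<gamma>_def simplex_path_def pathfinish_def fun_eq_iff
          intro!: arg_cong[where f = \<sigma>])
    have "{..1::nat} = {0, 1}" by auto
    then have "chain_boundary 1 (frag_of \<sigma>) = frag_of (singular_face 1 0 \<sigma>) - frag_of (singular_face 1 1 \<sigma>)"
      by (simp add: chain_boundary_of)
    then have B: "B (chain_boundary 1 (frag_of \<sigma>)) = ?e (b (pathfinish \<gamma>)) - ?e (b (pathstart \<gamma>))"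
      unfolding B_def by (simp only: frag_extend_diff frag_extend_of s0 s1)
    define a z where "a = b (pathstart \<gamma>)" and "z = b (pathfinish \<gamma>)"
    have az: "path a" "path_image a \<subseteq> Y" "pathstart a = x0" "pathfinish a = pathstart \<gamma>"
      "path z" "path_image z \<subseteq> Y" "pathstart z = x0" "pathfinish z = pathfinish \<gamma>"
      unfolding a_def z_def using b ends by auto
    \<comment> \<open>The edge is closed up to a loop at \<open>x0\<close>; modulo boundaries it
      equals this loop plus \<open>z\<close> minus \<open>a\<close>.\<close>
    define l where "l = (a +++ \<gamma>) +++ reversepath z"
    have l: "path l" "path_image l \<subseteq> Y" "pathstart l = x0" "pathfinish l = x0"
      unfolding l_def using az \<gamma> by (auto simp: path_image_join)
    have "homotopic_paths Y (l +++ z) (a +++ \<gamma>)"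
      unfolding l_def by (rule homotopic_paths_join_reverse_join) (use az \<gamma> in \<open>auto simp: path_image_join\<close>)
    then have 1: "?R (?e (l +++ z) - ?e (a +++ \<gamma>))"
      by (rule relboundary_homotopic)
    have 2: "?R (?e a + ?e \<gamma> - ?e (a +++ \<gamma>))" "?R (?e l + ?e z - ?e (l +++ z))"
      by (rule relboundary_join; use az \<gamma> l in simp)+
    have "P (?e l + ((?e a + ?e \<gamma> - ?e (a +++ \<gamma>)) - (?e l + ?e z - ?e (l +++ z)) - (?e (l +++ z) - ?e (a +++ \<gamma>))))"
      by (intro add path boundary singular_relboundary_diff 1 2) (use l x0 in auto)
    also have "?e l + ((?e a + ?e \<gamma> - ?e (a +++ \<gamma>)) - (?e l + ?e z - ?e (l +++ z)) - (?e (l +++ z) - ?e (a +++ \<gamma>))) =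
        ?e \<gamma> - (?e z - ?e a)"
      by (simp add: algebra_simps)
    finally show ?thesis unfolding B a_def z_def e\<gamma> .
  qed
  have chain: "P (c - B (chain_boundary 1 c))" if "singular_chain 1 (top_of_set Y) c" for c
    using that unfolding singular_chain_def
  proof (induction rule: frag_induction)
    case (diff a b)
    then have "P ((a - B (chain_boundary 1 a)) - (b - B (chain_boundary 1 b)))"
      by (rule assms(7))
    then show ?case by (simp add: chain_boundary_diff B_def frag_extend_diff algebra_simps)
  qed (use zero edge in \<open>auto simp: B_def\<close>)
  have "P (B d)" if "singular_chain 0 (subtopology (top_of_set Y) F) d" for d
    using that unfolding singular_chain_def
  proof (induction rule: frag_induction)
    case (one \<sigma>)
    have v: "?v \<in> standard_simplex 0" by (auto simp: standard_simplex_def)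
    have "singular_simplex 0 (top_of_set F) \<sigma>"
      using one F by (simp add: subtopology_subtopology Int_absorb1)
    then have "\<sigma> ?v \<in> F"
      using v unfolding singular_simplex_top_of_set by blast
    then show ?case
      unfolding B_def using F b by (auto intro!: path)
  next
    case (diff a b)
    then have "P (B a - B b)"
      by (rule assms(7))
    then show ?case by (simp add: B_def frag_extend_diff)
  qed (simp add: B_def zero)
  \<comment> \<open>The boundary of a relative cycle lies in \<open>F\<close>, so \<open>B\<close>
    turns it into paths that end in \<open>F\<close>, and these are admissible as well.\<close>
  then have "P (B (chain_boundary 1 c))" "P (c - B (chain_boundary 1 c))"
    using c chain by (auto simp: singular_relcycle)
  then have "P ((c - B (chain_boundary 1 c)) + B (chain_boundary 1 c))"
    by (intro add)
  then show ?thesis by simp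
qed

lemma frag_extend_frag_of_id: "frag_extend frag_of x = x"
  using frag_expansion[of x] by (simp add: frag_extend_def)

section \<open>Group rings of abelian groups\<close>

abbreviation ring_map :: "('h \<Rightarrow> 'k) \<Rightarrow> ('h \<Rightarrow>\<^sub>0 int) \<Rightarrow> ('k \<Rightarrow>\<^sub>0 int)" where
  "ring_map f \<equiv> frag_extend (\<lambda>h. frag_of (f h))"

lemma frag_of_mult: "frag_of (a::'h::ab_group_add) * frag_of b = frag_of (a + b)"
  by (simp add: mult_single)

lemma comm_ring_hom_ring_map:
  fixes f :: "'h::ab_group_add \<Rightarrow> 'k::ab_group_add"
  assumes "additive f"
  shows "comm_ring_hom (ring_map f)"
proof -
  interpret additive f by (rule assms)
  have single: "ring_map f (frag_of a * y) = ring_map f (frag_of a) * ring_map f y" for a y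
  proof -
    have "Poly_Mapping.keys y \<subseteq> UNIV" by simp
    then show ?thesis
      by (induction y rule: frag_induction)
        (simp_all add: frag_of_mult add frag_extend_diff right_diff_distrib)
  qed
  have "ring_map f (x * y) = ring_map f x * ring_map f y" for x y
  proof -
    have "Poly_Mapping.keys x \<subseteq> UNIV" by simp
    then show ?thesis
      by (induction x rule: frag_induction)
        (simp_all add: single frag_extend_diff left_diff_distrib)
  qed
  moreover have "ring_map f 1 = 1"
    using frag_extend_of[of "\<lambda>h. frag_of (f h)" 0] by (simp add: zero)
  ultimately show ?thesis
    by unfold_locales (simp_all add: frag_extend_add)
qed

lemma ring_map_ring_map: "ring_map f (ring_map g x) = ring_map (\<lambda>h. f (g h)) x"
proof -
  have "Poly_Mapping.keys x \<subseteq> UNIV" by simp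
  then show ?thesis
    by (induction x rule: frag_induction) (simp_all add: frag_extend_diff)
qed

text \<open>Over a linearly ordered group the group ring is a domain. The embedding \<open>f\<close>
  transfers this to \<open>'h\<close>, which carries no order, and \<open>g\<close> recovers the
  factor from its image.\<close>

lemma group_ring_no_zero_divisors:
  fixes x y :: "'h::ab_group_add \<Rightarrow>\<^sub>0 int" and f :: "'h \<Rightarrow> 'k::linordered_ab_group_add"
  assumes f: "additive f" and g: "\<And>h. g (f h) = h" and xy: "x * y = 0"
  shows "x = 0 \<or> y = 0"
proof -
  interpret comm_ring_hom "ring_map f" by (rule comm_ring_hom_ring_map[OF f])
  have "ring_map f x * ring_map f y = 0"
    using xy by (metis hom_mult hom_zero)
  then have "ring_map f x = 0 \<or> ring_map f y = 0" by simp
  moreover have "ring_map g (ring_map f z) = z" for z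
    by (simp add: ring_map_ring_map g frag_extend_frag_of_id)
  ultimately show ?thesis
    by (metis frag_extend_0)
qed

section \<open>The free part of the first homology\<close>

locale free_abelianization = group G for G :: "'g monoid" (structure) +
  fixes \<psi> :: "'g set set \<Rightarrow> 'h::ab_group_add"
  assumes psi: "\<psi> \<in> iso (free_homology G) additive_group"
begin

definition ab :: "'g \<Rightarrow> 'h" where
  "ab g = \<psi> (free_homology_proj G g)"

lemma normal_derived: "derived G (carrier G) \<lhd> G"
  by (rule derived_self_is_normal)

lemma comm_group_first_homology: "comm_group (first_homology G)"
  unfolding first_homology_def by (rule derived_quot_is_comm_group)

lemma normal_torsion: "torsion_elements (first_homology G) \<lhd> first_homology G"
proof -
  interpret A: comm_group "first_homology G" by (rule comm_group_first_homology)
  have "subgroup (torsion_elements (first_homology G)) (first_homology G)"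
  proof
    fix x y assume "x \<in> torsion_elements (first_homology G)" "y \<in> torsion_elements (first_homology G)"
    then obtain k l :: nat where k: "x \<in> carrier (first_homology G)" "k > 0" "x [^]\<^bsub>first_homology G\<^esub> k = \<one>\<^bsub>first_homology G\<^esub>"
      and l: "y \<in> carrier (first_homology G)" "l > 0" "y [^]\<^bsub>first_homology G\<^esub> l = \<one>\<^bsub>first_homology G\<^esub>"
      unfolding torsion_elements_def by blast
    have "x [^]\<^bsub>first_homology G\<^esub> (k * l) = \<one>\<^bsub>first_homology G\<^esub>"
      using k by (metis A.nat_pow_pow A.nat_pow_one)
    moreover have "y [^]\<^bsub>first_homology G\<^esub> (k * l) = \<one>\<^bsub>first_homology G\<^esub>"
      using l by (metis A.nat_pow_pow A.nat_pow_one mult.commute)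
    ultimately have "(x \<otimes>\<^bsub>first_homology G\<^esub> y) [^]\<^bsub>first_homology G\<^esub> (k * l) = \<one>\<^bsub>first_homology G\<^esub>"
      using k(1) l(1) by (simp add: A.nat_pow_distrib)
    then show "x \<otimes>\<^bsub>first_homology G\<^esub> y \<in> torsion_elements (first_homology G)"
      unfolding torsion_elements_def using k(1,2) l(1,2) by (auto intro!: exI[of _ "k * l"])
  next
    fix x assume "x \<in> torsion_elements (first_homology G)"
    then show "inv\<^bsub>first_homology G\<^esub> x \<in> torsion_elements (first_homology G)"
      unfolding torsion_elements_def by (auto simp: A.nat_pow_inv)
  qed (auto simp: torsion_elements_def intro: exI[of _ 1])
  then show ?thesis
    by (simp add: A.normal_iff_subgroup)
qed

lemma free_homology_proj_hom: "free_homology_proj G \<in> hom G (free_homology G)"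
proof -
  have "(\<lambda>g. derived G (carrier G) #> g) \<in> hom G (first_homology G)"
    unfolding first_homology_def by (rule normal.r_coset_hom_Mod[OF normal_derived])
  moreover have "(\<lambda>a. torsion_elements (first_homology G) #>\<^bsub>first_homology G\<^esub> a) \<in> hom (first_homology G) (free_homology G)"
    unfolding free_homology_def by (rule normal.r_coset_hom_Mod[OF normal_torsion])
  ultimately show ?thesis
    by (auto simp: hom_def free_homology_proj_def Pi_iff)
qed

lemma ab_mult:
  assumes "a \<in> carrier G" "b \<in> carrier G"
  shows "ab (a \<otimes> b) = ab a + ab b"
proof -
  have \<psi>: "\<psi> \<in> hom (free_homology G) additive_group" using psi by (simp add: iso_def)
  show ?thesis
    unfolding ab_def hom_mult[OF free_homology_proj_hom assms]
    using hom_mult[OF \<psi> hom_in_carrier[OF free_homology_proj_hom assms(1)] hom_in_carrier[OF free_homology_proj_hom assms(2)]]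
    by (simp add: additive_group_def)
qed

lemma ab_one: "ab \<one> = 0"
  using ab_mult[of \<one> \<one>] by simp

lemma ab_surj: "\<exists>g\<in>carrier G. ab g = h"
proof -
  have "h \<in> \<psi> ` carrier (free_homology G)"
    using psi by (auto simp: iso_def bij_betw_def additive_group_def)
  then obtain c where c: "c \<in> carrier (free_homology G)" "\<psi> c = h" by blast
  then obtain a where a: "a \<in> carrier (first_homology G)" "c = torsion_elements (first_homology G) #>\<^bsub>first_homology G\<^esub> a"
    unfolding free_homology_def carrier_FactGroup by blast
  then obtain g where "g \<in> carrier G" "a = derived G (carrier G) #> g"
    unfolding first_homology_def carrier_FactGroup by blast
  then show ?thesis
    using a c by (auto simp: ab_def free_homology_proj_def)
qed

text \<open>An element killed by \<open>ab\<close> has a positive power in the derived subgroup.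
  There \<open>\<xi>\<close> vanishes because the target is commutative, and the exponent can be
  cancelled because the target is torsion-free.\<close>

lemma ab_factor:
  fixes \<xi> :: "'g \<Rightarrow> 'i \<Rightarrow>\<^sub>0 int"
  assumes \<xi>: "\<And>a b. a \<in> carrier G \<Longrightarrow> b \<in> carrier G \<Longrightarrow> \<xi> (a \<otimes> b) = \<xi> a + \<xi> b"
    and g: "g \<in> carrier G" "ab g = 0"
  shows "\<xi> g = 0"
proof -
  have \<xi>1: "\<xi> \<one> = 0" using \<xi>[of \<one> \<one>] by simp
  have \<xi>inv: "\<xi> (inv a) = - \<xi> a" if "a \<in> carrier G" for a
    using \<xi>[of "inv a" a] that \<xi>1 by (simp add: eq_neg_iff_add_eq_0)
  have derived: "x \<in> carrier G \<and> \<xi> x = 0" if "x \<in> derived G (carrier G)" for x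
    using that unfolding derived_def
  proof (induction rule: generate.induct)
    case (incl h)
    then show ?case by (auto simp: \<xi> \<xi>inv)
  next
    case (inv h)
    then show ?case by (auto simp: \<xi> \<xi>inv)
  qed (auto simp: \<xi> \<xi>1)
  have pow: "\<xi> (g [^] k) = frag_cmul (int k) (\<xi> g)" for k :: nat
    using g(1) by (induction k) (simp_all add: \<xi> \<xi>1 frag_cmul_distrib)
  let ?A = "first_homology G" and ?D = "derived G (carrier G)"
  interpret A: comm_group ?A by (rule comm_group_first_homology)
  have a: "?D #> g \<in> carrier ?A"
    using g(1) by (auto simp: first_homology_def carrier_FactGroup)
  have fg: "free_homology_proj G g \<in> carrier (free_homology G)"
    using hom_in_carrier[OF free_homology_proj_hom g(1)] .
  have f1: "free_homology_proj G \<one> \<in> carrier (free_homology G)"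
    using hom_in_carrier[OF free_homology_proj_hom one_closed] .
  have inj: "inj_on \<psi> (carrier (free_homology G))"
    using psi by (auto simp: iso_def bij_betw_def)
  have "\<psi> (free_homology_proj G g) = \<psi> (free_homology_proj G \<one>)"
    using g(2) ab_one unfolding ab_def by simp
  then have "free_homology_proj G g = free_homology_proj G \<one>"
    using inj_onD[OF inj _ fg f1] by blast
  then have "torsion_elements ?A #>\<^bsub>?A\<^esub> (?D #> g) = torsion_elements ?A #>\<^bsub>?A\<^esub> (?D #> \<one>)"
    unfolding free_homology_proj_def .
  also have "?D #> \<one> = \<one>\<^bsub>?A\<^esub>"
    using normal_imp_subgroup[OF normal_derived] by (simp add: first_homology_def coset_mult_one subgroup.subset)
  also have "torsion_elements ?A #>\<^bsub>?A\<^esub> \<one>\<^bsub>?A\<^esub> = torsion_elements ?A"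
    using A.coset_mult_one subgroup.subset[OF normal_imp_subgroup[OF normal_torsion]] by blast
  finally have "?D #> g \<in> torsion_elements ?A"
    using A.coset_join1[OF _ a normal_imp_subgroup[OF normal_torsion]] by blast
  then obtain k :: nat where k: "k > 0" "(?D #> g) [^]\<^bsub>?A\<^esub> k = \<one>\<^bsub>?A\<^esub>"
    unfolding torsion_elements_def by blast
  have "?D #> (g [^] k) = ?D"
    using k(2) normal.FactGroup_pow[OF normal_derived g(1), of k] by (simp add: first_homology_def)
  then have "g [^] k \<in> ?D"
    using coset_join1[OF _ nat_pow_closed[OF g(1)] normal_imp_subgroup[OF normal_derived]] by blast
  then have "frag_cmul (int k) (\<xi> g) = 0"
    using derived pow by metis
  then show ?thesis using k(1) by simp
qed

lemma ab_factor_additive: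
  fixes \<xi> :: "'g \<Rightarrow> 'i \<Rightarrow>\<^sub>0 int"
  assumes \<xi>: "\<And>a b. a \<in> carrier G \<Longrightarrow> b \<in> carrier G \<Longrightarrow> \<xi> (a \<otimes> b) = \<xi> a + \<xi> b"
  obtains L :: "'h \<Rightarrow> 'i \<Rightarrow>\<^sub>0 int" where "additive L" "\<And>g. g \<in> carrier G \<Longrightarrow> L (ab g) = \<xi> g"
proof -
  have \<xi>1: "\<xi> \<one> = 0" using \<xi>[of \<one> \<one>] by simp
  have eq: "\<xi> a = \<xi> b" if "a \<in> carrier G" "b \<in> carrier G" "ab a = ab b" for a b
  proof -
    have "ab (a \<otimes> inv b) + ab b = ab (a \<otimes> inv b \<otimes> b)"
      using that by (subst ab_mult) auto
    also have "a \<otimes> inv b \<otimes> b = a" using that by (simp add: m_assoc)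
    finally have "ab (a \<otimes> inv b) = 0" using that(3) by simp
    then have "\<xi> (a \<otimes> inv b) = 0" using that by (intro ab_factor[OF \<xi>]) auto
    moreover have "\<xi> (a \<otimes> inv b \<otimes> b) = \<xi> (a \<otimes> inv b) + \<xi> b" using that by (intro \<xi>) auto
    ultimately show ?thesis using that by (simp add: m_assoc)
  qed
  obtain s where s: "\<And>h. s h \<in> carrier G" "\<And>h. ab (s h) = h"
    using ab_surj by metis
  show ?thesis
  proof
    show "\<xi> (s (ab g)) = \<xi> g" if "g \<in> carrier G" for g
      using eq[OF s(1) that] s(2) by blast
    show "additive (\<lambda>h. \<xi> (s h))"
    proof
      fix h k
      have "\<xi> (s (h + k)) = \<xi> (s h \<otimes> s k)"
        by (rule eq) (use s in \<open>auto simp: ab_mult\<close>)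
      then show "\<xi> (s (h + k)) = \<xi> (s h) + \<xi> (s k)" using \<xi> s by simp
    qed
  qed
qed

end

section \<open>Words and right-angled Artin groups\<close>

fun word_sum :: "('s \<Rightarrow> 'k::ab_group_add) \<Rightarrow> 's word \<Rightarrow> 'k" where
  "word_sum \<theta> [] = 0"
| "word_sum \<theta> ((s, b) # w) = (if b then \<theta> s else - \<theta> s) + word_sum \<theta> w"

text \<open>Fox calculus: the extension of \<open>y\<close> from generators to words by the crossed
  product rule. This rule forces the value \<open>- frag_of (- \<theta> s) * y s\<close> on an
  inverse letter.\<close>

fun fox :: "('s \<Rightarrow> 'k::ab_group_add) \<Rightarrow> ('s \<Rightarrow> 'k \<Rightarrow>\<^sub>0 int) \<Rightarrow> 's word \<Rightarrow> 'k \<Rightarrow>\<^sub>0 int" where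
  "fox \<theta> y [] = 0"
| "fox \<theta> y ((s, b) # w) =
    (if b then y s + frag_of (\<theta> s) * fox \<theta> y w else frag_of (- \<theta> s) * (fox \<theta> y w - y s))"

lemma word_sum_append: "word_sum \<theta> (u @ w) = word_sum \<theta> u + word_sum \<theta> w"
  by (induction \<theta> u rule: word_sum.induct) (auto simp: algebra_simps)

lemma frag_of_mult_left: "frag_of (a::'h::ab_group_add) * (frag_of b * x) = frag_of (a + b) * x"
  by (simp add: mult_single mult.assoc[symmetric])

lemma fox_append: "fox \<theta> y (u @ w) = fox \<theta> y u + frag_of (word_sum \<theta> u) * fox \<theta> y w"
proof (induction u)
  case (Cons a u)
  then show ?case
    by (cases a) (simp add: distrib_left right_diff_distrib frag_of_mult_left del: single_one)
qed simp

context
  fixes V :: "'v set" and E :: "'v set set"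
  assumes graph: "simple_graph V E"
begin

definition raag_eq :: "'v word \<Rightarrow> 'v word \<Rightarrow> bool" where
  "raag_eq = word_eq V {([(v, True), (w, True)], [(w, True), (v, True)]) | v w. {v, w} \<in> E}"

definition raag_class :: "'v word \<Rightarrow> 'v word set" where
  "raag_class w = {x. raag_eq w x}"

lemma raag_eq_word_sum: "raag_eq u w \<Longrightarrow> word_sum \<theta> u = word_sum \<theta> w"
  unfolding raag_eq_def
  by (induction rule: word_eq.induct) (auto simp: word_sum_append add.commute)

lemma raag_eq_fox:
  assumes y: "\<And>v w. {v, w} \<in> E \<Longrightarrow> y v + frag_of (\<theta> v) * y w = y w + frag_of (\<theta> w) * y v"
  shows "raag_eq u w \<Longrightarrow> fox \<theta> y u = fox \<theta> y w"
  unfolding raag_eq_def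
proof (induction rule: word_eq.induct)
  case (append u u' w w')
  then show ?case
    using raag_eq_word_sum[of u u' \<theta>] by (simp add: fox_append raag_eq_def)
next
  case (cancel s b)
  then show ?case
    by (cases b) (simp_all add: distrib_left right_diff_distrib frag_of_mult_left)
next
  case (relation u w)
  then show ?case using y by auto
qed auto

lemma graph_edge_in_V: "{v, w} \<in> E \<Longrightarrow> v \<in> V \<and> w \<in> V \<and> v \<noteq> w"
  using graph unfolding simple_graph_def by (metis doubleton_eq_iff)

lemma raag_class_mult:
  assumes "u \<in> lists (V \<times> UNIV)" "w \<in> lists (V \<times> UNIV)"
  shows "raag_class u \<otimes>\<^bsub>raag V E\<^esub> raag_class w = raag_class (u @ w)"
proof -
  have "raag_eq u u" "raag_eq w w"
    unfolding raag_eq_def using assms by (auto intro: word_eq.refl)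
  moreover have "raag_eq (u @ w) x" if "raag_eq u u'" "raag_eq w w'" "raag_eq (u' @ w') x" for u' w' x
    using that unfolding raag_eq_def by (meson word_eq.append word_eq.trans)
  ultimately show ?thesis
    unfolding raag_class_def raag_def presented_group_def raag_eq_def[symmetric] by auto
qed

lemma carrier_raag: "carrier (raag V E) = raag_class ` lists (V \<times> UNIV)"
  by (auto simp: raag_def presented_group_def quotient_def raag_class_def raag_eq_def)

lemma one_raag: "\<one>\<^bsub>raag V E\<^esub> = raag_class []"
  by (simp add: raag_def presented_group_def raag_class_def raag_eq_def)

lemma raag_class_eqI: "raag_eq u w \<Longrightarrow> raag_class u = raag_class w"
  unfolding raag_class_def raag_eq_def by (blast intro: word_eq.trans word_eq.sym)

lemma raag_class_cancel: "s \<in> V \<Longrightarrow> raag_class [(s, b), (s, \<not> b)] = raag_class []"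
  by (rule raag_class_eqI) (simp add: raag_eq_def word_eq.cancel)

lemma raag_class_relation: "{v, w} \<in> E \<Longrightarrow> raag_class [(v, True), (w, True)] = raag_class [(w, True), (v, True)]"
  by (rule raag_class_eqI) (auto simp: raag_eq_def intro!: word_eq.relation)

lemma raag_lift:
  fixes f :: "'v word \<Rightarrow> 'k"
  assumes f: "\<And>u w. raag_eq u w \<Longrightarrow> f u = f w"
  obtains F where "\<And>w. w \<in> lists (V \<times> UNIV) \<Longrightarrow> F (raag_class w) = f w"
proof
  fix w :: "'v word" assume w: "w \<in> lists (V \<times> UNIV)"
  define w' where "w' = (SOME u. u \<in> raag_class w)"
  have "w \<in> raag_class w"
    unfolding raag_class_def raag_eq_def using w by (auto intro: word_eq.refl)
  then have "w' \<in> raag_class w" unfolding w'_def by (rule someI)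
  then show "f (SOME u. u \<in> raag_class w) = f w"
    using f[of w w'] by (simp add: raag_class_def w'_def)
qed

end

lemma comm_group_additive_group: "comm_group (additive_group :: 'h::ab_group_add monoid)"
  by (rule comm_groupI) (auto simp: additive_group_def algebra_simps intro: exI[of _ "- x" for x])

locale raag_abelianization =
  fixes V :: "'v set" and E :: "'v set set" and \<psi> :: "'v word set set set \<Rightarrow> 'h::ab_group_add"
  assumes finite_V: "finite V" and graph: "simple_graph V E" and group_raag: "group (raag V E)"
    and psi_iso: "\<psi> \<in> iso (free_homology (raag V E)) additive_group"
begin

sublocale free_abelianization "raag V E" \<psi>
  by (simp add: free_abelianization_def free_abelianization_axioms_def group_raag psi_iso)

abbreviation G :: "'v word set monoid" where "G \<equiv> raag V E"

abbreviation cl :: "'v word \<Rightarrow> 'v word set" where "cl \<equiv> raag_class V E"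

definition gen :: "'v \<Rightarrow> 'v word set" where "gen v = cl [(v, True)]"

definition \<theta> :: "'v \<Rightarrow> 'h" where "\<theta> v = ab (gen v)"

lemma cl_closed [simp]: "w \<in> lists (V \<times> UNIV) \<Longrightarrow> cl w \<in> carrier G"
  by (simp add: carrier_raag[OF graph])

lemma gen_closed [simp]: "v \<in> V \<Longrightarrow> gen v \<in> carrier G"
  by (simp add: gen_def)

lemma cl_Cons:
  assumes "s \<in> V" "w \<in> lists (V \<times> UNIV)"
  shows "cl ((s, b) # w) = cl [(s, b)] \<otimes>\<^bsub>G\<^esub> cl w"
  using raag_class_mult[OF graph, of "[(s, b)]" w] assms by simp

lemma cl_inverse:
  assumes "s \<in> V"
  shows "gen s \<otimes>\<^bsub>G\<^esub> cl [(s, False)] = \<one>\<^bsub>G\<^esub>"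
  using raag_class_cancel[OF graph assms, of True] cl_Cons[OF assms, of "[(s, False)]" True] assms
  by (simp add: gen_def one_raag[OF graph])

lemma ab_cl_inverse:
  assumes "s \<in> V"
  shows "ab (cl [(s, False)]) = - \<theta> s"
proof -
  have "\<theta> s + ab (cl [(s, False)]) = 0"
    unfolding \<theta>_def using ab_mult[of "gen s" "cl [(s, False)]"] cl_inverse[OF assms] ab_one assms by simp
  then show ?thesis by (simp add: eq_neg_iff_add_eq_0 add.commute)
qed

lemma ab_cl: "w \<in> lists (V \<times> UNIV) \<Longrightarrow> ab (cl w) = word_sum \<theta> w"
proof (induction w)
  case Nil
  then show ?case using ab_one by (simp add: one_raag[OF graph])
next
  case (Cons a w)
  then obtain s b where a: "a = (s, b)" "s \<in> V" by (cases a) auto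
  have "ab (cl [(s, b)]) = (if b then \<theta> s else - \<theta> s)"
    using ab_cl_inverse[OF a(2)] by (simp add: \<theta>_def gen_def)
  moreover have w: "w \<in> lists (V \<times> UNIV)" "[(s, b)] \<in> lists (V \<times> UNIV)"
    using Cons.prems a(2) by auto
  have "ab (cl (a # w)) = ab (cl [(s, b)]) + ab (cl w)"
    unfolding a(1) cl_Cons[OF a(2) w(1)] by (rule ab_mult[OF cl_closed[OF w(2)] cl_closed[OF w(1)]])
  ultimately show ?case
    using Cons unfolding a(1) by simp
qed

text \<open>Expresses that the \<open>\<theta> v\<close> generate \<open>H\<close>. Closure under
  differences covers sums and negatives at once.\<close>

lemma additive_induct [case_names zero gen diff]:
  assumes zero: "P 0" and gen: "\<And>v. v \<in> V \<Longrightarrow> P (\<theta> v)" and diff: "\<And>a b. P a \<Longrightarrow> P b \<Longrightarrow> P (a - b)"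
  shows "P h"
proof -
  have add: "P (a + b)" if "P a" "P b" for a b
    using diff[OF that(1) diff[OF zero that(2)]] by simp
  have "P (word_sum \<theta> w)" if "w \<in> lists (V \<times> UNIV)" for w
    using that
  proof (induction w)
    case (Cons a w)
    then obtain s b where a: "a = (s, b)" "s \<in> V" by (cases a) auto
    have "P (- \<theta> s)" using diff[OF zero gen[OF a(2)]] by simp
    then have "P ((if b then \<theta> s else - \<theta> s) + word_sum \<theta> w)"
      using Cons a gen by (intro add) auto
    then show ?case using a by simp
  qed (simp add: zero)
  note sum = this
  obtain g where g: "g \<in> carrier G" "ab g = h"
    using ab_surj by blast
  then obtain w where w: "w \<in> lists (V \<times> UNIV)" "g = cl w"
    unfolding carrier_raag[OF graph] by (elim imageE)
  show ?thesis
    using sum[OF w(1)] ab_cl[OF w(1)] g(2) unfolding w(2) by (simp only:)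
qed

text \<open>The exponent sums of a word respect the commutation relations and therefore factor
  through \<open>H\<close>, which makes the \<open>\<theta> v\<close> independent. Vertices are
  numbered because \<open>nat \<Rightarrow>\<^sub>0 int\<close> is linearly ordered, which gives a
  domain later on.\<close>

lemma ex_coordinates:
  obtains idx :: "'v \<Rightarrow> nat" and L :: "'h \<Rightarrow> nat \<Rightarrow>\<^sub>0 int"
  where "inj_on idx V" "additive L" "\<And>v. v \<in> V \<Longrightarrow> L (\<theta> v) = frag_of (idx v)"
proof -
  obtain idx :: "'v \<Rightarrow> nat" where idx: "inj_on idx V"
    using finite_imp_inj_to_nat_seg[OF finite_V] by blast
  let ?e = "word_sum (\<lambda>v. frag_of (idx v))"
  have inv: "?e u = ?e w" if "raag_eq V E u w" for u w
    by (rule raag_eq_word_sum[OF graph that])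
  obtain F where F: "\<And>w. w \<in> lists (V \<times> UNIV) \<Longrightarrow> F (cl w) = ?e w"
    by (rule raag_lift[where f = ?e, OF graph inv]) (assumption | rule that | blast)+
  have "F (a \<otimes>\<^bsub>G\<^esub> b) = F a + F b" if ab': "a \<in> carrier G" "b \<in> carrier G" for a b
  proof -
    obtain u w where uw: "u \<in> lists (V \<times> UNIV)" "a = cl u" "w \<in> lists (V \<times> UNIV)" "b = cl w"
      using ab' unfolding carrier_raag[OF graph] by (elim imageE)
    have "u @ w \<in> lists (V \<times> UNIV)" using uw by auto
    then show ?thesis
      unfolding uw(2,4) raag_class_mult[OF graph uw(1,3)] F[OF uw(1)] F[OF uw(3)]
      by (simp only: F word_sum_append)
  qed
  then obtain L where L: "additive L" "\<And>g. g \<in> carrier G \<Longrightarrow> L (ab g) = F g"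
    by (rule ab_factor_additive) (assumption | rule that | blast)+
  show thesis
  proof
    show "L (\<theta> v) = frag_of (idx v)" if "v \<in> V" for v
      using L(2)[of "gen v"] F[of "[(v, True)]"] that by (simp add: \<theta>_def gen_def)
  qed fact+
qed

text \<open>Additive maps on \<open>H\<close> may be prescribed on the \<open>\<theta> v\<close>:
  pass to coordinates and use the universal property of the free abelian group there.\<close>

lemma ex_additive_extension:
  fixes f :: "'v \<Rightarrow> 'h"
  obtains L :: "'h \<Rightarrow> nat \<Rightarrow>\<^sub>0 int" and \<beta> where "additive L" "additive \<beta>" "\<And>v. v \<in> V \<Longrightarrow> \<beta> (L (\<theta> v)) = f v"
proof -
  obtain idx and L :: "'h \<Rightarrow> nat \<Rightarrow>\<^sub>0 int" where L: "inj_on idx V" "additive L" "\<And>v. v \<in> V \<Longrightarrow> L (\<theta> v) = frag_of (idx v)"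
    by (rule ex_coordinates) (rule that)
  interpret A: comm_group "additive_group :: 'h monoid" by (rule comm_group_additive_group)
  have "(\<lambda>n. f (inv_into V idx n)) ` UNIV \<subseteq> carrier additive_group"
    by (simp add: additive_group_def)
  then obtain \<beta> where \<beta>: "\<beta> \<in> hom (free_Abelian_group UNIV) (additive_group :: 'h monoid)"
    "\<And>n. \<beta> (frag_of n) = f (inv_into V idx n)"
    by (rule A.free_Abelian_group_universal) auto
  have "\<beta> (x + y) = \<beta> x + \<beta> y" for x y
    using hom_mult[OF \<beta>(1), of x y] by (simp add: free_Abelian_group_def additive_group_def)
  then have "additive \<beta>"
    by unfold_locales
  moreover have "\<beta> (L (\<theta> v)) = f v" if "v \<in> V" for v
    using that L by (simp add: \<beta>(2))
  ultimately show thesis using L(2) by (intro that)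
qed

lemma ex_left_inverse:
  obtains L :: "'h \<Rightarrow> nat \<Rightarrow>\<^sub>0 int" and \<beta> where "additive L" "\<And>h. \<beta> (L h) = h"
proof -
  obtain L :: "'h \<Rightarrow> nat \<Rightarrow>\<^sub>0 int" and \<beta> where L: "additive L" "additive \<beta>" "\<And>v. v \<in> V \<Longrightarrow> \<beta> (L (\<theta> v)) = \<theta> v"
    by (rule ex_additive_extension) (rule that)
  interpret L: additive L by (rule L)
  interpret \<beta>: additive \<beta> by (rule L)
  have "\<beta> (L h) = h" for h
    by (induction h rule: additive_induct) (simp_all add: L(3) L.zero \<beta>.zero L.diff \<beta>.diff)
  then show thesis using L that by blast
qed

lemma no_zero_divisors:
  fixes x y :: "'h \<Rightarrow>\<^sub>0 int"
  assumes "x * y = 0"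
  shows "x = 0 \<or> y = 0"
proof -
  obtain L :: "'h \<Rightarrow> nat \<Rightarrow>\<^sub>0 int" and \<beta> where L: "additive L" "\<And>h. \<beta> (L h) = h"
    by (rule ex_left_inverse) (rule that)
  show ?thesis
    by (rule group_ring_no_zero_divisors[OF L assms])
qed

lemma \<theta>_nonzero: "v \<in> V \<Longrightarrow> \<theta> v \<noteq> 0"
proof
  assume v: "v \<in> V" "\<theta> v = 0"
  obtain idx and L :: "'h \<Rightarrow> nat \<Rightarrow>\<^sub>0 int" where L: "inj_on idx V" "additive L" "\<And>v. v \<in> V \<Longrightarrow> L (\<theta> v) = frag_of (idx v)"
    by (rule ex_coordinates) (rule that)
  interpret L: additive L by (rule L)
  show False using L(3)[OF v(1)] v(2) L.zero by simp
qed

section \<open>Specialisations of the group ring\<close>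

definition t :: "'v \<Rightarrow> 'h \<Rightarrow>\<^sub>0 int" where "t v = frag_of (\<theta> v)"

lemma t_minus_1_nonzero: "v \<in> V \<Longrightarrow> t v - 1 \<noteq> 0"
proof
  assume v: "v \<in> V" "t v - 1 = 0"
  then have "frag_of (\<theta> v) = frag_of 0" by (simp add: t_def)
  then show False using \<theta>_nonzero[OF v(1)] unfolding frag_of_eq by blast
qed

text \<open>\<open>kill A\<close> induces the specialisation \<open>t v = 1\<close>, \<open>v \<in> A\<close>, of the group ring.\<close>

definition kill :: "'v set \<Rightarrow> 'h \<Rightarrow> 'h" where
  "kill A = (SOME l. additive l \<and> (\<forall>v\<in>V. l (\<theta> v) = (if v \<in> A then 0 else \<theta> v)))"

lemma kill: "additive (kill A)" "v \<in> V \<Longrightarrow> kill A (\<theta> v) = (if v \<in> A then 0 else \<theta> v)"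
proof -
  obtain L :: "'h \<Rightarrow> nat \<Rightarrow>\<^sub>0 int" and \<beta>
    where L: "additive L" "additive \<beta>" "\<And>v. v \<in> V \<Longrightarrow> \<beta> (L (\<theta> v)) = (if v \<in> A then 0 else \<theta> v)"
    by (rule ex_additive_extension) (rule that)
  then have "additive (\<lambda>h. \<beta> (L h))"
    by (simp add: additive_def)
  with L(3) have "\<exists>l. additive l \<and> (\<forall>v\<in>V. l (\<theta> v) = (if v \<in> A then 0 else \<theta> v))"
    by (intro exI[of _ "\<lambda>h. \<beta> (L h)"]) blast
  from someI_ex[OF this] have "additive (kill A) \<and> (\<forall>v\<in>V. kill A (\<theta> v) = (if v \<in> A then 0 else \<theta> v))"
    unfolding kill_def .
  then show "additive (kill A)" "v \<in> V \<Longrightarrow> kill A (\<theta> v) = (if v \<in> A then 0 else \<theta> v)" by auto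
qed

lemma kill_empty: "kill {} h = h"
proof -
  interpret additive "kill {}" by (rule kill)
  show ?thesis
    by (induction h rule: additive_induct) (simp_all add: zero diff kill)
qed

abbreviation specialise :: "'v set \<Rightarrow> ('h \<Rightarrow>\<^sub>0 int) \<Rightarrow> ('h \<Rightarrow>\<^sub>0 int)" where
  "specialise A \<equiv> ring_map (kill A)"

lemma comm_ring_hom_specialise: "comm_ring_hom (specialise A)"
  by (rule comm_ring_hom_ring_map[OF kill(1)])

lemma specialise_t: "v \<in> V \<Longrightarrow> specialise A (t v) = (if v \<in> A then 1 else t v)"
  by (simp add: t_def kill)

lemma specialise_t_minus_1: "v \<in> V \<Longrightarrow> specialise A (t v - 1) = (if v \<in> A then 0 else t v - 1)"
proof -
  interpret comm_ring_hom "specialise A" by (rule comm_ring_hom_specialise)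
  show "v \<in> V \<Longrightarrow> ?thesis" by (simp add: hom_minus specialise_t)
qed

lemma specialise_empty: "specialise {} x = x"
  by (simp add: kill_empty frag_extend_frag_of_id)

text \<open>Modulo \<open>t v - 1\<close> every group element \<open>h\<close> is congruent to
  \<open>kill {v} h\<close>, so every \<open>x\<close> is congruent to its specialisation.
  Divisibility thus becomes a vanishing condition for a homomorphism into a domain.\<close>

lemma t_minus_1_dvd_iff:
  assumes v: "v \<in> V"
  shows "t v - 1 dvd x \<longleftrightarrow> specialise {v} x = 0"
proof
  interpret comm_ring_hom "specialise {v}" by (rule comm_ring_hom_specialise)
  show "specialise {v} x = 0" if "t v - 1 dvd x"
    using that specialise_t_minus_1[OF v, of "{v}"] by (auto simp: hom_mult)
  interpret kill: additive "kill {v}" by (rule kill)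
  have base: "t v - 1 dvd frag_of h - frag_of (kill {v} h)" for h
  proof (induction h rule: additive_induct)
    case (gen w)
    then show ?case by (auto simp: kill t_def)
  next
    case (diff a b)
    define a' b' where "a' = kill {v} a" and "b' = kill {v} b"
    \<comment> \<open>Telescoping through the intermediate element \<open>a' - b\<close>.\<close>
    have "frag_of (a - b) - frag_of (a' - b') =
        frag_of (- b) * (frag_of a - frag_of a') - frag_of (a' - b - b') * (frag_of b - frag_of b')"
      by (simp add: right_diff_distrib frag_of_mult algebra_simps)
    moreover have "t v - 1 dvd frag_of a - frag_of a'" "t v - 1 dvd frag_of b - frag_of b'"
      using diff by (simp_all add: a'_def b'_def)
    ultimately have "t v - 1 dvd frag_of (a - b) - frag_of (a' - b')"
      by (simp only: dvd_diff dvd_mult)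
    moreover have "kill {v} (a - b) = a' - b'"
      unfolding a'_def b'_def by (rule kill.diff)
    ultimately show ?case by simp
  qed (simp add: kill.zero)
  have "t v - 1 dvd y - specialise {v} y" for y
  proof -
    have "Poly_Mapping.keys y \<subseteq> UNIV" by simp
    then show ?thesis
    proof (induction y rule: frag_induction)
      case (diff a b)
      then have "t v - 1 dvd (a - specialise {v} a) - (b - specialise {v} b)" by (rule dvd_diff)
      then show ?case by (simp add: frag_extend_diff algebra_simps)
    qed (simp_all add: base)
  qed
  from this[of x] show "t v - 1 dvd x" if "specialise {v} x = 0"
    using that by simp
qed

text \<open>The hypothesis on \<open>y\<close> is the equality of the Fox derivatives of
  \<open>vw\<close> and \<open>wv\<close>, so the Fox derivative descends from words to the
  group.\<close>

lemma ex_crossed_hom: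
  fixes y :: "'v \<Rightarrow> 'h \<Rightarrow>\<^sub>0 int"
  assumes l: "additive l"
    and y: "\<And>v w. {v, w} \<in> E \<Longrightarrow> (frag_of (l (\<theta> w)) - 1) * y v = (frag_of (l (\<theta> v)) - 1) * y w"
  obtains \<delta> where "\<And>a b. a \<in> carrier G \<Longrightarrow> b \<in> carrier G \<Longrightarrow>
      \<delta> (a \<otimes>\<^bsub>G\<^esub> b) = \<delta> a + frag_of (l (ab a)) * \<delta> b"
    "\<And>v. v \<in> V \<Longrightarrow> \<delta> (gen v) = y v"
proof -
  interpret l: additive l by (rule l)
  let ?f = "fox (\<lambda>v. l (\<theta> v)) y"
  have y': "y v + frag_of (l (\<theta> v)) * y w = y w + frag_of (l (\<theta> w)) * y v" if "{v, w} \<in> E" for v w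
    using y[OF that] by (simp add: algebra_simps)
  have inv: "?f u = ?f w" if "raag_eq V E u w" for u w
    by (rule raag_eq_fox[OF graph y' that])
  obtain F where F: "\<And>w. w \<in> lists (V \<times> UNIV) \<Longrightarrow> F (cl w) = ?f w"
    by (rule raag_lift[where f = ?f, OF graph inv]) (assumption | rule that | blast)+
  have sum: "word_sum (\<lambda>v. l (\<theta> v)) w = l (word_sum \<theta> w)" for w
    by (induction \<theta> w rule: word_sum.induct) (simp_all add: l.zero l.add l.minus)
  show thesis
  proof
    show "F (a \<otimes>\<^bsub>G\<^esub> b) = F a + frag_of (l (ab a)) * F b"
      if ab': "a \<in> carrier G" "b \<in> carrier G" for a b
    proof -
      obtain u w where uw: "u \<in> lists (V \<times> UNIV)" "a = cl u" "w \<in> lists (V \<times> UNIV)" "b = cl w"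
        using ab' unfolding carrier_raag[OF graph] by (elim imageE)
      have "u @ w \<in> lists (V \<times> UNIV)" using uw by auto
      then show ?thesis
        unfolding uw(2,4) raag_class_mult[OF graph uw(1,3)] F[OF uw(1)] F[OF uw(3)] ab_cl[OF uw(1)]
        by (simp only: F fox_append sum)
    qed
    show "F (gen v) = y v" if "v \<in> V" for v
      using F[of "[(v, True)]"] that by (simp add: gen_def)
  qed
qed

end

section \<open>The Alexander module of a cover\<close>

lemma path_class_eqI: "homotopic_paths S p q \<Longrightarrow> path_class S p = path_class S q"
  unfolding path_class_def by (blast intro: homotopic_paths_trans homotopic_paths_sym)

lemma path_class_eqD:
  assumes "path_class S p = path_class S q" "path q" "path_image q \<subseteq> S"
  shows "homotopic_paths S p q"
proof -
  have "q \<in> path_class S q" using assms by (simp add: path_class_def)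
  then show ?thesis using assms(1) by (metis mem_Collect_eq path_class_def)
qed

lemma path_class_mult:
  assumes "\<alpha> \<in> loops_at S x" "\<beta> \<in> loops_at S x"
  shows "path_class S \<alpha> \<otimes>\<^bsub>fundamental_group S x\<^esub> path_class S \<beta> = path_class S (\<alpha> +++ \<beta>)"
proof -
  have ab: "homotopic_paths S \<alpha> \<alpha>" "homotopic_paths S \<beta> \<beta>" "pathfinish \<alpha> = pathstart \<beta>"
    using assms by (auto simp: loops_at_def)
  have "homotopic_paths S (\<alpha> +++ \<beta>) \<delta>"
    if "homotopic_paths S \<alpha> a" "homotopic_paths S \<beta> b" "homotopic_paths S (a +++ b) \<delta>" for a b \<delta>
    using homotopic_paths_trans[OF homotopic_paths_join[OF that(1,2) ab(3)] that(3)] .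
  then have "(\<exists>a b. homotopic_paths S \<alpha> a \<and> homotopic_paths S \<beta> b \<and> homotopic_paths S (a +++ b) \<delta>) \<longleftrightarrow>
      homotopic_paths S (\<alpha> +++ \<beta>) \<delta>" for \<delta>
    using ab(1,2) by blast
  then show ?thesis
    unfolding fundamental_group_def path_class_def by (simp add: Bex_def)
qed

context alexander_cover
begin

interpretation A: free_abelianization G \<psi>
  by (simp add: free_abelianization_def free_abelianization_axioms_def group psi)

abbreviation F :: "'b set" where "F \<equiv> fibre X' p x0"

text \<open>These are the lifts at \<open>x0'\<close> of loops at \<open>x0\<close>;
  \<open>elt\<close> below is the group element represented by the projected loop.\<close>

definition lift_path :: "(real \<Rightarrow> 'b) \<Rightarrow> bool" where
  "lift_path \<gamma> \<longleftrightarrow> path \<gamma> \<and> path_image \<gamma> \<subseteq> X' \<and> pathstart \<gamma> = x0' \<and> pathfinish \<gamma> \<in> F"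

definition elt :: "(real \<Rightarrow> 'b) \<Rightarrow> 'g" where
  "elt \<gamma> = \<phi> (path_class X (p \<circ> \<gamma>))"

lemma cont_p: "continuous_on X' p"
  by (rule covering_space_imp_continuous[OF covering])

lemma p_image: "p ` X' = X"
  by (rule covering_space_imp_surjective[OF covering])

lemma x0'_in_F: "x0' \<in> F"
  using base_point by (simp add: fibre_def)

lemma F_subset: "F \<subseteq> X'"
  by (auto simp: fibre_def)

lemma proj_path:
  assumes "path \<gamma>" "path_image \<gamma> \<subseteq> X'"
  shows "path (p \<circ> \<gamma>)" "path_image (p \<circ> \<gamma>) \<subseteq> X"
  using assms cont_p p_image
  by (auto simp: path_image_compose intro: path_continuous_image continuous_on_subset)

lemma proj_loop: "lift_path \<gamma> \<Longrightarrow> p \<circ> \<gamma> \<in> loops_at X x0"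
  unfolding loops_at_def lift_path_def using proj_path[of \<gamma>] base_point
  by (auto simp: pathstart_compose pathfinish_compose fibre_def)

lemma phi_hom: "\<phi> \<in> hom (fundamental_group X x0) G"
  using phi by (simp add: iso_def)

lemma class_in_carrier: "\<alpha> \<in> loops_at X x0 \<Longrightarrow> path_class X \<alpha> \<in> carrier (fundamental_group X x0)"
  by (simp add: fundamental_group_def)

lemma elt_closed: "lift_path \<gamma> \<Longrightarrow> elt \<gamma> \<in> carrier G"
  unfolding elt_def by (rule hom_in_carrier[OF phi_hom class_in_carrier[OF proj_loop]])

lemma class_join:
  assumes "\<alpha> \<in> loops_at X x0" "\<beta> \<in> loops_at X x0"
  shows "\<phi> (path_class X (\<alpha> +++ \<beta>)) = \<phi> (path_class X \<alpha>) \<otimes>\<^bsub>G\<^esub> \<phi> (path_class X \<beta>)"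
  unfolding path_class_mult[OF assms, symmetric]
  by (rule hom_mult[OF phi_hom class_in_carrier[OF assms(1)] class_in_carrier[OF assms(2)]])

lemma elt_homotopic:
  assumes "homotopic_paths X' \<gamma> \<delta>"
  shows "elt \<gamma> = elt \<delta>"
  unfolding elt_def
  by (rule arg_cong[where f = \<phi>], rule path_class_eqI, rule homotopic_paths_continuous_image[OF assms cont_p])
    (use p_image in auto)

lemma elt_join:
  assumes l: "lift_path l" "pathfinish l = x0'" and \<gamma>: "lift_path \<gamma>"
  shows "lift_path (l +++ \<gamma>)" "elt (l +++ \<gamma>) = elt l \<otimes>\<^bsub>G\<^esub> elt \<gamma>"
proof -
  show "lift_path (l +++ \<gamma>)"
    using l \<gamma> by (auto simp: lift_path_def path_image_join)
  show "elt (l +++ \<gamma>) = elt l \<otimes>\<^bsub>G\<^esub> elt \<gamma>"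
    unfolding elt_def path_compose_join by (rule class_join[OF proj_loop[OF l(1)] proj_loop[OF \<gamma>]])
qed

lemma ab_elt_loop:
  assumes "lift_path l" "pathfinish l = x0'"
  shows "A.ab (elt l) = 0"
proof -
  have "l \<in> loops_at X' x0'" using assms by (simp add: lift_path_def loops_at_def)
  then have "path_class X (p \<circ> l) \<in> {c \<in> carrier (fundamental_group X x0). projection_to_H G \<psi> \<phi> c = 0}"
    unfolding cover_kernel[symmetric] by blast
  then show ?thesis by (simp add: projection_to_H_def A.ab_def elt_def)
qed

lemma ex_lift_path:
  assumes "g \<in> carrier G"
  obtains \<gamma> where "lift_path \<gamma>" "elt \<gamma> = g"
proof -
  have "g \<in> \<phi> ` carrier (fundamental_group X x0)"
    using phi assms by (auto simp: iso_def bij_betw_def)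
  then obtain \<alpha> where \<alpha>: "\<alpha> \<in> loops_at X x0" "g = \<phi> (path_class X \<alpha>)"
    by (auto simp: fundamental_group_def)
  have a: "path \<alpha>" "path_image \<alpha> \<subseteq> X" "p x0' = pathstart \<alpha>" "pathfinish \<alpha> = x0"
    using \<alpha>(1) base_point by (auto simp: loops_at_def)
  obtain \<gamma> where \<gamma>: "path \<gamma>" "path_image \<gamma> \<subseteq> X'" "pathstart \<gamma> = x0'" "\<And>t. t \<in> {0..1} \<Longrightarrow> p (\<gamma> t) = \<alpha> t"
    by (rule covering_path_lift[OF covering a(1,2) base_point(1) a(3)]) (rule that)
  have "lift_path \<gamma>"
    using \<gamma> a(4) pathfinish_in_path_image[of \<gamma>] by (auto simp: lift_path_def fibre_def pathfinish_def)
  moreover have "homotopic_paths X \<alpha> (p \<circ> \<gamma>)"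
    by (rule homotopic_paths_eq[OF a(1,2)]) (use \<gamma>(4) in auto)
  then have "elt \<gamma> = g"
    unfolding elt_def \<alpha>(2) by (simp add: path_class_eqI)
  ultimately show thesis by (rule that)
qed

text \<open>Injectivity of \<open>\<phi>\<close> makes the projected loops homotopic, and the
  homotopy lifts. Hence \<open>D\<close> below does not depend on the chosen lift.\<close>

lemma homotopic_lift_paths:
  assumes \<gamma>: "lift_path \<gamma>" and \<delta>: "lift_path \<delta>" and eq: "elt \<gamma> = elt \<delta>"
  shows "homotopic_paths X' \<gamma> \<delta>"
proof (rule covering_homotopic_lifts[OF covering])
  have "inj_on \<phi> (carrier (fundamental_group X x0))"
    using phi by (auto simp: iso_def bij_betw_def)
  from inj_onD[OF this eq[unfolded elt_def] class_in_carrier[OF proj_loop[OF \<gamma>]] class_in_carrier[OF proj_loop[OF \<delta>]]]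
  show "homotopic_paths X (p \<circ> \<gamma>) (p \<circ> \<delta>)"
    by (rule path_class_eqD) (use proj_path \<delta> in \<open>auto simp: lift_path_def\<close>)
qed (use \<gamma> \<delta> in \<open>auto simp: lift_path_def\<close>)

section \<open>The action of \<open>H\<close> by deck transformations\<close>

lemma cont_\<tau>: "continuous_on X' (\<tau> h)" and \<tau>_image: "\<tau> h ` X' = X'"
proof -
  obtain g where "homeomorphism X' X' (\<tau> h) g" using deck_homeomorphism[of h] by blast
  then show "continuous_on X' (\<tau> h)" "\<tau> h ` X' = X'" by (auto simp: homeomorphism_def)
qed

lemma \<tau>_mem: "y \<in> X' \<Longrightarrow> \<tau> h y \<in> X'"
  using \<tau>_image by blast

lemma \<tau>_F: "y \<in> F \<Longrightarrow> \<tau> h y \<in> F"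
  using \<tau>_image deck_over_base by (auto simp: fibre_def)

lemma \<tau>_lift_path:
  assumes "lift_path \<gamma>"
  shows "\<tau> (A.ab (elt \<gamma>)) x0' = pathfinish \<gamma>"
  using deck_lift[of \<gamma>] assms by (simp add: lift_path_def fibre_def projection_to_H_def A.ab_def elt_def)

lemma translate_path:
  assumes "path \<gamma>" "path_image \<gamma> \<subseteq> X'"
  shows "path (\<tau> h \<circ> \<gamma>)" "path_image (\<tau> h \<circ> \<gamma>) \<subseteq> X'"
  using assms cont_\<tau> \<tau>_mem
  by (auto simp: path_image_compose intro: path_continuous_image continuous_on_subset)

text \<open>\<open>\<tau> h\<close> moves \<open>x0'\<close> to the end of \<open>\<gamma>\<close>,
  so the translate of \<open>\<delta>\<close> starts there, and it projects to the same loop as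
  \<open>\<delta>\<close>. This is the source of the twist in \<open>D_mult\<close>.\<close>

lemma lift_path_translate_join:
  assumes \<gamma>: "lift_path \<gamma>" and \<delta>: "lift_path \<delta>" and h: "h = A.ab (elt \<gamma>)"
  shows "lift_path (\<gamma> +++ (\<tau> h \<circ> \<delta>))" "elt (\<gamma> +++ (\<tau> h \<circ> \<delta>)) = elt \<gamma> \<otimes>\<^bsub>G\<^esub> elt \<delta>"
proof -
  have 1: "path \<delta>" "path_image \<delta> \<subseteq> X'" "pathfinish \<delta> \<in> F" using \<delta> by (auto simp: lift_path_def)
  have 2: "pathstart (\<tau> h \<circ> \<delta>) = pathfinish \<gamma>" "pathfinish (\<tau> h \<circ> \<delta>) \<in> F"
    using \<tau>_lift_path[OF \<gamma>] \<delta> \<tau>_F by (auto simp: pathstart_compose pathfinish_compose lift_path_def h)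
  show "lift_path (\<gamma> +++ (\<tau> h \<circ> \<delta>))"
    using \<gamma> 2 translate_path[OF 1(1,2)] by (auto simp: lift_path_def path_image_join)
  have p\<tau>: "p (\<tau> h (\<delta> s)) = p (\<delta> s)" if "s \<in> {0..1}" for s
  proof -
    have "\<delta> s \<in> X'" using 1(2) that by (auto simp: path_image_def)
    then show ?thesis by (rule deck_over_base)
  qed
  have hom: "homotopic_paths X (p \<circ> \<delta>) (p \<circ> (\<tau> h \<circ> \<delta>))"
    by (rule homotopic_paths_eq[OF proj_path[OF 1(1,2)]]) (use p\<tau> in auto)
  then have "p \<circ> (\<tau> h \<circ> \<delta>) \<in> loops_at X x0"
    using proj_loop[OF \<delta>] homotopic_paths_imp_path[OF hom] homotopic_paths_imp_subset[OF hom]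
      homotopic_paths_imp_pathstart[OF hom] homotopic_paths_imp_pathfinish[OF hom]
    by (simp add: loops_at_def)
  from class_join[OF proj_loop[OF \<gamma>] this]
  show "elt (\<gamma> +++ (\<tau> h \<circ> \<delta>)) = elt \<gamma> \<otimes>\<^bsub>G\<^esub> elt \<delta>"
    unfolding elt_def path_compose_join path_class_eqI[OF hom] .
qed

lemma \<tau>_agree:
  assumes "\<tau> h (\<tau> k x0') = \<tau> l x0'" "y \<in> X'"
  shows "\<tau> h (\<tau> k y) = \<tau> l y"
proof (rule covering_lifts_agree[OF covering, of X' "\<lambda>y. \<tau> h (\<tau> k y)" "\<tau> l" x0' y])
  show "topological_space_class.connected X'" by (rule path_connected_imp_connected[OF path_connected])
  show "continuous_on X' (\<lambda>y. \<tau> h (\<tau> k y))"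
    by (rule continuous_on_compose2[OF cont_\<tau> cont_\<tau>]) (simp add: \<tau>_image)
  show "(\<lambda>y. \<tau> h (\<tau> k y)) ` X' \<subseteq> X'" using \<tau>_image by blast
  show "p (\<tau> h (\<tau> k y)) = p (\<tau> l y)" if "y \<in> X'" for y
  proof -
    have "\<tau> k y \<in> X'" using \<tau>_image that by blast
    then show ?thesis using deck_over_base that by simp
  qed
qed (use assms base_point cont_\<tau> \<tau>_image in auto)

text \<open>The locale fixes \<open>\<tau> h\<close> at \<open>x0'\<close> only. Both sides lift
  \<open>p\<close> on the connected space \<open>X'\<close>, so comparing their values at
  \<open>x0'\<close> is enough.\<close>

lemma \<tau>_add:
  assumes "y \<in> X'"
  shows "\<tau> (h + k) y = \<tau> h (\<tau> k y)"
proof -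
  obtain g where g: "g \<in> carrier G" "A.ab g = h" using A.ab_surj by blast
  obtain g' where g': "g' \<in> carrier G" "A.ab g' = k" using A.ab_surj by blast
  obtain \<gamma> where \<gamma>: "lift_path \<gamma>" "elt \<gamma> = g" by (rule ex_lift_path[OF g(1)])
  obtain \<delta> where \<delta>: "lift_path \<delta>" "elt \<delta> = g'" by (rule ex_lift_path[OF g'(1)])
  have h: "h = A.ab (elt \<gamma>)" and k: "k = A.ab (elt \<delta>)" using g g' \<gamma> \<delta> by auto
  note join = lift_path_translate_join[OF \<gamma>(1) \<delta>(1) h]
  have "\<tau> (h + k) x0' = pathfinish (\<gamma> +++ (\<tau> h \<circ> \<delta>))"
    using \<tau>_lift_path[OF join(1)]
    by (simp only: join(2) A.ab_mult[OF elt_closed[OF \<gamma>(1)] elt_closed[OF \<delta>(1)]] h[symmetric] k[symmetric])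
  also have "\<dots> = \<tau> h (\<tau> k x0')"
    using \<tau>_lift_path[OF \<delta>(1)] by (simp add: pathfinish_compose flip: k)
  finally show ?thesis using \<tau>_agree[OF _ assms, of h k "h + k"] by simp
qed

lemma \<tau>_0: "y \<in> X' \<Longrightarrow> \<tau> 0 y = y"
proof -
  assume y: "y \<in> X'"
  \<comment> \<open>By \<open>\<tau>_add\<close> the map \<open>\<tau> 0\<close> is idempotent;
    being onto, it is the identity.\<close>
  then obtain z where "z \<in> X'" "y = \<tau> 0 z" using \<tau>_image by blast
  then show ?thesis using \<tau>_add[of z 0 0] by simp
qed

section \<open>Classes of lifts in the Alexander module\<close>

abbreviation M :: "'b chain set monoid" where "M \<equiv> alexander_module X' p x0"

abbreviation hclass :: "'b chain \<Rightarrow> 'b chain set" where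
  "hclass \<equiv> homologous_rel_set 1 (top_of_set X') F"

abbreviation relcycle :: "'b chain \<Rightarrow> bool" where
  "relcycle \<equiv> singular_relcycle 1 (top_of_set X') F"

definition act :: "'h \<Rightarrow> 'b chain set \<Rightarrow> 'b chain set" where
  "act h = hom_induced 1 (top_of_set X') F (top_of_set X') F (\<tau> h)"

lemma M_eq: "M = relative_homology_group (int 1) (top_of_set X') F"
  by (simp add: alexander_module_def)

lemma comm_group_M: "comm_group M"
  by (simp add: alexander_module_def)

lemma carrier_M: "carrier M = hclass ` Collect relcycle"
  unfolding M_eq carrier_relative_homology_group by simp

lemma hclass_add:
  assumes "relcycle a" "relcycle b"
  shows "hclass a \<otimes>\<^bsub>M\<^esub> hclass b = hclass (a + b)"
proof -
  have "r_coset (relcycle_group 1 (top_of_set X') F) (singular_relboundary_set 1 (top_of_set X') F) = hclass"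
    by (rule right_coset_singular_relboundary)
  then show ?thesis
    using normal.rcos_sum[OF normal_subgroup_singular_relboundary_relcycle, of a 1 "top_of_set X'" F b] assms
    unfolding M_eq by (simp add: relative_homology_group_def)
qed

lemma hclass_eqI: "singular_relboundary 1 (top_of_set X') F (a - b) \<Longrightarrow> hclass a = hclass b"
  unfolding homologous_rel_set_eq by (simp only: homologous_rel_def)

lemma act_hclass: "relcycle c \<Longrightarrow> act h (hclass c) = hclass (chain_map 1 (\<tau> h) c)"
  using hom_induced_chain_map[of "top_of_set X'" "top_of_set X'" "\<tau> h" F F 1 c] cont_\<tau>[of h] \<tau>_mem[of _ h] \<tau>_F[of _ h]
  by (simp add: act_def Pi_iff image_subset_iff)

lemma act_hom: "act h \<in> hom M M"
  unfolding act_def alexander_module_def by (rule hom_induced_hom)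

lemma cont_map_\<tau>: "continuous_map (top_of_set X') (top_of_set X') (\<tau> h)"
  using cont_\<tau>[of h] \<tau>_mem[of _ h] by (simp add: Pi_iff image_subset_iff)

lemma act_add: "act (h + k) m = act h (act k m)"
proof -
  have "act (h + k) = hom_induced 1 (top_of_set X') F (top_of_set X') F (\<tau> h \<circ> \<tau> k)"
    unfolding act_def by (rule hom_induced_eq) (simp add: \<tau>_add)
  also have "\<dots> = act h \<circ> act k"
    unfolding act_def by (rule hom_induced_compose[OF cont_map_\<tau> _ cont_map_\<tau>]) (simp_all add: \<tau>_F Pi_iff)
  finally show ?thesis by simp
qed

lemma act_0: "m \<in> carrier M \<Longrightarrow> act 0 m = m"
proof -
  assume m: "m \<in> carrier M"
  have "act 0 = hom_induced 1 (top_of_set X') F (top_of_set X') F id"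
    unfolding act_def by (rule hom_induced_eq) (simp add: \<tau>_0)
  then show "act 0 m = m"
    using m hom_induced_id unfolding alexander_module_def by simp
qed

lemma relcycle_edge:
  assumes "path \<gamma>" "path_image \<gamma> \<subseteq> X'" "pathstart \<gamma> \<in> F" "pathfinish \<gamma> \<in> F"
  shows "relcycle (edge_chain \<gamma>)"
proof -
  have edge: "singular_simplex 1 (top_of_set X') (edge_simplex \<gamma>)"
    by (rule singular_simplex_edge_simplex[OF assms(1,2)])
  have "singular_simplex 0 (subtopology (top_of_set X') F) (singular_face 1 k (edge_simplex \<gamma>))" if "k \<le> 1" for k
  proof -
    have "singular_simplex 0 (top_of_set X') (singular_face 1 k (edge_simplex \<gamma>))"
      using singular_simplex_singular_face[OF edge, of k] that by simp
    moreover have "singular_face 1 k (edge_simplex \<gamma>) x \<in> F" if x: "x \<in> standard_simplex 0" for x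
    proof -
      have "x 0 = 1" using x by (simp add: standard_simplex_def)
      moreover have "simplical_face k x \<in> standard_simplex 1"
        by (rule simplical_face_in_standard_simplex) (use x \<open>k \<le> 1\<close> in auto)
      moreover have "k = 0 \<or> k = 1" using \<open>k \<le> 1\<close> by auto
      ultimately show ?thesis
        using assms(3,4) x
        by (auto simp: singular_face_def edge_simplex_def simplical_face_def pathstart_def pathfinish_def)
    qed
    ultimately show ?thesis by (auto simp: singular_simplex_subtopology)
  qed
  then have "singular_chain 0 (subtopology (top_of_set X') F) (chain_boundary 1 (edge_chain \<gamma>))"
    by (auto simp: chain_boundary_of singular_chain_of intro!: singular_chain_diff)
  then show ?thesis
    using edge by (simp add: singular_relcycle singular_chain_of)
qed

text \<open>The universal crossed homomorphism from \<open>G\<close> to the Alexander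
  module.\<close>

definition D :: "'g \<Rightarrow> 'b chain set" where
  "D g = hclass (edge_chain (SOME \<gamma>. lift_path \<gamma> \<and> elt \<gamma> = g))"

lemma D_elt:
  assumes "lift_path \<gamma>"
  shows "D (elt \<gamma>) = hclass (edge_chain \<gamma>)"
proof -
  let ?\<delta> = "SOME \<delta>. lift_path \<delta> \<and> elt \<delta> = elt \<gamma>"
  have "lift_path ?\<delta> \<and> elt ?\<delta> = elt \<gamma>"
    by (rule someI[of _ \<gamma>]) (use assms in simp)
  then have "homotopic_paths X' ?\<delta> \<gamma>"
    using homotopic_lift_paths assms by blast
  then show ?thesis
    unfolding D_def by (intro hclass_eqI relboundary_homotopic)
qed

lemma relcycle_lift_path: "lift_path \<gamma> \<Longrightarrow> relcycle (edge_chain \<gamma>)"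
  using x0'_in_F by (intro relcycle_edge) (auto simp: lift_path_def)

lemma D_closed: "g \<in> carrier G \<Longrightarrow> D g \<in> carrier M"
proof -
  assume "g \<in> carrier G"
  then obtain \<gamma> where \<gamma>: "lift_path \<gamma>" "elt \<gamma> = g" by (rule ex_lift_path)
  then show "D g \<in> carrier M"
    using D_elt[OF \<gamma>(1)] relcycle_lift_path[OF \<gamma>(1)] unfolding carrier_M by simp
qed

lemma D_mult:
  assumes g: "g \<in> carrier G" "g' \<in> carrier G"
  shows "D (g \<otimes>\<^bsub>G\<^esub> g') = D g \<otimes>\<^bsub>M\<^esub> act (A.ab g) (D g')"
proof -
  obtain \<gamma> where \<gamma>: "lift_path \<gamma>" "elt \<gamma> = g" by (rule ex_lift_path[OF g(1)])
  obtain \<delta> where \<delta>: "lift_path \<delta>" "elt \<delta> = g'" by (rule ex_lift_path[OF g(2)])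
  define h where "h = A.ab (elt \<gamma>)"
  note join = lift_path_translate_join[OF \<gamma>(1) \<delta>(1) h_def]
  have 1: "path \<gamma>" "path_image \<gamma> \<subseteq> X'" "path \<delta>" "path_image \<delta> \<subseteq> X'"
    using \<gamma> \<delta> by (auto simp: lift_path_def)
  have 2: "pathstart (\<tau> h \<circ> \<delta>) = pathfinish \<gamma>" "pathfinish (\<tau> h \<circ> \<delta>) \<in> F" "pathfinish \<gamma> \<in> F"
    using \<tau>_lift_path[OF \<gamma>(1)] \<delta>(1) \<gamma>(1) \<tau>_F
    by (auto simp: pathstart_compose pathfinish_compose lift_path_def h_def)
  have t: "relcycle (edge_chain (\<tau> h \<circ> \<delta>))"
    by (rule relcycle_edge[OF translate_path[OF 1(3,4)]]) (use 2 in auto)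
  have "simplex_map 1 (\<tau> h) (edge_simplex \<delta>) = edge_simplex (\<tau> h \<circ> \<delta>)"
    by (auto simp: simplex_map_def edge_simplex_def restrict_def fun_eq_iff)
  then have act: "act h (D g') = hclass (edge_chain (\<tau> h \<circ> \<delta>))"
    using act_hclass[OF relcycle_lift_path[OF \<delta>(1)], of h] D_elt[OF \<delta>(1)] \<delta>(2) by simp
  have "D g \<otimes>\<^bsub>M\<^esub> act h (D g') = hclass (edge_chain \<gamma> + edge_chain (\<tau> h \<circ> \<delta>))"
    unfolding act \<gamma>(2)[symmetric] D_elt[OF \<gamma>(1)] by (rule hclass_add[OF relcycle_lift_path[OF \<gamma>(1)] t])
  also have "\<dots> = hclass (edge_chain (\<gamma> +++ (\<tau> h \<circ> \<delta>)))"
    by (intro hclass_eqI relboundary_join) (use 1 2 translate_path in auto)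
  also have "\<dots> = D (g \<otimes>\<^bsub>G\<^esub> g')"
    using D_elt[OF join(1)] unfolding join(2) \<gamma>(2) \<delta>(2) by simp
  finally show ?thesis by (simp add: h_def \<gamma>(2))
qed

lemma M_generated:
  assumes N: "subgroup N M" and D: "\<And>g. g \<in> carrier G \<Longrightarrow> D g \<in> N"
  shows "carrier M \<subseteq> N"
proof -
  interpret M: comm_group M by (rule comm_group_M)
  \<comment> \<open>The cycle condition is carried through the induction because
    \<open>hclass_add\<close> is available for relative cycles only.\<close>
  have "relcycle c \<and> hclass c \<in> N" if "relcycle c" for c
    using that
  proof (rule relcycle_induct_paths[OF _ path_connected base_point(1) x0'_in_F F_subset])
    fix \<gamma> assume "path \<gamma>" "path_image \<gamma> \<subseteq> X'" "pathstart \<gamma> = x0'" "pathfinish \<gamma> \<in> F"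
    then have \<gamma>: "lift_path \<gamma>" by (simp add: lift_path_def)
    then show "relcycle (edge_chain \<gamma>) \<and> hclass (edge_chain \<gamma>) \<in> N"
      using relcycle_lift_path[OF \<gamma>] D[OF elt_closed[OF \<gamma>]] by (simp add: D_elt)
  next
    fix a b assume a: "relcycle a \<and> hclass a \<in> N" and b: "relcycle b \<and> hclass b \<in> N"
    have ab: "relcycle (a - b)" using a b by (simp add: singular_relcycle_diff)
    have "hclass (a - b) \<otimes>\<^bsub>M\<^esub> hclass b = hclass a"
      using hclass_add[OF ab] b by simp
    moreover have "hclass (a - b) \<in> carrier M" "hclass b \<in> carrier M"
      using ab b by (auto simp: carrier_M)
    ultimately have "hclass (a - b) = hclass a \<otimes>\<^bsub>M\<^esub> inv\<^bsub>M\<^esub> hclass b"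
      by (metis M.inv_solve_right M.m_closed)
    then show "relcycle (a - b) \<and> hclass (a - b) \<in> N"
      using ab a b N by (simp add: subgroup.m_closed subgroup.m_inv_closed)
  next
    fix a assume a: "singular_relboundary 1 (top_of_set X') F a"
    then have "relcycle a" by (rule singular_relboundary_imp_relcycle)
    moreover have "hclass a = \<one>\<^bsub>M\<^esub>"
      unfolding M_eq one_relative_homology_group using a by (simp add: homologous_rel_set_eq_relboundary)
    ultimately show "relcycle a \<and> hclass a \<in> N"
      using subgroup.one_closed[OF N] by simp
  qed
  then show ?thesis by (auto simp: carrier_M)
qed

text \<open>The value at a simplex \<open>\<sigma>\<close> of the cocycle inducing a given crossed homomorphism \<open>\<delta>\<close> is the change of
  \<open>\<delta>\<close> along \<open>\<sigma>\<close>, when all paths from \<open>x0'\<close> are closed up to lifts of loops by fixed paths to \<open>x0'\<close> that are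
  constant over the base point.\<close>

lemma ex_functional:
  fixes \<delta> :: "'g \<Rightarrow> 'h \<Rightarrow>\<^sub>0 int"
  assumes \<delta>: "\<And>a b. a \<in> carrier G \<Longrightarrow> b \<in> carrier G \<Longrightarrow> \<delta> (a \<otimes>\<^bsub>G\<^esub> b) = \<delta> a + u (A.ab a) * \<delta> b"
    and u0: "u 0 = 1"
  obtains f :: "'b chain set \<Rightarrow> 'h \<Rightarrow>\<^sub>0 int"
  where "\<And>a b. a \<in> carrier M \<Longrightarrow> b \<in> carrier M \<Longrightarrow> f (a \<otimes>\<^bsub>M\<^esub> b) = f a + f b"
    "\<And>g. g \<in> carrier G \<Longrightarrow> f (D g) = \<delta> g"
proof -
  have ex: "\<exists>\<gamma>. path \<gamma> \<and> path_image \<gamma> \<subseteq> X' \<and> pathstart \<gamma> = x \<and> pathfinish \<gamma> = y" if "x \<in> X'" "y \<in> X'" for x y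
    using path_connected that unfolding path_connected_def by blast
  have "\<forall>x. \<exists>\<gamma>. x \<in> X' \<longrightarrow> path \<gamma> \<and> path_image \<gamma> \<subseteq> X' \<and> pathstart \<gamma> = x0' \<and> pathfinish \<gamma> = x"
    using ex base_point(1) by blast
  then obtain b where b: "\<And>x. x \<in> X' \<Longrightarrow> path (b x)" "\<And>x. x \<in> X' \<Longrightarrow> path_image (b x) \<subseteq> X'"
    "\<And>x. x \<in> X' \<Longrightarrow> pathstart (b x) = x0'" "\<And>x. x \<in> X' \<Longrightarrow> pathfinish (b x) = x"
    by metis
  \<comment> \<open>Closing paths are constant over the base point so that a lift of a loop is left
    unchanged up to homotopy, which gives exactly \<open>\<delta> g\<close> on
    \<open>D g\<close>.\<close>
  have "\<forall>x. \<exists>\<gamma>. x \<in> X' \<longrightarrow> path \<gamma> \<and> path_image \<gamma> \<subseteq> X' \<and> pathstart \<gamma> = x \<and> pathfinish \<gamma> \<in> F \<and>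
      (x \<in> F \<longrightarrow> \<gamma> = (\<lambda>_. x))"
  proof
    fix x
    show "\<exists>\<gamma>. x \<in> X' \<longrightarrow> path \<gamma> \<and> path_image \<gamma> \<subseteq> X' \<and> pathstart \<gamma> = x \<and> pathfinish \<gamma> \<in> F \<and> (x \<in> F \<longrightarrow> \<gamma> = (\<lambda>_. x))"
    proof (cases "x \<in> F")
      case True
      then show ?thesis by (intro exI[of _ "\<lambda>_. x"]) auto
    next
      case False
      then show ?thesis using ex[of x x0'] base_point(1) x0'_in_F by metis
    qed
  qed
  from choice[OF this] obtain c where c': "\<forall>x. x \<in> X' \<longrightarrow> path (c x) \<and> path_image (c x) \<subseteq> X' \<and>
      pathstart (c x) = x \<and> pathfinish (c x) \<in> F \<and> (x \<in> F \<longrightarrow> c x = (\<lambda>_. x))"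
    by blast
  have c: "path (c x)" "path_image (c x) \<subseteq> X'" "pathstart (c x) = x" "pathfinish (c x) \<in> F" if "x \<in> X'" for x
    using c' that by blast+
  have c_F: "c x = (\<lambda>_. x)" if "x \<in> F" for x
    using c' F_subset that by blast
  define from_base where "from_base \<gamma> \<longleftrightarrow> path \<gamma> \<and> path_image \<gamma> \<subseteq> X' \<and> pathstart \<gamma> = x0'" for \<gamma>
  define W where "W \<gamma> = \<delta> (elt (\<gamma> +++ c (pathfinish \<gamma>)))" for \<gamma>
  have end_X': "pathfinish \<gamma> \<in> X'" if "from_base \<gamma>" for \<gamma>
    using that pathfinish_in_path_image[of \<gamma>] by (auto simp: from_base_def)
  have close: "lift_path (\<gamma> +++ c (pathfinish \<gamma>))" if "from_base \<gamma>" for \<gamma>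
    using that end_X'[OF that] c by (auto simp: from_base_def lift_path_def path_image_join)
  have W_hom: "W \<gamma> = W \<gamma>'" if hom: "homotopic_paths X' \<gamma> \<gamma>'" and "from_base \<gamma>" for \<gamma> \<gamma>'
  proof -
    have fin: "pathfinish \<gamma> = pathfinish \<gamma>'" by (rule homotopic_paths_imp_pathfinish[OF hom])
    have "homotopic_paths X' (\<gamma> +++ c (pathfinish \<gamma>)) (\<gamma>' +++ c (pathfinish \<gamma>))"
      by (rule homotopic_paths_join[OF hom]) (use c end_X'[OF that(2)] in auto)
    then show ?thesis unfolding W_def fin by (simp add: elt_homotopic)
  qed
  have W_loop: "W (l +++ \<gamma>) = \<delta> (elt l) + W \<gamma>"
    if l: "lift_path l" "pathfinish l = x0'" and \<gamma>: "from_base \<gamma>" for l \<gamma>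
  proof -
    have "homotopic_paths X' (l +++ (\<gamma> +++ c (pathfinish \<gamma>))) ((l +++ \<gamma>) +++ c (pathfinish \<gamma>))"
      by (rule homotopic_paths_assoc) (use l \<gamma> c end_X'[OF \<gamma>] in \<open>auto simp: lift_path_def from_base_def\<close>)
    then have "W (l +++ \<gamma>) = \<delta> (elt (l +++ (\<gamma> +++ c (pathfinish \<gamma>))))"
      unfolding W_def by (simp add: elt_homotopic)
    also have "\<dots> = \<delta> (elt l) + u (A.ab (elt l)) * W \<gamma>"
      unfolding elt_join(2)[OF l close[OF \<gamma>]] W_def by (rule \<delta>[OF elt_closed[OF l(1)] elt_closed[OF close[OF \<gamma>]]])
    \<comment> \<open>The twist disappears because a closed lift represents an element of the kernel
      of \<open>ab\<close>.\<close>
    finally show ?thesis using ab_elt_loop[OF l] u0 by simp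
  qed
  \<comment> \<open>The change of \<open>W\<close> along \<open>\<sigma>\<close> is independent of
    the approach: two approaches differ by a closed lift \<open>l\<close>, which adds
    \<open>\<delta> (elt l)\<close> to both values.\<close>
  have W_diff: "W (\<alpha> +++ \<sigma>) - W \<alpha> = W (\<beta> +++ \<sigma>) - W \<beta>"
    if ab: "from_base \<alpha>" "from_base \<beta>" "pathfinish \<alpha> = pathstart \<sigma>" "pathfinish \<beta> = pathstart \<sigma>"
      and \<sigma>: "path \<sigma>" "path_image \<sigma> \<subseteq> X'" for \<alpha> \<beta> \<sigma>
  proof -
    define l where "l = \<alpha> +++ reversepath \<beta>"
    have l: "lift_path l" "pathfinish l = x0'"
      using ab x0'_in_F by (auto simp: l_def lift_path_def from_base_def path_image_join)
    have hom: "homotopic_paths X' (l +++ \<beta>) \<alpha>"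
      unfolding l_def by (rule homotopic_paths_join_reverse_join) (use ab in \<open>auto simp: from_base_def\<close>)
    have base: "from_base (l +++ \<beta>)" "from_base (\<beta> +++ \<sigma>)" "from_base ((l +++ \<beta>) +++ \<sigma>)" "from_base (l +++ (\<beta> +++ \<sigma>))"
      using l ab \<sigma> by (auto simp: from_base_def lift_path_def path_image_join)
    have "W \<alpha> = \<delta> (elt l) + W \<beta>"
      using W_hom[OF hom base(1)] W_loop[OF l ab(2)] by simp
    moreover have "homotopic_paths X' ((l +++ \<beta>) +++ \<sigma>) (\<alpha> +++ \<sigma>)"
      by (rule homotopic_paths_join[OF hom]) (use \<sigma> ab in auto)
    from W_hom[OF this base(3)] have "W ((l +++ \<beta>) +++ \<sigma>) = W (\<alpha> +++ \<sigma>)" .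
    moreover have "homotopic_paths X' (l +++ (\<beta> +++ \<sigma>)) ((l +++ \<beta>) +++ \<sigma>)"
      by (rule homotopic_paths_assoc) (use l ab \<sigma> in \<open>auto simp: lift_path_def from_base_def\<close>)
    from W_hom[OF this base(4)] have "W (l +++ (\<beta> +++ \<sigma>)) = W ((l +++ \<beta>) +++ \<sigma>)" .
    moreover have "W (l +++ (\<beta> +++ \<sigma>)) = \<delta> (elt l) + W (\<beta> +++ \<sigma>)"
      by (rule W_loop[OF l base(2)])
    ultimately have "W (\<alpha> +++ \<sigma>) = \<delta> (elt l) + W (\<beta> +++ \<sigma>)" "W \<alpha> = \<delta> (elt l) + W \<beta>"
      by simp_all
    then show ?thesis by simp
  qed
  define \<kappa> where "\<kappa> \<sigma> = W (b (pathstart (simplex_path \<sigma>)) +++ simplex_path \<sigma>) - W (b (pathstart (simplex_path \<sigma>)))" for \<sigma>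
  have b_base: "from_base (b x)" if "x \<in> X'" for x
    using b that by (simp add: from_base_def)
  have \<kappa>_face: "\<kappa> (singular_face 2 0 s) - \<kappa> (singular_face 2 1 s) + \<kappa> (singular_face 2 2 s) = 0"
    if s: "singular_simplex 2 (top_of_set X') s" for s
  proof -
    have face: "singular_simplex 1 (top_of_set X') (singular_face 2 k s)" if "k \<le> 2" for k
      using singular_simplex_singular_face[OF s, of k] that by simp
    define e01 e12 e02 where "e01 = simplex_path (singular_face 2 2 s)" and "e12 = simplex_path (singular_face 2 0 s)"
      and "e02 = simplex_path (singular_face 2 1 s)"
    have e: "path e01" "path_image e01 \<subseteq> X'" "path e12" "path_image e12 \<subseteq> X'" "path e02" "path_image e02 \<subseteq> X'"
      unfolding e01_def e12_def e02_def by (simp_all add: path_simplex_path[OF face])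
    have hom: "homotopic_paths X' (e01 +++ e12) e02"
      unfolding e01_def e12_def e02_def by (rule simplex_path_face_join(1)[OF s])
    have j: "pathfinish e01 = pathstart e12"
      unfolding e01_def e12_def by (rule simplex_path_face_join(2)[OF s])
    have start: "pathstart e02 = pathstart e01"
      using homotopic_paths_imp_pathstart[OF hom] by simp
    have in_X': "pathstart e01 \<in> X'" "pathstart e12 \<in> X'"
      using e(2,4) by auto
    define b0 b1 where "b0 = b (pathstart e01)" and "b1 = b (pathstart e12)"
    have b01: "from_base b0" "from_base b1" "pathfinish b0 = pathstart e01" "pathfinish b1 = pathstart e12"
      unfolding b0_def b1_def using b_base in_X' b by auto
    have base: "from_base (b0 +++ e01)" "from_base (b0 +++ (e01 +++ e12))" "from_base ((b0 +++ e01) +++ e12)"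
      using b01 e j by (auto simp: from_base_def path_image_join)
    \<comment> \<open>The chosen approach to the start of \<open>e12\<close> is replaced by
      \<open>b0 +++ e01\<close>; then the contributions of the three edges telescope.\<close>
    have "W (b1 +++ e12) - W b1 = W ((b0 +++ e01) +++ e12) - W (b0 +++ e01)"
      by (rule W_diff) (use b01 base e j in auto)
    moreover have "homotopic_paths X' (b0 +++ (e01 +++ e12)) ((b0 +++ e01) +++ e12)"
      by (rule homotopic_paths_assoc) (use b01 e j in \<open>auto simp: from_base_def\<close>)
    from W_hom[OF this base(2)] have "W (b0 +++ (e01 +++ e12)) = W ((b0 +++ e01) +++ e12)" .
    moreover have "homotopic_paths X' (b0 +++ (e01 +++ e12)) (b0 +++ e02)"
      by (rule homotopic_paths_join[OF _ hom]) (use b01 in \<open>auto simp: from_base_def\<close>)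
    from W_hom[OF this base(2)] have "W (b0 +++ (e01 +++ e12)) = W (b0 +++ e02)" .
    ultimately show ?thesis
      unfolding \<kappa>_def e01_def[symmetric] e12_def[symmetric] e02_def[symmetric] start b0_def[symmetric] b1_def[symmetric]
      by simp
  qed
  have \<kappa>_F: "\<kappa> \<sigma> = 0" if \<sigma>: "singular_simplex 1 (subtopology (top_of_set X') F) \<sigma>" for \<sigma>
  proof -
    have "singular_simplex 1 (top_of_set F) \<sigma>"
      using \<sigma> F_subset by (simp add: subtopology_subtopology Int_absorb1)
    then have s: "path (simplex_path \<sigma>)" "path_image (simplex_path \<sigma>) \<subseteq> F"
      using path_simplex_path by blast+
    define x where "x = pathstart (simplex_path \<sigma>)"
    have x: "x \<in> F" using s(2) by (auto simp: x_def)
    have sF: "simplex_path \<sigma> t \<in> F" if "t \<in> {0..1}" for t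
      using s(2) that by (auto simp: path_image_def)
    \<comment> \<open>The fibre is discrete in effect: a path in it and the constant path at
      \<open>x\<close> both lift the constant path at \<open>x0\<close>.\<close>
    have const: "simplex_path \<sigma> t = x" if "t \<in> {0..1}" for t
      by (rule covering_lifts_agree[OF covering, of "{0..1::real}" "simplex_path \<sigma>" "\<lambda>_. x" 0 t])
        (use s sF x F_subset that in \<open>auto simp: path_def x_def pathstart_def fibre_def\<close>)
    have bx: "path (b x)" "path_image (b x) \<subseteq> X'" "pathfinish (b x) = x"
      using b x F_subset by blast+
    have "homotopic_paths X' (simplex_path \<sigma>) (\<lambda>_. x)"
      by (rule homotopic_paths_eq[OF s(1)]) (use s(2) F_subset const in auto)
    then have "homotopic_paths X' (b x +++ simplex_path \<sigma>) (b x +++ (\<lambda>_. x))"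
      by (intro homotopic_paths_join) (use bx x_def in auto)
    also have "homotopic_paths X' \<dots> (b x)"
      using homotopic_paths_join_const[OF bx(1,2)] bx(3) by simp
    finally have "W (b x +++ simplex_path \<sigma>) = W (b x)"
      by (rule homotopic_paths_sym[THEN W_hom, symmetric]) (use b_base x F_subset in blast)
    then show ?thesis by (simp add: \<kappa>_def x_def[symmetric])
  qed
  have \<kappa>_boundary: "frag_extend \<kappa> a = 0" if a: "singular_relboundary 1 (top_of_set X') F a" for a
  proof -
    obtain d e where de: "singular_chain (Suc 1) (top_of_set X') d" "singular_chain 1 (subtopology (top_of_set X') F) e"
      "chain_boundary (Suc 1) d + e = a"
      using a unfolding singular_relboundary by blast
    have "Poly_Mapping.keys d \<subseteq> Collect (singular_simplex 2 (top_of_set X'))"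
      using de(1) unfolding singular_chain_def by (simp add: numeral_2_eq_2)
    then have "frag_extend \<kappa> (chain_boundary 2 d) = 0"
    proof (induction d rule: frag_induction)
      case (one s)
      have "{..2::nat} = {0, 1, 2}" by auto
      then show ?case
        using \<kappa>_face[of s] one by (simp add: chain_boundary_of frag_extend_add frag_extend_diff frag_extend_minus algebra_simps)
    qed (simp_all add: chain_boundary_diff frag_extend_diff)
    moreover have "frag_extend \<kappa> e = 0"
      using de(2) unfolding singular_chain_def
      by (induction e rule: frag_induction) (simp_all add: \<kappa>_F frag_extend_diff)
    ultimately show ?thesis
      using de(3) by (auto simp: frag_extend_add numeral_2_eq_2)
  qed
  define f where "f m = frag_extend \<kappa> (SOME a. relcycle a \<and> m = hclass a)" for m
  have f: "f (hclass a) = frag_extend \<kappa> a" if a: "relcycle a" for a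
  proof -
    define a' where "a' = (SOME a'. relcycle a' \<and> hclass a = hclass a')"
    have "relcycle a' \<and> hclass a = hclass a'"
      unfolding a'_def by (rule someI[of _ a]) (use a in simp)
    then have "homologous_rel 1 (top_of_set X') F a a'"
      unfolding homologous_rel_set_eq by blast
    then have "singular_relboundary 1 (top_of_set X') F (a - a')"
      by (simp only: homologous_rel_def)
    from \<kappa>_boundary[OF this] show ?thesis
      unfolding f_def a'_def[symmetric] by (simp add: frag_extend_diff)
  qed
  show thesis
  proof
    show "f (m \<otimes>\<^bsub>M\<^esub> n) = f m + f n" if "m \<in> carrier M" "n \<in> carrier M" for m n
      using that unfolding carrier_M
      by (auto simp only: hclass_add f singular_relcycle_add frag_extend_add)
    show "f (D g) = \<delta> g" if g_in: "g \<in> carrier G" for g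
    proof -
      obtain \<gamma> where \<gamma>: "lift_path \<gamma>" "elt \<gamma> = g" by (rule ex_lift_path[OF g_in])
      have g: "path \<gamma>" "path_image \<gamma> \<subseteq> X'" "pathstart \<gamma> = x0'" "pathfinish \<gamma> \<in> F"
        using \<gamma>(1) by (auto simp: lift_path_def)
      define \<gamma>' where "\<gamma>' = simplex_path (edge_simplex \<gamma>)"
      have \<gamma>': "\<gamma>' t = \<gamma> t" if "t \<in> {0..1}" for t
        unfolding \<gamma>'_def by (rule simplex_path_edge_simplex[OF that])
      have start: "pathstart \<gamma>' = x0'"
        using \<gamma>'[of 0] g(3) by (simp add: pathstart_def)
      \<comment> \<open>The chosen path from \<open>x0'\<close> to itself may be any closed lift;
        its value \<open>\<delta> (elt b0)\<close> occurs in both terms of \<open>\<kappa>\<close>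
        and cancels.\<close>
      define b0 where "b0 = b x0'"
      have b0: "lift_path b0" "pathfinish b0 = x0'" "from_base b0" "from_base \<gamma>"
        using b[OF base_point(1)] x0'_in_F g by (auto simp: b0_def lift_path_def from_base_def)
      have base: "from_base (b0 +++ \<gamma>)"
        using b0 g by (auto simp: from_base_def path_image_join)
      have "homotopic_paths X' \<gamma> \<gamma>'"
        by (rule homotopic_paths_eq[OF g(1,2)]) (use \<gamma>' in simp)
      then have "homotopic_paths X' (b0 +++ \<gamma>) (b0 +++ \<gamma>')"
        by (intro homotopic_paths_join) (use b0 g in \<open>auto simp: lift_path_def\<close>)
      then have "W (b0 +++ \<gamma>') = W (b0 +++ \<gamma>)"
        using W_hom[OF _ base] by simp
      also have "\<dots> = \<delta> (elt b0) + W \<gamma>"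
        by (rule W_loop[OF b0(1,2,4)])
      also have "W \<gamma> = \<delta> (elt \<gamma>)"
        unfolding W_def c_F[OF g(4)] using elt_homotopic[OF homotopic_paths_join_const[OF g(1,2)]] by simp
      finally have 1: "W (b0 +++ \<gamma>') = \<delta> (elt b0) + \<delta> g" unfolding \<gamma>(2) .
      have "path b0" "path_image b0 \<subseteq> X'" using b0(1) by (auto simp: lift_path_def)
      from elt_homotopic[OF homotopic_paths_join_const[OF this]] have "W b0 = \<delta> (elt b0)"
        unfolding W_def b0(2) c_F[OF x0'_in_F] by simp
      then have "\<kappa> (edge_simplex \<gamma>) = \<delta> g"
        unfolding \<kappa>_def \<gamma>'_def[symmetric] start b0_def[symmetric] 1 by simp
      then show ?thesis
        using f[OF relcycle_lift_path[OF \<gamma>(1)]] D_elt[OF \<gamma>(1)] \<gamma>(2) by simp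
    qed
  qed
qed

end

section \<open>Modules over a group ring\<close>

locale group_with_action = comm_group M for M :: "('m, 'z) monoid_scheme" (structure) +
  fixes act :: "'h::ab_group_add \<Rightarrow> 'm \<Rightarrow> 'm"
  assumes act_hom: "act h \<in> hom M M"
    and act_add: "a \<in> carrier M \<Longrightarrow> act (h + k) a = act h (act k a)"
    and act_0: "a \<in> carrier M \<Longrightarrow> act 0 a = a"
begin

definition smult :: "('h \<Rightarrow>\<^sub>0 int) \<Rightarrow> 'm \<Rightarrow> 'm" where
  "smult r a = (\<Otimes>h\<in>Poly_Mapping.keys r. act h a [^] Poly_Mapping.lookup r h)"

lemma act_closed [simp]: "a \<in> carrier M \<Longrightarrow> act h a \<in> carrier M"
  using hom_in_carrier[OF act_hom] .

lemma act_mult: "a \<in> carrier M \<Longrightarrow> b \<in> carrier M \<Longrightarrow> act h (a \<otimes> b) = act h a \<otimes> act h b"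
  using hom_mult[OF act_hom] .

lemma smult_superset:
  assumes "a \<in> carrier M" "finite S" "Poly_Mapping.keys r \<subseteq> S"
  shows "smult r a = (\<Otimes>h\<in>S. act h a [^] Poly_Mapping.lookup r h)"
  unfolding smult_def
  by (rule finprod_mono_neutral_cong_left) (use assms in \<open>auto simp: in_keys_iff\<close>)

lemma smult_closed [simp]: "a \<in> carrier M \<Longrightarrow> smult r a \<in> carrier M"
  unfolding smult_def by (intro finprod_closed) auto

lemma smult_mult:
  assumes "a \<in> carrier M" "b \<in> carrier M"
  shows "smult r (a \<otimes> b) = smult r a \<otimes> smult r b"
proof -
  have "smult r (a \<otimes> b) =
      (\<Otimes>h\<in>Poly_Mapping.keys r. act h a [^] Poly_Mapping.lookup r h \<otimes> act h b [^] Poly_Mapping.lookup r h)"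
    unfolding smult_def by (rule finprod_cong') (use assms in \<open>auto simp: act_mult int_pow_distrib\<close>)
  also have "\<dots> = smult r a \<otimes> smult r b"
    unfolding smult_def by (rule finprod_multf) (use assms in auto)
  finally show ?thesis .
qed

lemma smult_add:
  assumes "a \<in> carrier M"
  shows "smult (r + s) a = smult r a \<otimes> smult s a"
proof -
  let ?S = "Poly_Mapping.keys r \<union> Poly_Mapping.keys s"
  have "smult (r + s) a = (\<Otimes>h\<in>?S. act h a [^] Poly_Mapping.lookup (r + s) h)"
    by (rule smult_superset) (use assms Poly_Mapping.keys_add[of r s] in auto)
  also have "\<dots> = (\<Otimes>h\<in>?S. act h a [^] Poly_Mapping.lookup r h \<otimes> act h a [^] Poly_Mapping.lookup s h)"
    by (rule finprod_cong') (use assms in \<open>auto simp: lookup_add int_pow_mult\<close>)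
  also have "\<dots> = (\<Otimes>h\<in>?S. act h a [^] Poly_Mapping.lookup r h) \<otimes> (\<Otimes>h\<in>?S. act h a [^] Poly_Mapping.lookup s h)"
    by (rule finprod_multf) (use assms in auto)
  also have "\<dots> = smult r a \<otimes> smult s a"
    using smult_superset[OF assms, of ?S] by simp
  finally show ?thesis .
qed

lemma smult_frag_of: "a \<in> carrier M \<Longrightarrow> smult (frag_of h) a = act h a"
  by (simp add: smult_def finprod_insert)

lemma smult_0: "a \<in> carrier M \<Longrightarrow> smult 0 a = \<one>"
  by (simp add: smult_def)

lemma smult_diff:
  assumes "a \<in> carrier M"
  shows "smult (r - s) a = smult r a \<otimes> inv (smult s a)"
proof -
  have "smult (r - s) a \<otimes> smult s a = smult r a"
    using smult_add[OF assms, of "r - s" s] by simp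
  then show ?thesis
    using assms by (metis inv_solve_right smult_closed)
qed

lemma act_smult:
  assumes a: "a \<in> carrier M"
  shows "smult (frag_of h * s) a = act h (smult s a)"
proof -
  interpret act: group_hom M M "act h"
    by unfold_locales (rule act_hom)
  have "Poly_Mapping.keys s \<subseteq> UNIV" by simp
  then show ?thesis
  proof (induction s rule: frag_induction)
    case (diff r s)
    then show ?case
      using a by (simp add: right_diff_distrib smult_diff act_mult)
  qed (use a in \<open>simp_all add: smult_0 frag_of_mult smult_frag_of act_add del: single_one\<close>)
qed

lemma smult_smult:
  assumes a: "a \<in> carrier M"
  shows "smult (r * s) a = smult r (smult s a)"
proof -
  have "Poly_Mapping.keys r \<subseteq> UNIV" by simp
  then show ?thesis
  proof (induction r rule: frag_induction)
    case (diff r r')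
    then show ?case
      using a by (simp add: left_diff_distrib smult_diff)
  qed (use a in \<open>simp_all add: smult_0 smult_frag_of act_smult del: single_one\<close>)
qed

lemma group_with_scalars_smult: "group_with_scalars M smult"
proof
  show "smult 1 a = a" if "a \<in> carrier M" for a
    using smult_frag_of[OF that, of 0] act_0[OF that] by simp
qed (auto simp: smult_mult smult_add smult_smult intro: comm_group_axioms)

end

section \<open>Components of graphs\<close>

lemma equiv_reachable: "equiv W (reachable W E)"
proof -
  have "sym ({(a, b). {a, b} \<in> E}\<^sup>*)"
    by (rule sym_rtrancl) (auto simp: sym_def insert_commute)
  then show ?thesis
    by (auto simp: equiv_def reachable_def refl_on_def sym_def trans_def)
qed

lemma disconnected_graphD:
  assumes "disconnected_graph W E"
  obtains u w where "u \<in> W" "w \<in> W" "(u, w) \<notin> reachable W E"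
proof (rule ccontr)
  assume "\<not> thesis"
  then have all: "(u, w) \<in> reachable W E" if "u \<in> W" "w \<in> W" for u w
    using that \<open>\<And>w u. u \<in> W \<Longrightarrow> w \<in> W \<Longrightarrow> (u, w) \<notin> reachable W E \<Longrightarrow> thesis\<close> by blast
  have "x = y" if xy: "x \<in> graph_components W E" "y \<in> graph_components W E" for x y
  proof -
    obtain u w where "u \<in> W" "x = reachable W E `` {u}" "w \<in> W" "y = reachable W E `` {w}"
      using xy unfolding graph_components_def by (auto elim!: quotientE)
    then show ?thesis
      using equiv_class_eq[OF equiv_reachable all[of u w]] by simp
  qed
  then have "card (graph_components W E) \<le> 1"
    by (metis card_le_Suc0_iff_eq card.infinite le_zero_eq One_nat_def nat_le_linear not_one_le_zero)
  then show False using assms by (simp add: disconnected_graph_def)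
qed

lemma not_disconnected_graphD:
  assumes "\<not> disconnected_graph W E" "finite W" "u \<in> W" "w \<in> W"
  shows "(u, w) \<in> reachable W E"
proof (rule ccontr)
  assume no: "(u, w) \<notin> reachable W E"
  let ?r = "reachable W E"
  have "?r `` {u} \<in> graph_components W E" "?r `` {w} \<in> graph_components W E"
    using assms(3,4) by (auto simp: graph_components_def quotientI)
  moreover have "?r `` {u} \<noteq> ?r `` {w}"
    using no eq_equiv_class[OF _ equiv_reachable assms(4)] by blast
  \<comment> \<open>An infinite set of components would have \<open>card\<close> 0 and so would not
    count as disconnected.\<close>
  moreover have "finite (graph_components W E)"
    unfolding graph_components_def using assms(2) by (intro finite_quotient) (auto simp: reachable_def)
  ultimately have "card {?r `` {u}, ?r `` {w}} \<le> card (graph_components W E)"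
    by (intro card_mono) auto
  then show False
    using \<open>?r `` {u} \<noteq> ?r `` {w}\<close> assms(1) by (simp add: disconnected_graph_def)
qed

lemma connected_graph_iff_not_disconnected:
  assumes "finite W" "W \<noteq> {}"
  shows "connected_graph W E \<longleftrightarrow> \<not> disconnected_graph W E"
proof -
  have "finite (graph_components W E)"
    unfolding graph_components_def using assms(1) by (intro finite_quotient) (auto simp: reachable_def)
  moreover have "graph_components W E \<noteq> {}"
    using assms(2) by (auto simp: graph_components_def quotient_def)
  ultimately have "card (graph_components W E) > 0" by (simp add: card_gt_0_iff)
  then show ?thesis by (auto simp: connected_graph_def disconnected_graph_def)
qed

lemma induced_edges_simple_graph: "simple_graph V E \<Longrightarrow> induced_edges E V = E"
  by (auto simp: induced_edges_def simple_graph_def)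

section \<open>The module of crossed homomorphisms of a right-angled Artin group\<close>

text \<open>The interface between topology and algebra. \<open>D_universal\<close> provides only
  additive functionals, since linearity follows from the crossed rule. The twist by an endomorphism
  \<open>l\<close> of \<open>'h\<close> keeps specialised coefficients in the same group
  ring.\<close>

locale raag_module = raag_abelianization V E \<psi> + M: group_with_scalars M smul
  for V :: "'v set" and E and \<psi> :: "'v word set set set \<Rightarrow> 'h::ab_group_add"
    and M :: "'m monoid" (structure) and smul :: "('h \<Rightarrow>\<^sub>0 int) \<Rightarrow> 'm \<Rightarrow> 'm" +
  fixes D :: "'v word set \<Rightarrow> 'm"
  assumes D_closed: "g \<in> carrier G \<Longrightarrow> D g \<in> carrier M"
    and D_mult: "g \<in> carrier G \<Longrightarrow> g' \<in> carrier G \<Longrightarrow>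
      D (g \<otimes>\<^bsub>G\<^esub> g') = D g \<otimes> smul (frag_of (ab g)) (D g')"
    and D_generates: "subgroup N M \<Longrightarrow> (\<And>g. g \<in> carrier G \<Longrightarrow> D g \<in> N) \<Longrightarrow> carrier M \<subseteq> N"
    and D_universal: "additive (l :: 'h \<Rightarrow> 'h) \<Longrightarrow>
      (\<And>a b. a \<in> carrier G \<Longrightarrow> b \<in> carrier G \<Longrightarrow>
        \<delta> (a \<otimes>\<^bsub>G\<^esub> b) = \<delta> a + frag_of (l (ab a)) * \<delta> b) \<Longrightarrow>
      \<exists>f :: 'm \<Rightarrow> 'h \<Rightarrow>\<^sub>0 int. (\<forall>a\<in>carrier M. \<forall>b\<in>carrier M. f (a \<otimes> b) = f a + f b) \<and>
        (\<forall>g\<in>carrier G. f (D g) = \<delta> g)"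
begin

definition d :: "'v \<Rightarrow> 'm" where "d v = D (gen v)"

lemma d_closed [simp]: "v \<in> V \<Longrightarrow> d v \<in> carrier M"
  by (simp add: d_def D_closed)

lemma D_one: "D \<one>\<^bsub>G\<^esub> = \<one>"
proof -
  have c: "\<one>\<^bsub>G\<^esub> \<in> carrier G" by simp
  have "D \<one>\<^bsub>G\<^esub> = D \<one>\<^bsub>G\<^esub> \<otimes> smul (frag_of (ab \<one>\<^bsub>G\<^esub>)) (D \<one>\<^bsub>G\<^esub>)"
    using D_mult[OF c c] by simp
  then have "D \<one>\<^bsub>G\<^esub> = D \<one>\<^bsub>G\<^esub> \<otimes> D \<one>\<^bsub>G\<^esub>"
    using D_closed[OF c] by (simp add: ab_one M.smul_1)
  then show ?thesis
    using D_closed[OF c] by (metis M.l_cancel_one')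
qed

lemma M_generated_by_vertices:
  assumes N: "subgroup N M" and smul: "\<And>r m. m \<in> N \<Longrightarrow> smul r m \<in> N" and d: "\<And>v. v \<in> V \<Longrightarrow> d v \<in> N"
  shows "carrier M \<subseteq> N"
proof (rule D_generates[OF N])
  have letter: "D (cl [(s, b)]) \<in> N" if s: "s \<in> V" for s b
  proof (cases b)
    case False
    define x where "x = D (cl [(s, False)])"
    have x: "x \<in> carrier M" unfolding x_def using s by (intro D_closed cl_closed) auto
    \<comment> \<open>Expanding \<open>D\<close> of the trivial word made of \<open>s\<close> and
      its inverse expresses the inverse letter as a multiple of \<open>d s\<close>.\<close>
    have "d s \<otimes> smul (frag_of (\<theta> s)) x = \<one>"
      using D_mult[of "gen s" "cl [(s, False)]"] s cl_inverse[OF s] D_one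
      by (simp add: d_def \<theta>_def x_def)
    then have "smul (frag_of (\<theta> s)) x = inv (d s)"
      using x s by (metis M.comm_inv_char d_closed M.smul_closed)
    then have "smul (frag_of (- \<theta> s)) (inv (d s)) = smul (frag_of (- \<theta> s) * frag_of (\<theta> s)) x"
      using M.smul_smul[OF x] by simp
    also have "\<dots> = x" using M.smul_1[OF x] by (simp add: frag_of_mult)
    finally show ?thesis
      using smul d[OF s] N False unfolding x_def by (metis subgroup.m_inv_closed)
  next
    case True
    then show ?thesis using d[OF s] by (simp add: d_def gen_def)
  qed
  have "D (cl w) \<in> N" if "w \<in> lists (V \<times> UNIV)" for w
    using that
  proof (induction w)
    case Nil
    then show ?case
      using D_one subgroup.one_closed[OF N] by (simp add: one_raag[OF graph])
  next
    case (Cons a w)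
    then obtain s b where a: "a = (s, b)" "s \<in> V" by (cases a) auto
    have w: "w \<in> lists (V \<times> UNIV)" "[(s, b)] \<in> lists (V \<times> UNIV)" using Cons.hyps a(2) by auto
    show ?case
      unfolding a(1) cl_Cons[OF a(2) w(1)] D_mult[OF cl_closed[OF w(2)] cl_closed[OF w(1)]]
      by (rule subgroup.m_closed[OF N letter[OF a(2)] smul[OF Cons.IH]])
  qed
  then show "D g \<in> N" if "g \<in> carrier G" for g
    using that unfolding carrier_raag[OF graph] by blast
qed

text \<open>Both sides come from expanding \<open>D\<close> of the equal elements \<open>vw\<close>
  and \<open>wv\<close> by the crossed rule.\<close>

lemma edge_relation:
  assumes vw: "{v, w} \<in> E"
  shows "smul (t w - 1) (d v) = smul (t v - 1) (d w)"
proof -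
  have V: "v \<in> V" "w \<in> V" using graph_edge_in_V[OF graph vw] by auto
  have "gen v \<otimes>\<^bsub>G\<^esub> gen w = gen w \<otimes>\<^bsub>G\<^esub> gen v"
    using raag_class_relation[OF graph vw] cl_Cons[of v "[(w, True)]" True] cl_Cons[of w "[(v, True)]" True] V
    by (simp add: gen_def)
  then have eq: "d v \<otimes> smul (t v) (d w) = d w \<otimes> smul (t w) (d v)"
    using D_mult[of "gen v" "gen w"] D_mult[of "gen w" "gen v"] V by (simp add: d_def t_def \<theta>_def)
  have minus: "smul (r - 1) m = smul r m \<otimes> inv m" if "m \<in> carrier M" for r m
    using M.smul_add[OF that, of r "- 1"] M.smul_uminus[OF that, of 1] M.smul_1[OF that] by simp
  have 1: "smul (t w) (d v) = inv (d w) \<otimes> (d v \<otimes> smul (t v) (d w))"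
    unfolding eq using V by (simp add: M.inv_solve_left)
  have cancel: "a \<otimes> (inv a \<otimes> b) = b" if "a \<in> carrier M" "b \<in> carrier M" for a b
    using that by (simp add: M.m_assoc[symmetric])
  have "smul (t w) (d v) \<otimes> inv (d v) =
      (d v \<otimes> inv (d v)) \<otimes> (smul (t v) (d w) \<otimes> inv (d w))"
    unfolding 1 using V by (simp add: M.m_ac cancel)
  then show ?thesis
    unfolding minus[OF d_closed[OF V(1)]] minus[OF d_closed[OF V(2)]] using V by simp
qed

text \<open>In effect the edge relations are all the relations: any values on the \<open>d v\<close>
  compatible with them extend to \<open>M\<close>.\<close>

lemma ex_semilinear_functional:
  fixes l :: "'h \<Rightarrow> 'h" and y :: "'v \<Rightarrow> 'h \<Rightarrow>\<^sub>0 int"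
  assumes l: "additive l"
    and y: "\<And>v w. {v, w} \<in> E \<Longrightarrow> (frag_of (l (\<theta> w)) - 1) * y v = (frag_of (l (\<theta> v)) - 1) * y w"
  obtains f where "semilinear_functional M smul (ring_map l) f" "\<And>v. v \<in> V \<Longrightarrow> f (d v) = y v"
proof -
  obtain \<delta> where \<delta>: "\<And>a b. a \<in> carrier G \<Longrightarrow> b \<in> carrier G \<Longrightarrow>
      \<delta> (a \<otimes>\<^bsub>G\<^esub> b) = \<delta> a + frag_of (l (ab a)) * \<delta> b"
    "\<And>v. v \<in> V \<Longrightarrow> \<delta> (gen v) = y v"
    by (rule ex_crossed_hom[OF l y]) (assumption | rule that | blast)+
  obtain f :: "'m \<Rightarrow> 'h \<Rightarrow>\<^sub>0 int" where f: "\<And>a b. a \<in> carrier M \<Longrightarrow> b \<in> carrier M \<Longrightarrow> f (a \<otimes> b) = f a + f b"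
    "\<And>g. g \<in> carrier G \<Longrightarrow> f (D g) = \<delta> g"
    using D_universal[OF l \<delta>(1)] by blast
  have f1: "f \<one> = 0" using f(1)[of "\<one>" "\<one>"] by simp
  have finv: "f (inv a) = - f a" if "a \<in> carrier M" for a
    using f(1)[of "inv a" a] that f1 by (simp add: eq_neg_iff_add_eq_0)
  have smul_inv: "smul r (inv a) = inv (smul r a)" if "a \<in> carrier M" for r a
    using M.smul_mult[of "inv a" a r] that by (metis M.inv_closed M.inv_equality M.l_inv M.smul_closed M.smul_one)
  have basis: "f (smul (frag_of h) m) = frag_of (l h) * f m" if m: "m \<in> carrier M" for h m
  proof -
    obtain g where g: "g \<in> carrier G" "ab g = h" using ab_surj by blast
    let ?N = "{m \<in> carrier M. f (smul (frag_of h) m) = frag_of (l h) * f m}"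
    have "carrier M \<subseteq> ?N"
    proof (rule D_generates)
      show "subgroup ?N M"
        by unfold_locales (auto simp: f M.smul_mult f1 finv smul_inv distrib_left)
      fix g' assume g': "g' \<in> carrier G"
      have "f (D (g \<otimes>\<^bsub>G\<^esub> g')) = \<delta> (g \<otimes>\<^bsub>G\<^esub> g')"
        using f(2) g g' by simp
      then have "\<delta> g + f (smul (frag_of h) (D g')) = \<delta> g + frag_of (l h) * \<delta> g'"
        using g g' by (simp add: D_mult f D_closed \<delta>)
      then show "D g' \<in> ?N" using g' by (simp add: D_closed f)
    qed
    then show ?thesis using m by blast
  qed
  have "f (smul r m) = ring_map l r * f m" if m: "m \<in> carrier M" for r m
  proof -
    have "Poly_Mapping.keys r \<subseteq> UNIV" by simp
    then show ?thesis
    proof (induction r rule: frag_induction)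
      case (diff a b)
      have "smul (a - b) m = smul a m \<otimes> inv (smul b m)"
        using M.smul_add[OF m, of a "- b"] M.smul_uminus[OF m, of b] by simp
      then show ?case
        using diff m by (simp add: f finv frag_extend_diff left_diff_distrib)
    qed (use m in \<open>simp_all add: f1 basis\<close>)
  qed
  then have "semilinear_functional M smul (ring_map l) f"
    using f(1) comm_ring_hom_ring_map[OF l]
    by (simp add: semilinear_functional_def semilinear_functional_axioms_def M.group_with_scalars_axioms)
  then show thesis
    using f(2) \<delta>(2) by (intro that) (auto simp: d_def)
qed

text \<open>Here \<open>K\<close> is a union of components outside \<open>A\<close>. An edge outside
  \<open>A\<close> has both ends in \<open>K\<close> or neither; on an edge meeting
  \<open>A\<close>, the value at the end in \<open>A\<close> is 0 and so is its specialised
  \<open>t - 1\<close>, so both sides vanish.\<close>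

lemma ex_component_functional:
  assumes A: "A \<subseteq> V"
    and K: "\<And>v w. {v, w} \<in> induced_edges E (V - A) \<Longrightarrow> v \<in> K \<longleftrightarrow> w \<in> K"
  obtains f where "semilinear_functional M smul (specialise A) f"
    "\<And>v. v \<in> V \<Longrightarrow> f (d v) = (if v \<in> K - A then t v - 1 else 0)"
proof -
  let ?y = "\<lambda>v. if v \<in> K - A then t v - 1 else 0"
  have "(frag_of (kill A (\<theta> w)) - 1) * ?y v = (frag_of (kill A (\<theta> v)) - 1) * ?y w" if vw: "{v, w} \<in> E" for v w
  proof (cases "v \<in> A \<or> w \<in> A")
    case True
    then show ?thesis using graph_edge_in_V[OF graph vw] by (auto simp: kill)
  next
    case False
    have V: "v \<in> V" "w \<in> V" using graph_edge_in_V[OF graph vw] by auto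
    then have "v \<in> K \<longleftrightarrow> w \<in> K" using K vw False by (auto simp: induced_edges_def)
    then show ?thesis using V False by (simp add: kill t_def mult.commute)
  qed
  then show thesis
    by (rule ex_semilinear_functional[where y = ?y, OF kill(1)]) (assumption | rule that | blast)+
qed

lemma augmentation:
  obtains f where "semilinear_functional M smul (\<lambda>x. x) f" "\<And>v. v \<in> V \<Longrightarrow> f (d v) = t v - 1"
proof -
  obtain f where "semilinear_functional M smul (specialise {}) f" "\<And>v. v \<in> V \<Longrightarrow> f (d v) = (if v \<in> UNIV - {} then t v - 1 else 0)"
    by (rule ex_component_functional[of "{}" UNIV]) (auto intro: that)
  moreover have "specialise {} = (\<lambda>x. x)" by (rule ext) (rule specialise_empty)
  ultimately show thesis using that by simp
qed

lemma specialise_elementary_ideal: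
  assumes \<Phi>: "presents M smul \<Phi>" and A: "A \<subseteq> V"
    and disconnected: "disconnected_graph (V - A) (induced_edges E (V - A))"
    and x: "x \<in> elementary_ideal 1 \<Phi>"
  shows "specialise A x = 0"
proof -
  let ?r = "reachable (V - A) (induced_edges E (V - A))"
  obtain u w where uw: "u \<in> V - A" "w \<in> V - A" "(u, w) \<notin> ?r"
    by (rule disconnected_graphD[OF disconnected])
  \<comment> \<open>\<open>K\<close> and its complement are both unions of components, and their
    functionals are separated by \<open>d u\<close> and \<open>d w\<close>.\<close>
  define K where "K = ?r `` {u}"
  have K: "v \<in> K \<longleftrightarrow> v' \<in> K" if e: "{v, v'} \<in> induced_edges E (V - A)" for v v'
  proof -
    have "(v, v') \<in> ?r" using e by (auto simp: reachable_def induced_edges_def)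
    then show ?thesis
      unfolding K_def using equiv_reachable[of "V - A" "induced_edges E (V - A)"]
      by (meson Image_singleton_iff equivE symE transE)
  qed
  have uK: "u \<in> K" "w \<notin> K"
    using uw(3) equiv_class_self[OF equiv_reachable uw(1)] unfolding K_def by auto
  obtain f1 where f1: "semilinear_functional M smul (specialise A) f1"
    "\<And>v. v \<in> V \<Longrightarrow> f1 (d v) = (if v \<in> K - A then t v - 1 else 0)"
    by (rule ex_component_functional[OF A K]) (assumption | rule that | blast)+
  obtain f2 where f2: "semilinear_functional M smul (specialise A) f2"
    "\<And>v. v \<in> V \<Longrightarrow> f2 (d v) = (if v \<in> - K - A then t v - 1 else 0)"
    by (rule ex_component_functional[OF A, of "- K"]) (use K in \<open>auto intro: that\<close>)
  show ?thesis
  proof (rule elementary_ideal_1_in_kernel[OF f1(1) f2(1) no_zero_divisors _ _ _ _ _ \<Phi> x])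
    show "d u \<in> carrier M" "d w \<in> carrier M" using uw by auto
    show "f1 (d u) \<noteq> 0" "f2 (d u) = 0" "f2 (d w) \<noteq> 0"
      using uw uK f1(2) f2(2) t_minus_1_nonzero by auto
  qed
qed

section \<open>Products of the primes \<open>t a - 1\<close>\<close>

inductive_set products :: "'v set \<Rightarrow> ('h \<Rightarrow>\<^sub>0 int) set" for W where
  products_1: "1 \<in> products W"
| products_step: "a \<in> W \<Longrightarrow> x \<in> products W \<Longrightarrow> (t a - 1) * x \<in> products W"

lemma products_mult: "x \<in> products W \<Longrightarrow> y \<in> products W \<Longrightarrow> x * y \<in> products W"
  by (induction rule: products.induct) (auto simp: mult.assoc intro: products_step)

lemma products_power: "x \<in> products W \<Longrightarrow> x ^ n \<in> products W"
  by (induction n) (auto intro: products_1 products_mult)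

text \<open>With \<open>A = {a}\<close> for a vertex \<open>a\<close> outside \<open>W\<close>, this
  excludes divisibility by \<open>t a - 1\<close>; with \<open>A\<close> empty, it says that the
  product is nonzero.\<close>

lemma specialise_products:
  assumes "x \<in> products W" "W \<subseteq> V" "A \<inter> W = {}"
  shows "specialise A x \<noteq> 0"
  using assms(1)
proof induction
  interpret comm_ring_hom "specialise A" by (rule comm_ring_hom_specialise)
  case (products_step a x)
  have a: "a \<in> V" "a \<notin> A" using products_step.hyps assms by auto
  have "specialise A ((t a - 1) * x) = (t a - 1) * specialise A x"
    unfolding hom_mult specialise_t_minus_1[OF a(1)] using a(2) by simp
  then show ?case
    using no_zero_divisors[of "t a - 1" "specialise A x"] t_minus_1_nonzero[OF a(1)] products_step.IH by auto
next
  interpret comm_ring_hom "specialise A" by (rule comm_ring_hom_specialise)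
  case products_1
  then show ?case by simp
qed

lemma products_nonzero: "x \<in> products W \<Longrightarrow> W \<subseteq> V \<Longrightarrow> x \<noteq> 0"
  using specialise_products[of x W "{}"] by (auto simp: specialise_empty)

lemma t_minus_1_prime:
  assumes "a \<in> V" "t a - 1 dvd x * y"
  shows "t a - 1 dvd x \<or> t a - 1 dvd y"
proof -
  interpret comm_ring_hom "specialise {a}" by (rule comm_ring_hom_specialise)
  show ?thesis
    using assms no_zero_divisors unfolding t_minus_1_dvd_iff[OF assms(1)] hom_mult by blast
qed

text \<open>Takes the place of unique factorisation: a prime factor \<open>t a - 1\<close> divides
  \<open>c\<close> or its cofactor \<open>z\<close>, and in the second case it is cancelled before
  the induction hypothesis is applied.\<close>

lemma dvd_products:
  assumes "x \<in> products W" "W \<subseteq> V" "c dvd x"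
  shows "c dvd 1 \<or> (\<exists>a\<in>W. t a - 1 dvd c)"
  using assms(1,3)
proof induction
  case (products_step a x)
  have a: "a \<in> V" using products_step.hyps assms by auto
  obtain z where z: "(t a - 1) * x = c * z" using products_step.prems by (auto elim: dvdE)
  then have "t a - 1 dvd c * z" by (metis dvd_triv_left)
  then consider "t a - 1 dvd c" | "t a - 1 dvd z" using t_minus_1_prime[OF a] by blast
  then show ?case
  proof cases
    case 2
    then obtain z' where "z = (t a - 1) * z'" by (auto elim: dvdE)
    then have "(t a - 1) * x = (t a - 1) * (c * z')" using z by (simp only: mult.left_commute)
    then have "(t a - 1) * (x - c * z') = 0" by (simp only: right_diff_distrib diff_self)
    then have "x = c * z'" using no_zero_divisors t_minus_1_nonzero[OF a] by (metis eq_iff_diff_eq_0)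
    then show ?thesis using products_step.IH by simp
  qed (use products_step.hyps in blast)
qed simp

text \<open>Each step along the path costs the factor \<open>t w - 1\<close> of the vertex that is
  left, and this vertex lies in \<open>W\<close>.\<close>

lemma reachable_proportional:
  assumes W: "W \<subseteq> V" and r: "(u, w) \<in> reachable W (induced_edges E W)"
  shows "\<exists>N\<in>products W. \<exists>c. smul N (d w) = smul c (d u)"
proof -
  have u: "u \<in> V" using r W by (auto simp: reachable_def)
  have "(u, w) \<in> {(a, b). {a, b} \<in> induced_edges E W}\<^sup>*" using r by (simp add: reachable_def)
  then show ?thesis
  proof (induction rule: rtrancl_induct)
    case base
    show ?case using products_1 by blast
  next
    case (step w z)
    then obtain N c where Nc: "N \<in> products W" "smul N (d w) = smul c (d u)" by blast
    have wz: "w \<in> W" "z \<in> W" "{w, z} \<in> E" using step.hyps(2) by (auto simp: induced_edges_def)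
    have V: "w \<in> V" "z \<in> V" using wz W by auto
    have "smul ((t w - 1) * N) (d z) = smul (N * (t w - 1)) (d z)" by (simp add: mult.commute)
    also have "\<dots> = smul N (smul (t w - 1) (d z))" using V by (simp add: M.smul_smul)
    also have "smul (t w - 1) (d z) = smul (t z - 1) (d w)"
      by (rule edge_relation) (use wz in \<open>simp add: insert_commute\<close>)
    also have "smul N (smul (t z - 1) (d w)) = smul (t z - 1) (smul N (d w))"
      using V by (simp add: M.smul_smul[symmetric] mult.commute)
    also have "\<dots> = smul ((t z - 1) * c) (d u)"
      unfolding Nc(2) using u by (simp add: M.smul_smul)
    finally show ?case using products_step[OF wz(1) Nc(1)] by blast
  qed
qed

text \<open>The multipliers for the finitely many vertices are multiplied together. The elements
  sent into the cyclic submodule form a submodule, so the vertices suffice.\<close>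

lemma ex_common_annihilator:
  assumes u: "u \<in> V" and N: "\<And>z. z \<in> V \<Longrightarrow> \<exists>N\<in>products W. \<exists>c. smul N (d z) = smul c (d u)"
  obtains P where "P \<in> products W" "\<And>m. m \<in> carrier M \<Longrightarrow> \<exists>c. smul P m = smul c (d u)"
proof -
  have "\<exists>P\<in>products W. \<forall>z\<in>U. \<exists>c. smul P (d z) = smul c (d u)" if "finite U" "U \<subseteq> V" for U
    using that
  proof (induction rule: finite_induct)
    case empty
    then show ?case using products_1 by blast
  next
    case (insert x U)
    then obtain P where P: "P \<in> products W" "\<forall>z\<in>U. \<exists>c. smul P (d z) = smul c (d u)" by blast
    obtain N c where N: "N \<in> products W" "smul N (d x) = smul c (d u)"
      using N[of x] insert.prems by blast
    have "\<exists>c. smul (P * N) (d z) = smul c (d u)" if z: "z \<in> insert x U" for z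
    proof (cases "z = x")
      case True
      have "smul (P * N) (d x) = smul (P * c) (d u)"
        using insert.prems u N(2) by (simp add: M.smul_smul)
      then show ?thesis using True by blast
    next
      case False
      then obtain c' where c': "smul P (d z) = smul c' (d u)" using P(2) z by blast
      have "smul (N * P) (d z) = smul (N * c') (d u)"
        using insert.prems z u c' by (auto simp: M.smul_smul)
      then show ?thesis by (metis mult.commute)
    qed
    then show ?case using products_mult[OF P(1) N(1)] by blast
  qed
  from this[OF finite_V] obtain P where P: "P \<in> products W" "\<And>z. z \<in> V \<Longrightarrow> \<exists>c. smul P (d z) = smul c (d u)"
    by blast
  let ?N = "{m \<in> carrier M. \<exists>c. smul P m = smul c (d u)}"
  have du: "d u \<in> carrier M" using u by simp
  have "carrier M \<subseteq> ?N"
  proof (rule M_generated_by_vertices)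
    show "subgroup ?N M"
    proof
      fix x y assume "x \<in> ?N" "y \<in> ?N"
      then obtain a b where "x \<in> carrier M" "y \<in> carrier M" "smul P x = smul a (d u)" "smul P y = smul b (d u)"
        by blast
      then have "smul P (x \<otimes> y) = smul (a + b) (d u)"
        using du by (simp add: M.smul_mult M.smul_add)
      then show "x \<otimes> y \<in> ?N" using \<open>x \<in> carrier M\<close> \<open>y \<in> carrier M\<close> by auto
    next
      have "smul P \<one> = smul 0 (d u)" using du by simp
      then show "\<one> \<in> ?N" by blast
    next
      fix x assume "x \<in> ?N"
      then obtain a where x: "x \<in> carrier M" "smul P x = smul a (d u)" by blast
      have "inv x = smul (- 1) x" using M.smul_uminus[OF x(1), of 1] M.smul_1[OF x(1)] by simp
      then have "smul P (inv x) = smul (- 1 * a) (d u)"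
        using x du by (metis M.smul_smul mult.commute)
      then show "inv x \<in> ?N" using x by auto
    qed auto
    fix r m assume "m \<in> ?N"
    then obtain a where m: "m \<in> carrier M" "smul P m = smul a (d u)" by blast
    have "smul P (smul r m) = smul (r * a) (d u)"
      using m du by (metis M.smul_smul mult.commute)
    then show "smul r m \<in> ?N" using m by auto
  qed (use P(2) in auto)
  then show thesis using P(1) by (intro that) auto
qed

lemma dvd_products_of_connected:
  assumes \<Phi>: "presents M smul \<Phi>" and c: "\<And>x. x \<in> elementary_ideal 1 \<Phi> \<Longrightarrow> c dvd x"
    and u: "u \<in> V" and N: "\<And>z. z \<in> V \<Longrightarrow> \<exists>N\<in>products W. \<exists>c. smul N (d z) = smul c (d u)"
  obtains x where "x \<in> products W" "c dvd x"
proof -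
  obtain P where P: "P \<in> products W" "\<And>m. m \<in> carrier M \<Longrightarrow> \<exists>c. smul P m = smul c (d u)"
    by (rule ex_common_annihilator[OF u N]) (assumption | rule that | blast)+
  obtain f where f: "semilinear_functional M smul (\<lambda>x. x) f" "\<And>v. v \<in> V \<Longrightarrow> f (d v) = t v - 1"
    by (rule augmentation) (assumption | rule that | blast)+
  have "c dvd P ^ dim_row \<Phi>"
  proof (rule dvd_power_of_annihilator[OF f(1) _ P(2) _ \<Phi> c])
    show "d u \<in> carrier M" using u by simp
    show "x = 0" if "x * f (d u) = 0" for x
      using that no_zero_divisors t_minus_1_nonzero[OF u] f(2)[OF u] by metis
  qed
  then show thesis using products_power[OF P(1)] that by blast
qed

theorem alexander_polynomial_nonconstant_iff:
  assumes V: "V \<noteq> {}" and \<Delta>: "is_alexander_polynomial M smul \<Delta>"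
  shows "\<not> constant_up_to_unit \<Delta> \<longleftrightarrow> connectivity_one V E"
proof -
  obtain \<Phi> where \<Phi>: "presents M smul \<Phi>" and gcd: "is_gcd_of \<Delta> (elementary_ideal 1 \<Phi>)"
    using \<Delta> unfolding is_alexander_polynomial_def by blast
  have dvd: "\<Delta> dvd x" if "x \<in> elementary_ideal 1 \<Phi>" for x
    using gcd that by (simp add: is_gcd_of_def)
  have greatest: "c dvd \<Delta>" if "\<And>x. x \<in> elementary_ideal 1 \<Phi> \<Longrightarrow> c dvd x" for c
    using gcd that by (simp add: is_gcd_of_def)
  have EV: "induced_edges E V = E" by (rule induced_edges_simple_graph[OF graph])
  show ?thesis
  proof
    assume "connectivity_one V E"
    then obtain v where conn: "connected_graph V E" and v: "v \<in> V"
      and cut: "disconnected_graph (V - {v}) (induced_edges E (V - {v}))"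
      by (auto simp: connectivity_one_def)
    have reach: "(v, z) \<in> reachable V (induced_edges E V)" if "z \<in> V" for z
      using conn not_disconnected_graphD[OF _ finite_V v that]
      unfolding EV connected_graph_iff_not_disconnected[OF finite_V V] by blast
    \<comment> \<open>Taking all of \<open>V\<close> as \<open>W\<close> needs only the
      connectedness of \<open>\<Gamma>\<close> and shows that \<open>\<Delta>\<close> is
      nonzero.\<close>
    obtain x where x: "x \<in> products V" "\<Delta> dvd x"
      by (rule dvd_products_of_connected[OF \<Phi> dvd v reachable_proportional[OF _ reach]]) (assumption | rule that | blast)+
    have "\<Delta> \<noteq> 0" using x products_nonzero[OF x(1)] by auto
    have "t v - 1 dvd \<Delta>"
      by (rule greatest) (use specialise_elementary_ideal[OF \<Phi> _ cut] v in \<open>simp add: t_minus_1_dvd_iff\<close>)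
    then have s\<Delta>: "specialise {v} \<Delta> = 0" using t_minus_1_dvd_iff[OF v] by blast
    interpret comm_ring_hom "specialise {v}" by (rule comm_ring_hom_specialise)
    show "\<not> constant_up_to_unit \<Delta>"
    proof
      assume "constant_up_to_unit \<Delta>"
      then obtain U :: "'h \<Rightarrow>\<^sub>0 int" and c :: int where U: "U dvd 1" "\<Delta> = U * of_int c"
        by (auto simp: constant_up_to_unit_def)
      \<comment> \<open>A unit stays a unit under specialisation and integers are fixed by it, so
        the vanishing of \<open>\<Delta>\<close> at \<open>t v = 1\<close> makes the constant
        \<open>c\<close> zero.\<close>
      obtain U' where "1 = U * U'" using U(1) by (auto elim: dvdE)
      then have "specialise {v} U * specialise {v} U' = 1"
        by (metis hom_mult hom_one)
      then have "specialise {v} U \<noteq> 0" by auto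
      moreover have "specialise {v} U * of_int c = 0"
        using s\<Delta> U(2) by (simp add: hom_mult hom_of_int)
      ultimately have "(of_int c :: 'h \<Rightarrow>\<^sub>0 int) = 0" using no_zero_divisors by blast
      then show False using U(2) \<open>\<Delta> \<noteq> 0\<close> by simp
    qed
  next
    assume nonconst: "\<not> constant_up_to_unit \<Delta>"
    have \<Delta>0: "\<Delta> \<noteq> 0"
    proof
      assume "\<Delta> = 0"
      then have "\<Delta> = 1 * of_int 0" by simp
      then show False using nonconst unfolding constant_up_to_unit_def by (metis dvd_refl)
    qed
    have conn: "connected_graph V E"
    proof (rule ccontr)
      assume "\<not> connected_graph V E"
      then have "disconnected_graph (V - {}) (induced_edges E (V - {}))"
        using connected_graph_iff_not_disconnected[OF finite_V V] by (simp add: EV)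
      then have "x = 0" if "x \<in> elementary_ideal 1 \<Phi>" for x
        using specialise_elementary_ideal[OF \<Phi> _ _ that, of "{}"] by (simp add: specialise_empty)
      then have "0 dvd \<Delta>" by (intro greatest) auto
      then show False using \<Delta>0 by simp
    qed
    show "connectivity_one V E"
    proof (rule ccontr)
      assume "\<not> connectivity_one V E"
      then have nocut: "\<not> disconnected_graph (V - {v}) (induced_edges E (V - {v}))" if "v \<in> V" for v
        using conn that by (auto simp: connectivity_one_def)
      have ex: "\<exists>x\<in>products (V - {v}). \<Delta> dvd x" if v: "v \<in> V" for v
      proof (cases "V = {v}")
        case True
        \<comment> \<open>With a single vertex the module is cyclic and the empty product
          suffices.\<close>
        have "\<exists>N\<in>products (V - {v}). \<exists>c. smul N (d z) = smul c (d v)" if "z \<in> V" for z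
          using products_1 True that by blast
        from dvd_products_of_connected[OF \<Phi> dvd v this] show ?thesis by blast
      next
        case False
        obtain z where z: "z \<in> V" "z \<noteq> v" using False v by blast
        have "(z, v) \<in> reachable V E"
          using conn not_disconnected_graphD[OF _ finite_V z(1) v]
          unfolding connected_graph_iff_not_disconnected[OF finite_V V] by blast
        then have "(z, v) \<in> {(a, b). {a, b} \<in> E}\<^sup>*" by (simp add: reachable_def)
        \<comment> \<open>The reference vertex is a neighbour of \<open>v\<close>: the edge to
          \<open>v\<close> then costs the factor \<open>t u - 1\<close>, whereas starting at
          \<open>v\<close> would cost the forbidden \<open>t v - 1\<close>.\<close>
        then obtain u where e: "{u, v} \<in> E"
          using z(2) by (auto elim: rtranclE)
        have u: "u \<in> V - {v}" "u \<in> V" using graph_edge_in_V[OF graph e] by auto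
        have "\<exists>N\<in>products (V - {v}). \<exists>c. smul N (d x) = smul c (d u)" if x: "x \<in> V" for x
        proof (cases "x = v")
          case True
          have "(t u - 1) * 1 \<in> products (V - {v})"
            by (intro products_step products_1 u(1))
          moreover have "smul ((t u - 1) * 1) (d v) = smul (t v - 1) (d u)"
            using edge_relation[of v u] e by (simp add: insert_commute)
          ultimately show ?thesis using True by blast
        next
          case False
          then have "x \<in> V - {v}" using x by simp
          from not_disconnected_graphD[OF nocut[OF v] _ u(1) this] finite_V
          have "(u, x) \<in> reachable (V - {v}) (induced_edges E (V - {v}))" by simp
          then show ?thesis by (intro reachable_proportional) auto
        qed
        from dvd_products_of_connected[OF \<Phi> dvd u(2) this] show ?thesis by blast
      qed
      have "\<Delta> dvd 1"
      proof (rule ccontr)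
        assume no: "\<not> \<Delta> dvd 1"
        obtain v where v: "v \<in> V" using V by blast
        \<comment> \<open>The vertex \<open>a\<close> is found from an arbitrary \<open>v\<close>;
          the contradiction comes from applying \<open>ex\<close> once more, to \<open>a\<close>
          itself.\<close>
        obtain a where a: "a \<in> V" "t a - 1 dvd \<Delta>"
          using ex[OF v] dvd_products[of _ "V - {v}" \<Delta>] no by blast
        obtain x where x: "x \<in> products (V - {a})" "\<Delta> dvd x" using ex[OF a(1)] by blast
        have "t a - 1 dvd x" using a(2) x(2) by (rule dvd_trans)
        then have "specialise {a} x = 0" using t_minus_1_dvd_iff[OF a(1)] by blast
        then show False using specialise_products[OF x(1), of "{a}"] by auto
      qed
      moreover have "\<Delta> = \<Delta> * of_int 1" by simp
      ultimately show False
        using nonconst unfolding constant_up_to_unit_def by blast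
    qed
  qed
qed

end

section \<open>The Alexander polynomial\<close>

context alexander_cover
begin

lemma alexander_smult_eq: "alexander_smult X' p x0 \<tau> = group_with_action.smult M act"
proof -
  interpret comm_group M by (rule comm_group_M)
  interpret group_with_action M act
    by unfold_locales (simp_all add: act_hom act_add act_0)
  show ?thesis
    by (intro ext) (simp add: smult_def alexander_smult_def act_def)
qed

end

lemma raag_module_alexander_module:
  fixes \<psi> :: "'v word set set set \<Rightarrow> 'h::ab_group_add"
  assumes "finite V" "simple_graph V E" and cover: "alexander_cover X C (raag V E) \<psi> x0 \<phi> X' x0' p \<tau>"
  shows "raag_module V E \<psi> (alexander_module X' p x0) (alexander_smult X' p x0 \<tau>)
    (alexander_cover.D X x0 \<phi> X' x0' p)"
proof -
  interpret cover: alexander_cover X C "raag V E" \<psi> x0 \<phi> X' x0' p \<tau> by (rule cover)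
  interpret raag_abelianization V E \<psi>
    using assms cover.group cover.psi by (simp add: raag_abelianization_def)
  interpret N: comm_group "alexander_module X' p x0" by (rule cover.comm_group_M)
  interpret N: group_with_action "alexander_module X' p x0" cover.act
    by unfold_locales (simp_all add: cover.act_hom cover.act_add cover.act_0)
  have scalars: "group_with_scalars (cover.M) (alexander_smult X' p x0 \<tau>)"
    unfolding cover.alexander_smult_eq by (rule N.group_with_scalars_smult)
  have "raag_module_axioms V E \<psi> (cover.M) (alexander_smult X' p x0 \<tau>) cover.D"
  proof
    show "cover.D g \<in> carrier (cover.M)" if "g \<in> carrier (raag V E)" for g
      by (rule cover.D_closed[OF that])
    show "cover.D (g \<otimes>\<^bsub>raag V E\<^esub> g') = cover.D g \<otimes>\<^bsub>cover.M\<^esub>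
        alexander_smult X' p x0 \<tau> (frag_of (ab g)) (cover.D g')"
      if "g \<in> carrier (raag V E)" "g' \<in> carrier (raag V E)" for g g'
      unfolding cover.alexander_smult_eq N.smult_frag_of[OF cover.D_closed[OF that(2)]]
      by (rule cover.D_mult[OF that])
    show "carrier (cover.M) \<subseteq> N"
      if "subgroup N (cover.M)" "\<And>g. g \<in> carrier (raag V E) \<Longrightarrow> cover.D g \<in> N" for N
      by (rule cover.M_generated[OF that])
    show "\<exists>f. (\<forall>a\<in>carrier (cover.M). \<forall>b\<in>carrier (cover.M).
          f (a \<otimes>\<^bsub>cover.M\<^esub> b) = f a + f b) \<and> (\<forall>g\<in>carrier (raag V E). f (cover.D g) = \<delta> g)"
      if l: "additive l" and \<delta>: "\<And>a b. a \<in> carrier (raag V E) \<Longrightarrow> b \<in> carrier (raag V E) \<Longrightarrow>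
          \<delta> (a \<otimes>\<^bsub>raag V E\<^esub> b) = \<delta> a + frag_of (l (ab a)) * \<delta> b"
      for l :: "'h \<Rightarrow> 'h" and \<delta> :: "'v word set \<Rightarrow> 'h \<Rightarrow>\<^sub>0 int"
    proof -
      have one: "frag_of (l 0) = (1 :: 'h \<Rightarrow>\<^sub>0 int)"
        using additive.zero[OF l] by simp
      obtain f :: "'b chain set \<Rightarrow> 'h \<Rightarrow>\<^sub>0 int" where
        "\<And>a b. a \<in> carrier (cover.M) \<Longrightarrow> b \<in> carrier (cover.M) \<Longrightarrow>
          f (a \<otimes>\<^bsub>cover.M\<^esub> b) = f a + f b"
        "\<And>g. g \<in> carrier (raag V E) \<Longrightarrow> f (cover.D g) = \<delta> g"
        by (rule cover.ex_functional[of \<delta> "\<lambda>h. frag_of (l h)", OF \<delta> one]) (assumption | rule that)+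
      then show ?thesis by auto
    qed
  qed
  then show ?thesis
    using raag_abelianization_axioms scalars by (simp add: raag_module_def)
qed

theorem proposition4p13:
  fixes V :: "'v set" and E :: "'v set set"
    and \<psi> :: "'v word set set set \<Rightarrow> 'h::ab_group_add"
    and X :: "'a::t2_space set" and C :: "nat \<Rightarrow> ((nat \<Rightarrow> real) \<Rightarrow> 'a) set" and x0 :: 'a
    and \<phi> :: "(real \<Rightarrow> 'a) set \<Rightarrow> 'v word set"
    and X' :: "'b::topological_space set" and x0' :: 'b and p :: "'b \<Rightarrow> 'a"
    and \<tau> :: "'h \<Rightarrow> 'b \<Rightarrow> 'b"
    and \<Delta> :: "'h \<Rightarrow>\<^sub>0 int"
  assumes "finite V" and "V \<noteq> {}" and "simple_graph V E"
    and "alexander_cover X C (raag V E) \<psi> x0 \<phi> X' x0' p \<tau>"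
    and "is_alexander_polynomial (alexander_module X' p x0) (alexander_smult X' p x0 \<tau>) \<Delta>"
  shows "\<not> constant_up_to_unit \<Delta> \<longleftrightarrow> connectivity_one V E"
  by (rule raag_module.alexander_polynomial_nonconstant_iff[OF raag_module_alexander_module[OF assms(1,3,4)] assms(2,5)])

end
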